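(* Let $D$ satisfy (H1), (H2), (H3) as listed in the context, let $\mathbf{u}_0\in X_1$, and let $\mathbf{u}=(u,v)^T$ be the unique weak solution of the initial-boundary-value problem (P) with initial data $\mathbf{u}_0$. Consider the functional $$V(t)=\Phi(\mathbf{u}(t)):=\frac12\int_\Omega\left(u(\mathbf{x},t)^2+v(\mathbf{x},t)^2\right)d\Omega.$$ Then $V$ defines a Lyapunov function for (P).
   Context: $\Omega\subset\mathbb{R}^2$ is a bounded (typically rectangular) domain with boundary $\partial\Omega$ and outward normal $n$; $T>0$ is arbitrary, $Q_T=\Omega\times(0,T]$, $\overline{Q_T}=\overline\Omega\times[0,T]$. $X_k=H^k(\Omega)\times H^k(\Omega)$, with $H^0(\Omega)=L^2(\Omega)$. $J\mathbf{u}$ is the Jacobian matrix of $\mathbf{u}=(u,v)^T$ with respect to the space variables (rows $\nabla u$, $\nabla v$). The cross-diffusion matrix $D=(D_{ij})_{i,j=1,2}$ assigns to $\mathbf{u}:\overline{Q_T}\to\mathbb{R}^2$ the matrix-valued function $D(\mathbf{u})(\mathbf{x},t)=D(\mathbf{u}(\mathbf{x},t))\in M_{2\times2}(\mathbb{R})$. The hypotheses on $D$ are: (H1) there is $\alpha>0$ such that for each $\mathbf{u}:\overline{Q_T}\to\mathbb{R}^2$, $\xi^TD(\mathbf{u}(\mathbf{x},t))\xi\ge\alpha|\xi|^2$ for all $\xi\in\mathbb{R}^2$, $(\mathbf{x},t)\in\overline{Q_T}$; (H2) there is $L>0$ such that for all $\mathbf{u},\mathbf{v}:\overline{Q_T}\to\mathbb{R}^2$,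 $(\mathbf{x},t)\in\overline{Q_T}$, $i,j=1,2$, $|D_{ij}(\mathbf{v}(\mathbf{x},t))-D_{ij}(\mathbf{u}(\mathbf{x},t))|\le L|\mathbf{v}(\mathbf{x},t)-\mathbf{u}(\mathbf{x},t)|$; (H3) there is $M>0$ such that for each $\mathbf{u}:\overline{Q_T}\to\mathbb{R}^2$, $|D_{ij}(\mathbf{u}(\mathbf{x},t))|\le M$ for all $(\mathbf{x},t)\in\overline{Q_T}$, $i,j=1,2$. Problem (P), for $\mathbf{u}=(u,v)^T$ and $\mathbf{u}_0=(u_0,v_0)^T$: $$\partial_t u=\mathrm{div}(D_{11}(\mathbf{u})\nabla u+D_{12}(\mathbf{u})\nabla v),\quad \partial_t v=\mathrm{div}(D_{21}(\mathbf{u})\nabla u+D_{22}(\mathbf{u})\nabla v)\quad\text{in }Q_T,$$ with $u(\mathbf{x},0)=u_0(\mathbf{x})$, $v(\mathbf{x},0)=v_0(\mathbf{x})$ for $\mathbf{x}\in\Omega$, and on $\partial\Omega\times[0,T]$: $\langle D_{11}(\mathbf{u})\nabla u+D_{12}(\mathbf{u})\nabla v,n\rangle=0$, $\langle D_{21}(\mathbf{u})\nabla u+D_{22}(\mathbf{u})\nabla v,n\rangle=0$. A weak solution of (P) is $\mathbf{u}=(u,v)^T\in C(0,T,X_0)\cap L^2(0,T,X_1)$, with $\mathbf{u}(0)=\mathbf{u}_0$, such that for any $t\in(0,T]$ $$\int_\Omega\left((\partial_tu)w_1+(\partial_tv)w_2\right)d\Omega+\int_\Omega\mathrm{tr}\left((J\mathbf{w})^TD(\mathbf{u})(J\mathbf{u})\right)d\Omega=0\quad\text{for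 all }\mathbf{w}=(w_1,w_2)^T\in X_1,$$ where $\mathrm{tr}$ is the trace and the integral of a product of an element of $(H^1(\Omega))'$ and one of $H^1(\Omega)$ is understood as the duality pairing. Under (H1)-(H3), for $\mathbf{u}_0\in X_1$ the weak solution exists and is unique for every $T>0$. Lyapunov function: for $f\in L^2(\Omega)$ let $m(f)=\frac1{A(\Omega)}\int_\Omega f\,d\Omega$ with $A(\Omega)$ the area of $\Omega$, and $\mathbf{M}(\mathbf{u}_0)=(m(u_0),m(v_0))^T$, viewed as a constant function on $\Omega$. That $V(t)=\Phi(\mathbf{u}(t))$ is a Lyapunov function for (P) means that $\frac{d}{dt}V(t)\le0$ for $t\ge0$ and $\Phi(\mathbf{M}(\mathbf{u}_0))\le\Phi(\mathbf{u}(t))$ for $t\ge0$. *)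

theory Defs
  imports "HOL-Analysis.Analysis"
begin

text \<open>
  Elements of the function spaces are represented by functions, not by classes modulo
  almost-everywhere equality; all notions below are insensitive to the representative.
\<close>

definition L2 :: "(real^2) set \<Rightarrow> (real^2 \<Rightarrow> real) set" where
  "L2 \<Omega> = {f. f \<in> borel_measurable (lebesgue_on \<Omega>) \<and> integrable (lebesgue_on \<Omega>) (\<lambda>x. (f x)\<^sup>2)}"

definition partial_deriv :: "2 \<Rightarrow> (real^2 \<Rightarrow> real) \<Rightarrow> real^2 \<Rightarrow> real" where
  "partial_deriv i \<phi> x = frechet_derivative \<phi> (at x) (axis i 1)"

primrec Ck :: "nat \<Rightarrow> (real^2 \<Rightarrow> real) \<Rightarrow> bool" where
  "Ck 0 \<phi> \<longleftrightarrow> continuous_on UNIV \<phi>"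
| "Ck (Suc k) \<phi> \<longleftrightarrow> (\<forall>x. \<phi> differentiable (at x)) \<and> (\<forall>i. Ck k (partial_deriv i \<phi>))"

definition test_functions :: "(real^2) set \<Rightarrow> (real^2 \<Rightarrow> real) set" where
  "test_functions \<Omega> = {\<phi>. (\<forall>k. Ck k \<phi>) \<and> (\<exists>K. compact K \<and> K \<subseteq> \<Omega> \<and> (\<forall>x. x \<notin> K \<longrightarrow> \<phi> x = 0))}"

definition has_weak_gradient :: "(real^2) set \<Rightarrow> (real^2 \<Rightarrow> real) \<Rightarrow> (real^2 \<Rightarrow> real^2) \<Rightarrow> bool" where
  "has_weak_gradient \<Omega> f g \<longleftrightarrow>
     (\<forall>i. (\<lambda>x. g x $ i) \<in> L2 \<Omega>) \<and>
     (\<forall>\<phi>\<in>test_functions \<Omega>. \<forall>i.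
        (\<integral>x. f x * partial_deriv i \<phi> x \<partial>lebesgue_on \<Omega>) = - (\<integral>x. g x $ i * \<phi> x \<partial>lebesgue_on \<Omega>))"

definition H1 :: "(real^2) set \<Rightarrow> (real^2 \<Rightarrow> real) set" where
  "H1 \<Omega> = {f \<in> L2 \<Omega>. \<exists>g. has_weak_gradient \<Omega> f g}"

text \<open>The weak gradient is unique up to null sets; the choice operator picks a representative.\<close>

definition weak_gradient :: "(real^2) set \<Rightarrow> (real^2 \<Rightarrow> real) \<Rightarrow> real^2 \<Rightarrow> real^2" where
  "weak_gradient \<Omega> f = (SOME g. has_weak_gradient \<Omega> f g)"

definition norm_H1 :: "(real^2) set \<Rightarrow> (real^2 \<Rightarrow> real) \<Rightarrow> real" where
  "norm_H1 \<Omega> f = sqrt ((\<integral>x. (f x)\<^sup>2 \<partial>lebesgue_on \<Omega>) + (\<integral>x. (norm (weak_gradient \<Omega> f x))\<^sup>2 \<partial>lebesgue_on \<Omega>))"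

definition X0 :: "(real^2) set \<Rightarrow> (real^2 \<Rightarrow> real^2) set" where
  "X0 \<Omega> = {f. \<forall>i. (\<lambda>x. f x $ i) \<in> L2 \<Omega>}"

definition X1 :: "(real^2) set \<Rightarrow> (real^2 \<Rightarrow> real^2) set" where
  "X1 \<Omega> = {f. \<forall>i. (\<lambda>x. f x $ i) \<in> H1 \<Omega>}"

definition norm_X0 :: "(real^2) set \<Rightarrow> (real^2 \<Rightarrow> real^2) \<Rightarrow> real" where
  "norm_X0 \<Omega> f = sqrt (\<Sum>i\<in>UNIV. \<integral>x. (f x $ i)\<^sup>2 \<partial>lebesgue_on \<Omega>)"

definition norm_X1 :: "(real^2) set \<Rightarrow> (real^2 \<Rightarrow> real^2) \<Rightarrow> real" where
  "norm_X1 \<Omega> f = sqrt (\<Sum>i\<in>UNIV. (norm_H1 \<Omega> (\<lambda>x. f x $ i))\<^sup>2)"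

definition weak_jacobian :: "(real^2) set \<Rightarrow> (real^2 \<Rightarrow> real^2) \<Rightarrow> real^2 \<Rightarrow> real^2^2" where
  "weak_jacobian \<Omega> f x = (\<chi> i. weak_gradient \<Omega> (\<lambda>y. f y $ i) x)"

definition C_X0 :: "(real^2) set \<Rightarrow> real \<Rightarrow> (real \<Rightarrow> real^2 \<Rightarrow> real^2) set" where
  "C_X0 \<Omega> T = {u. (\<forall>t\<in>{0..T}. u t \<in> X0 \<Omega>) \<and>
     (\<forall>t\<in>{0..T}. ((\<lambda>s. norm_X0 \<Omega> (\<lambda>x. u s x - u t x)) \<longlongrightarrow> 0) (at t within {0..T}))}"

text \<open>The Bochner space; the simple functions \<open>s n\<close> express strong measurability.\<close>

definition L2_X1 :: "(real^2) set \<Rightarrow> real \<Rightarrow> (real \<Rightarrow> real^2 \<Rightarrow> real^2) set" where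
  "L2_X1 \<Omega> T = {u.
     (AE t in lebesgue_on {0..T}. u t \<in> X1 \<Omega>) \<and>
     (\<exists>s :: nat \<Rightarrow> real \<Rightarrow> real^2 \<Rightarrow> real^2.
        (\<forall>n. simple_function (lebesgue_on {0..T}) (s n) \<and> (\<forall>t\<in>{0..T}. s n t \<in> X1 \<Omega>)) \<and>
        (AE t in lebesgue_on {0..T}. (\<lambda>n. norm_X1 \<Omega> (\<lambda>x. s n t x - u t x)) \<longlonglongrightarrow> 0)) \<and>
     integrable (lebesgue_on {0..T}) (\<lambda>t. (norm_X1 \<Omega> (u t))\<^sup>2)}"

definition H1_dual :: "(real^2) set \<Rightarrow> ((real^2 \<Rightarrow> real) \<Rightarrow> real) set" where
  "H1_dual \<Omega> = {l.
     (\<forall>f\<in>H1 \<Omega>. \<forall>g\<in>H1 \<Omega>. l (\<lambda>x. f x + g x) = l f + l g) \<and>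
     (\<forall>f\<in>H1 \<Omega>. \<forall>c. l (\<lambda>x. c * f x) = c * l f) \<and>
     (\<exists>C. \<forall>f\<in>H1 \<Omega>. \<bar>l f\<bar> \<le> C * norm_H1 \<Omega> f)}"

definition norm_H1_dual :: "(real^2) set \<Rightarrow> ((real^2 \<Rightarrow> real) \<Rightarrow> real) \<Rightarrow> real" where
  "norm_H1_dual \<Omega> l = (SUP f\<in>{f \<in> H1 \<Omega>. norm_H1 \<Omega> f \<le> 1}. \<bar>l f\<bar>)"

definition L2_embed :: "(real^2) set \<Rightarrow> (real^2 \<Rightarrow> real) \<Rightarrow> (real^2 \<Rightarrow> real) \<Rightarrow> real" where
  "L2_embed \<Omega> f w = (\<integral>x. f x * w x \<partial>lebesgue_on \<Omega>)"

text \<open>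
  The time derivative at \<open>t\<close> (one-sided at end points of \<open>S\<close>) of a curve in \<open>L\<^sup>2\<close>, regarded as a
  curve in the dual of \<open>H\<^sup>1\<close> through the embedding above: convergence of the difference
  quotients in the norm of the dual.
\<close>

definition has_time_derivative ::
    "(real^2) set \<Rightarrow> (real \<Rightarrow> real^2 \<Rightarrow> real) \<Rightarrow> ((real^2 \<Rightarrow> real) \<Rightarrow> real) \<Rightarrow> real \<Rightarrow> real set \<Rightarrow> bool" where
  "has_time_derivative \<Omega> f l t S \<longleftrightarrow> l \<in> H1_dual \<Omega> \<and>
     ((\<lambda>s. norm_H1_dual \<Omega> (\<lambda>w. (L2_embed \<Omega> (f s) w - L2_embed \<Omega> (f t) w) / (s - t) - l w)) \<longlongrightarrow> 0)
       (at t within S)"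

text \<open>
  The matrix at a point of space-time depends only on the value of the unknown there, and that
  value ranges over the whole plane when the unknown ranges over all functions; so the
  hypotheses on the cross-diffusion matrix are conditions on all values \<open>y\<close>, \<open>z\<close>.
\<close>

definition uniformly_elliptic :: "(real^2 \<Rightarrow> real^2^2) \<Rightarrow> bool" where
  "uniformly_elliptic D \<longleftrightarrow> (\<exists>\<alpha>>0. \<forall>z \<xi>. \<xi> \<bullet> (D z *v \<xi>) \<ge> \<alpha> * (norm \<xi>)\<^sup>2)"

definition entries_lipschitz :: "(real^2 \<Rightarrow> real^2^2) \<Rightarrow> bool" where
  "entries_lipschitz D \<longleftrightarrow> (\<exists>L>0. \<forall>y z i j. \<bar>D z $ i $ j - D y $ i $ j\<bar> \<le> L * norm (z - y))"

definition entries_bounded :: "(real^2 \<Rightarrow> real^2^2) \<Rightarrow> bool" where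
  "entries_bounded D \<longleftrightarrow> (\<exists>M>0. \<forall>z i j. \<bar>D z $ i $ j\<bar> \<le> M)"

definition weak_solution ::
    "(real^2) set \<Rightarrow> (real^2 \<Rightarrow> real^2^2) \<Rightarrow> (real^2 \<Rightarrow> real^2) \<Rightarrow> real \<Rightarrow> (real \<Rightarrow> real^2 \<Rightarrow> real^2) \<Rightarrow> bool"
  where
  "weak_solution \<Omega> D u0 T u \<longleftrightarrow>
     u \<in> C_X0 \<Omega> T \<inter> L2_X1 \<Omega> T \<and>
     (AE x in lebesgue_on \<Omega>. u 0 x = u0 x) \<and>
     (\<forall>t\<in>{0<..T}. u t \<in> X1 \<Omega> \<and>
        (\<exists>l1 l2. has_time_derivative \<Omega> (\<lambda>s x. u s x $ 1) l1 t {0..T} \<and>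
                 has_time_derivative \<Omega> (\<lambda>s x. u s x $ 2) l2 t {0..T} \<and>
                 (\<forall>w\<in>X1 \<Omega>. l1 (\<lambda>x. w x $ 1) + l2 (\<lambda>x. w x $ 2) +
                    (\<integral>x. trace (transpose (weak_jacobian \<Omega> w x) ** D (u t x) ** weak_jacobian \<Omega> (u t) x)
                      \<partial>lebesgue_on \<Omega>) = 0)))"

definition mean :: "(real^2) set \<Rightarrow> (real^2 \<Rightarrow> real) \<Rightarrow> real" where
  "mean \<Omega> f = (1 / measure lebesgue \<Omega>) * (\<integral>x. f x \<partial>lebesgue_on \<Omega>)"

definition mean_vec :: "(real^2) set \<Rightarrow> (real^2 \<Rightarrow> real^2) \<Rightarrow> real^2" where
  "mean_vec \<Omega> f = (\<chi> i. mean \<Omega> (\<lambda>x. f x $ i))"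

definition energy :: "(real^2) set \<Rightarrow> (real^2 \<Rightarrow> real^2) \<Rightarrow> real" where
  "energy \<Omega> f = 1 / 2 * (\<integral>x. (f x $ 1)\<^sup>2 + (f x $ 2)\<^sup>2 \<partial>lebesgue_on \<Omega>)"

definition lyapunov ::
    "(real^2) set \<Rightarrow> (real^2 \<Rightarrow> real^2) \<Rightarrow> (real \<Rightarrow> real^2 \<Rightarrow> real^2) \<Rightarrow> ((real^2 \<Rightarrow> real^2) \<Rightarrow> real) \<Rightarrow> bool"
  where
  "lyapunov \<Omega> u0 u \<Phi> \<longleftrightarrow>
     (\<forall>t\<ge>0. \<exists>V'. ((\<lambda>s. \<Phi> (u s)) has_real_derivative V') (at t within {0..}) \<and> V' \<le> 0) \<and>
     (\<forall>t\<ge>0. \<Phi> (\<lambda>_. mean_vec \<Omega> u0) \<le> \<Phi> (u t))"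

end

theory Submission
  imports Defs "HOL-Computational_Algebra.Polynomial"
begin

text \<open>
  Write \<open>b(v; y, w)\<close> for the diffusion form, \<open>J\<close> for the weak Jacobian and \<open>V(t)\<close> for the energy of
  \<open>u(t)\<close>. The expected derivative is \<open>V'(t) = - b(u(t); u(t), u(t))\<close>, which is nonpositive by
  ellipticity. No regularity of \<open>s \<mapsto> u(s)\<close> in \<open>H\<^sup>1\<close> is available, so with \<open>z = u(t)\<close> one has to show that
  \<open>\<phi>(s) = 1/2 \<parallel>u(s) - z\<parallel>\<^sup>2\<close> is \<open>o(s - t)\<close>. Differentiating \<open>\<phi>\<close> only from the left and from above
  allows one to drop the quadratic increment, so \<open>\<phi>\<close> plus a linear functional has at \<open>s\<close> an upper left
  Dini derivative controlled by the equation at time \<open>s\<close>.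

  Near \<open>z\<close> the form satisfies
  \<open>- b(v; v, v - z + y) \<le> - \<alpha>/2 \<parallel>J(v - z)\<parallel>\<^sup>2 - b(z; z, y) + \<epsilon>\<close>, because the terms linear in \<open>J(v - z)\<close>
  are small when \<open>v\<close> is \<open>L\<^sup>2\<close>-close to \<open>z\<close>: approximate their coefficients by test functions and integrate
  by parts. Taking \<open>y = z\<close> and \<open>y = - z\<close> gives the right derivative, also at \<open>t = 0\<close>.

  For the left derivative put \<open>h = t - s\<close> and \<open>G = \<parallel>J(u(s) - z)\<parallel>\<close>. Differentiability at \<open>t\<close> in the dual
  norm, tested with \<open>u(s) - z\<close>, gives \<open>\<phi> \<le> \<epsilon> h (1 + G)\<close>, while the Dini derivative of \<open>\<phi>\<close> is at most
  \<open>- \<alpha>/2 G\<^sup>2 + \<epsilon>\<close>. By Young's inequality it is at most \<open>c - 2\<phi>/h\<close> with \<open>c = O(\<epsilon>)\<close>, so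
  \<open>\<phi>/h\<^sup>2 - c/h\<close> is nonincreasing and \<open>\<phi> \<le> c h + O(h\<^sup>2)\<close>.

  Constants are admissible test functions with vanishing Jacobian, so the mean is conserved, and the
  lower bound is the orthogonality of \<open>u(t) - M(u\<^sub>0)\<close> and \<open>M(u\<^sub>0)\<close>.
\<close>

section \<open>Square-integrable functions\<close>

text \<open>Values in any Euclidean space let one calculus serve scalar functions, planar fields and
  matrix-valued Jacobians. Functions are not identified almost everywhere, so identities of weak
  derivatives enter through \<open>l2norm_cong_AE\<close> and
  \<open>l2inner_cong_AE\<close>.\<close>

definition sq_integrable :: "'a measure \<Rightarrow> ('a \<Rightarrow> 'b::euclidean_space) \<Rightarrow> bool" where
  "sq_integrable M f \<longleftrightarrow> f \<in> borel_measurable M \<and> integrable M (\<lambda>x. (norm (f x))\<^sup>2)"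

definition l2inner :: "'a measure \<Rightarrow> ('a \<Rightarrow> 'b::euclidean_space) \<Rightarrow> ('a \<Rightarrow> 'b) \<Rightarrow> real" where
  "l2inner M f g = (\<integral>x. f x \<bullet> g x \<partial>M)"

definition l2norm :: "'a measure \<Rightarrow> ('a \<Rightarrow> 'b::euclidean_space) \<Rightarrow> real" where
  "l2norm M f = sqrt (\<integral>x. (norm (f x))\<^sup>2 \<partial>M)"

lemma l2norm_nonneg [simp]: "0 \<le> l2norm M f"
  by (simp add: l2norm_def)

lemma l2norm_sq: "(l2norm M f)\<^sup>2 = (\<integral>x. (norm (f x))\<^sup>2 \<partial>M)"
  by (simp add: l2norm_def)

lemma l2norm_sq_inner: "(l2norm M f)\<^sup>2 = l2inner M f f"
  by (simp add: l2norm_sq l2inner_def power2_norm_eq_inner)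

lemma l2inner_commute: "l2inner M f g = l2inner M g f"
  by (simp add: l2inner_def inner_commute)

lemma sq_integrable_borel [measurable_dest]: "sq_integrable M f \<Longrightarrow> f \<in> borel_measurable M"
  by (simp add: sq_integrable_def)

lemma sq_integrable_zero [simp]: "sq_integrable M (\<lambda>x. 0)"
  by (simp add: sq_integrable_def)

lemma sq_integrable_inner:
  assumes "sq_integrable M f" "sq_integrable M g"
  shows "integrable M (\<lambda>x. f x \<bullet> g x)"
proof (rule Bochner_Integration.integrable_bound)
  show "integrable M (\<lambda>x. (norm (f x))\<^sup>2 + (norm (g x))\<^sup>2)"
    using assms by (simp add: sq_integrable_def)
  have "\<bar>a \<bullet> b\<bar> \<le> (norm a)\<^sup>2 + (norm b)\<^sup>2" for a b :: 'b
  proof -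
    have "\<bar>a \<bullet> b\<bar> \<le> norm a * norm b" by (rule Cauchy_Schwarz_ineq2)
    also have "\<dots> \<le> (norm a)\<^sup>2 + (norm b)\<^sup>2"
      using sum_squares_bound[of "norm a" "norm b"] mult_nonneg_nonneg[OF norm_ge_zero[of a] norm_ge_zero[of b]] by linarith
    finally show ?thesis .
  qed
  then show "AE x in M. norm (f x \<bullet> g x) \<le> norm ((norm (f x))\<^sup>2 + (norm (g x))\<^sup>2)"
    by simp
qed (use assms in \<open>auto dest!: sq_integrable_borel\<close>)

lemma sq_integrable_bound:
  assumes "sq_integrable M f" "g \<in> borel_measurable M" "\<And>x. x \<in> space M \<Longrightarrow> norm (g x) \<le> c * norm (f x)"
  shows "sq_integrable M g"
  unfolding sq_integrable_def
proof
  show "integrable M (\<lambda>x. (norm (g x))\<^sup>2)"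
  proof (rule Bochner_Integration.integrable_bound)
    show "integrable M (\<lambda>x. c\<^sup>2 * (norm (f x))\<^sup>2)"
      using assms(1) by (simp add: sq_integrable_def)
    show "AE x in M. norm ((norm (g x))\<^sup>2) \<le> norm (c\<^sup>2 * (norm (f x))\<^sup>2)"
    proof (rule AE_I2)
      fix x assume "x \<in> space M"
      then have "(norm (g x))\<^sup>2 \<le> (c * norm (f x))\<^sup>2" by (intro power_mono assms(3)) auto
      then show "norm ((norm (g x))\<^sup>2) \<le> norm (c\<^sup>2 * (norm (f x))\<^sup>2)" by (simp add: power_mult_distrib)
    qed
  qed (use assms in simp)
qed fact

lemma l2norm_bound:
  assumes "sq_integrable M f" "g \<in> borel_measurable M" "0 \<le> c"
    and le: "\<And>x. x \<in> space M \<Longrightarrow> norm (g x) \<le> c * norm (f x)"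
  shows "l2norm M g \<le> c * l2norm M f"
proof -
  have g: "sq_integrable M g" using sq_integrable_bound[OF assms(1,2) le] .
  have "(l2norm M g)\<^sup>2 \<le> (\<integral>x. c\<^sup>2 * (norm (f x))\<^sup>2 \<partial>M)"
    unfolding l2norm_sq
  proof (rule integral_mono)
    fix x assume "x \<in> space M"
    then have "(norm (g x))\<^sup>2 \<le> (c * norm (f x))\<^sup>2" by (intro power_mono le) auto
    then show "(norm (g x))\<^sup>2 \<le> c\<^sup>2 * (norm (f x))\<^sup>2" by (simp add: power_mult_distrib)
  qed (use g assms(1) in \<open>auto simp: sq_integrable_def\<close>)
  also have "\<dots> = (c * l2norm M f)\<^sup>2" by (simp add: power_mult_distrib l2norm_sq)
  finally show ?thesis by (rule power2_le_imp_le) (use \<open>0 \<le> c\<close> in simp)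
qed

lemma sq_integrable_scaleR [intro]:
  assumes "sq_integrable M f" shows "sq_integrable M (\<lambda>x. c *\<^sub>R f x)"
  using assms by (intro sq_integrable_bound[OF assms, where c="\<bar>c\<bar>"]) (auto dest!: sq_integrable_borel)

lemma sq_integrable_minus [intro]:
  assumes "sq_integrable M f" shows "sq_integrable M (\<lambda>x. - f x)"
  using sq_integrable_scaleR[OF assms, of "-1"] by simp

lemma sq_integrable_add [intro]:
  assumes f: "sq_integrable M f" and g: "sq_integrable M g" shows "sq_integrable M (\<lambda>x. f x + g x)"
  unfolding sq_integrable_def
proof
  have "(norm (f x + g x))\<^sup>2 = (norm (f x))\<^sup>2 + 2 * (f x \<bullet> g x) + (norm (g x))\<^sup>2" for x
    by (simp add: power2_norm_eq_inner inner_simps inner_commute)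
  then show "integrable M (\<lambda>x. (norm (f x + g x))\<^sup>2)"
    using f g sq_integrable_inner[OF f g] by (simp add: sq_integrable_def)
qed (use assms in \<open>auto dest!: sq_integrable_borel\<close>)

lemma sq_integrable_diff [intro]:
  assumes f: "sq_integrable M f" and g: "sq_integrable M g" shows "sq_integrable M (\<lambda>x. f x - g x)"
  using sq_integrable_add[OF f sq_integrable_minus[OF g]] by simp

lemma l2norm_cong_AE:
  assumes "f \<in> borel_measurable M" "g \<in> borel_measurable M" "AE x in M. f x = g x"
  shows "l2norm M f = l2norm M g"
  unfolding l2norm_def by (rule arg_cong[where f=sqrt], rule integral_cong_AE) (use assms in auto)

lemma l2inner_cong_AE:
  assumes "f \<in> borel_measurable M" "g \<in> borel_measurable M" "h \<in> borel_measurable M"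
    "AE x in M. f x = g x"
  shows "l2inner M f h = l2inner M g h"
  unfolding l2inner_def by (rule integral_cong_AE) (use assms in auto)

lemma l2inner_add_left:
  assumes "sq_integrable M f" "sq_integrable M g" "sq_integrable M h"
  shows "l2inner M (\<lambda>x. f x + g x) h = l2inner M f h + l2inner M g h"
  using assms by (simp add: l2inner_def inner_add_left sq_integrable_inner)

lemma l2inner_diff_left:
  assumes "sq_integrable M f" "sq_integrable M g" "sq_integrable M h"
  shows "l2inner M (\<lambda>x. f x - g x) h = l2inner M f h - l2inner M g h"
  using assms by (simp add: l2inner_def inner_diff_left sq_integrable_inner)

lemma l2inner_scaleR_left: "l2inner M (\<lambda>x. c *\<^sub>R f x) h = c * l2inner M f h"
  by (simp add: l2inner_def)

lemma l2inner_minus_left: "l2inner M (\<lambda>x. - f x) h = - l2inner M f h"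
  by (simp add: l2inner_def)

lemma l2inner_add_right:
  assumes "sq_integrable M f" "sq_integrable M g" "sq_integrable M h"
  shows "l2inner M h (\<lambda>x. f x + g x) = l2inner M h f + l2inner M h g"
  using l2inner_add_left[OF assms] by (simp add: l2inner_commute)

lemma l2inner_diff_right:
  assumes "sq_integrable M f" "sq_integrable M g" "sq_integrable M h"
  shows "l2inner M h (\<lambda>x. f x - g x) = l2inner M h f - l2inner M h g"
  using l2inner_diff_left[OF assms] by (simp add: l2inner_commute)

lemma l2inner_minus_right: "l2inner M h (\<lambda>x. - f x) = - l2inner M h f"
  by (simp add: l2inner_def)

lemma l2norm_scaleR: "l2norm M (\<lambda>x. c *\<^sub>R f x) = \<bar>c\<bar> * l2norm M f"
  by (simp add: l2norm_def power_mult_distrib real_sqrt_mult)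

lemma l2norm_minus: "l2norm M (\<lambda>x. - f x) = l2norm M f"
  by (simp add: l2norm_def)

lemma l2norm_sq_add:
  assumes f: "sq_integrable M f" and g: "sq_integrable M g"
  shows "(l2norm M (\<lambda>x. f x + g x))\<^sup>2 = (l2norm M f)\<^sup>2 + 2 * l2inner M f g + (l2norm M g)\<^sup>2"
  using assms
  by (simp add: l2norm_sq_inner l2inner_add_left l2inner_add_right sq_integrable_add l2inner_commute[of M g f])

text \<open>The squared norm of \<open>f + t g\<close> is a quadratic polynomial in \<open>t\<close>
  that is never negative; its values at well-chosen \<open>t\<close> give the discriminant
  inequality.\<close>

lemma l2_Cauchy_Schwarz:
  assumes f: "sq_integrable M f" and g: "sq_integrable M g"
  shows "\<bar>l2inner M f g\<bar> \<le> l2norm M f * l2norm M g"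
proof -
  let ?A = "(l2norm M f)\<^sup>2" and ?B = "l2inner M f g" and ?C = "(l2norm M g)\<^sup>2"
  have q: "0 \<le> ?A + 2 * t * ?B + t\<^sup>2 * ?C" for t
  proof -
    have "0 \<le> (l2norm M (\<lambda>x. f x + t *\<^sub>R g x))\<^sup>2" by simp
    then show ?thesis
      using l2norm_sq_add[OF f sq_integrable_scaleR[OF g], of t]
      by (simp add: l2norm_scaleR power_mult_distrib l2inner_commute[of M f] l2inner_scaleR_left)
  qed
  have "?B\<^sup>2 \<le> ?A * ?C"
  proof (cases "?C = 0")
    case True
    have "?B = 0"
    proof (rule ccontr)
      assume "?B \<noteq> 0"
      \<comment> \<open>Without a quadratic term the polynomial is affine, and at this
        \<open>t\<close> it takes the value -1.\<close>
      then show False using q[of "- (?A + 1) / (2 * ?B)"] True by (simp add: field_simps)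
    qed
    then show ?thesis by simp
  next
    case False
    then have C: "0 < ?C" by simp
    \<comment> \<open>The quadratic is minimal at \<open>- ?B / ?C\<close>.\<close>
    have "0 \<le> ?C * (?A + 2 * (- ?B / ?C) * ?B + (- ?B / ?C)\<^sup>2 * ?C)"
      using q[of "- ?B / ?C"] C by (intro mult_nonneg_nonneg) auto
    also have "\<dots> = ?A * ?C - ?B\<^sup>2"
      using False by (simp add: algebra_simps power_divide) (simp add: power2_eq_square field_simps)
    finally show ?thesis by simp
  qed
  then have "\<bar>?B\<bar>\<^sup>2 \<le> (l2norm M f * l2norm M g)\<^sup>2" by (simp add: power_mult_distrib)
  then show ?thesis by (rule power2_le_imp_le) simp
qed

lemma l2norm_triangle:
  assumes f: "sq_integrable M f" and g: "sq_integrable M g"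
  shows "l2norm M (\<lambda>x. f x + g x) \<le> l2norm M f + l2norm M g"
proof (rule power2_le_imp_le)
  show "(l2norm M (\<lambda>x. f x + g x))\<^sup>2 \<le> (l2norm M f + l2norm M g)\<^sup>2"
    using l2_Cauchy_Schwarz[OF f g] by (simp add: l2norm_sq_add[OF f g] power2_sum)
qed simp

lemma l2norm_eq_0_AE:
  assumes "sq_integrable M f" "l2norm M f = 0" shows "AE x in M. f x = 0"
proof -
  have "(\<integral>x. (norm (f x))\<^sup>2 \<partial>M) = 0" using assms(2) l2norm_sq[of M f] by simp
  then show ?thesis
    using integral_nonneg_eq_0_iff_AE[of M "\<lambda>x. (norm (f x))\<^sup>2"] assms(1) by (simp add: sq_integrable_def)
qed

lemma sq_integrable_bounded:
  assumes "finite_measure M" "f \<in> borel_measurable M" "\<And>x. x \<in> space M \<Longrightarrow> norm (f x) \<le> c"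
  shows "sq_integrable M f"
  unfolding sq_integrable_def
proof
  interpret finite_measure M by fact
  show "integrable M (\<lambda>x. (norm (f x))\<^sup>2)"
  proof (rule integrable_const_bound)
    show "AE x in M. norm ((norm (f x))\<^sup>2) \<le> c\<^sup>2" by (rule AE_I2) (simp add: assms(3) power_mono)
  qed (use assms in simp)
qed fact

section \<open>Smooth functions and bump functions\<close>

lemma partial_deriv_eqI:
  "(f has_derivative f') (at x) \<Longrightarrow> partial_deriv i f x = f' (axis i 1)"
  by (simp add: partial_deriv_def frechet_derivative_at[symmetric])

lemma Ck_Suc_D: "Ck (Suc k) f \<Longrightarrow> Ck k f"
proof (induction k arbitrary: f)
  case 0
  then show ?case
    by (auto simp: continuous_on_eq_continuous_at intro: differentiable_imp_continuous_within)
next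
  case (Suc k)
  then show ?case by (metis Ck.simps(2))
qed

lemma partial_deriv_const: "partial_deriv i (\<lambda>x. c) = (\<lambda>x. 0)"
  by (rule ext, subst partial_deriv_eqI[of _ "\<lambda>x. 0"]) auto

lemma Ck_const: "Ck k (\<lambda>x. c)"
  by (induction k arbitrary: c) (auto simp: partial_deriv_const)

lemma Ck_nth: "Ck k (\<lambda>x. x $ i)"
proof (cases k)
  case 0
  then show ?thesis by (auto intro: continuous_intros)
next
  case (Suc n)
  have d: "((\<lambda>x::real^2. x $ i) has_derivative (\<lambda>x. x $ i)) (at x)" for x
    by (rule bounded_linear_imp_has_derivative) (rule bounded_linear_vec_nth)
  have "partial_deriv j (\<lambda>x. x $ i) = (\<lambda>x. axis j 1 $ i)" for j
    by (rule ext) (rule partial_deriv_eqI[OF d])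
  then show ?thesis
    using Suc d by (auto simp: Ck_const differentiable_def)
qed

lemma Ck_add: "Ck k f \<Longrightarrow> Ck k g \<Longrightarrow> Ck k (\<lambda>x. f x + g x)"
proof (induction k arbitrary: f g)
  case (Suc k)
  have "partial_deriv i (\<lambda>x. f x + g x) = (\<lambda>x. partial_deriv i f x + partial_deriv i g x)" for i
  proof
    fix x
    show "partial_deriv i (\<lambda>x. f x + g x) x = partial_deriv i f x + partial_deriv i g x"
      using Suc.prems
      by (subst partial_deriv_eqI[of _ "\<lambda>h. frechet_derivative f (at x) h + frechet_derivative g (at x) h"])
        (auto simp: partial_deriv_def frechet_derivative_works[symmetric] intro!: has_derivative_add)
  qed
  then show ?case using Suc by auto
qed (auto intro: continuous_intros)

lemma Ck_mult: "Ck k f \<Longrightarrow> Ck k g \<Longrightarrow> Ck k (\<lambda>x. f x * g x)"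
proof (induction k arbitrary: f g)
  case (Suc k)
  have "partial_deriv i (\<lambda>x. f x * g x) = (\<lambda>x. f x * partial_deriv i g x + partial_deriv i f x * g x)" for i
  proof
    fix x
    show "partial_deriv i (\<lambda>x. f x * g x) x = f x * partial_deriv i g x + partial_deriv i f x * g x"
      using Suc.prems
      by (subst partial_deriv_eqI[of _ "\<lambda>h. f x * frechet_derivative g (at x) h + frechet_derivative f (at x) h * g x"])
        (auto simp: partial_deriv_def frechet_derivative_works[symmetric] intro!: has_derivative_mult)
  qed
  \<comment> \<open>The product rule leaves one factor undifferentiated, so the induction hypothesis
    is also applied to \<open>f\<close> and \<open>g\<close> themselves, one order lower.\<close>
  moreover have "Ck k f" "Ck k g" using Suc.prems by (auto intro: Ck_Suc_D simp del: Ck.simps)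
  ultimately show ?case using Suc by (auto intro!: Ck_add Suc.IH)
qed (auto intro: continuous_intros)

lemma Ck_continuous: "Ck k f \<Longrightarrow> continuous_on UNIV f"
  by (induction k) (use Ck_Suc_D in auto)

text \<open>The functions \<open>p(1/x) exp(-1/x)\<close> form a class closed under differentiation, which makes
  smoothness of the usual bump function an induction.\<close>

definition flat :: "real poly \<Rightarrow> real \<Rightarrow> real" where
  "flat p x = (if x > 0 then poly p (inverse x) * exp (- inverse x) else 0)"

text \<open>Substituting \<open>y = 1/x\<close> turns the limit into the decay of a polynomial
  against \<open>exp y\<close>, checked monomial by monomial.\<close>

lemma flat_tendsto_0: "(flat p \<longlongrightarrow> 0) (at_right 0)"
proof -
  have "((\<lambda>y. \<Sum>i\<le>degree p. coeff p i * (y ^ i / exp y)) \<longlongrightarrow> (\<Sum>i\<le>degree p. coeff p i * 0)) at_top"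
    by (intro tendsto_sum tendsto_mult tendsto_const tendsto_power_div_exp_0)
  then have "((\<lambda>y. poly p y * exp (- y)) \<longlongrightarrow> 0) at_top"
    by (simp add: poly_altdef sum_distrib_right exp_minus divide_inverse mult.assoc)
  then have "((\<lambda>x. poly p (inverse x) * exp (- inverse x)) \<longlongrightarrow> 0) (at_right 0)"
    by (rule filterlim_compose[OF _ filterlim_inverse_at_top_right])
  then show ?thesis
    by (rule tendsto_cong[THEN iffD1, rotated]) (auto simp: eventually_at_filter flat_def)
qed

text \<open>To the right of 0 this is the chain rule: with \<open>y = 1/x\<close>, the derivative of
  \<open>p(y) exp (- y)\<close> in \<open>x\<close> is \<open>y^2 (p(y) - p'(y)) exp (- y)\<close>,
  and \<open>[:0, 0, 1:]\<close> is the polynomial \<open>y^2\<close>. At 0 the formula gives 0, and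
  the difference quotient is shown to vanish from both sides.\<close>

lemma flat_has_derivative:
  "(flat p has_real_derivative flat ([:0, 0, 1:] * (p - pderiv p)) x) (at x)"
proof (cases x "0 :: real" rule: linorder_cases)
  case less
  have "((\<lambda>x. 0) has_real_derivative 0) (at x)" by simp
  then have "(flat p has_real_derivative 0) (at x)"
    by (rule DERIV_cong_ev[OF refl _ refl, THEN iffD1, rotated])
      (use less eventually_nhds_in_open[of "{..<0}" x] in \<open>auto elim!: eventually_mono simp: flat_def\<close>)
  then show ?thesis using less by (simp add: flat_def)
next
  case greater
  have "((\<lambda>x. poly p (inverse x) * exp (- inverse x)) has_real_derivative
      flat ([:0, 0, 1:] * (p - pderiv p)) x) (at x)"
    using greater
    by (auto intro!: derivative_eq_intros DERIV_chain2[of "poly p", OF poly_DERIV] simp: flat_def)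
      (simp add: field_simps power2_eq_square)
  then show ?thesis
    by (rule DERIV_cong_ev[OF refl _ refl, THEN iffD1, rotated])
      (use greater eventually_nhds_in_open[of "{0<..}" x] in \<open>auto elim!: eventually_mono simp: flat_def\<close>)
next
  case equal
  \<comment> \<open>For positive \<open>h\<close>, dividing by \<open>h\<close> multiplies the
    polynomial by its variable, so the quotient is again a flat function.\<close>
  have "((\<lambda>h. flat p h / h) \<longlongrightarrow> 0) (at_right 0)"
    using flat_tendsto_0[of "[:0, 1:] * p"]
    by (rule tendsto_cong[THEN iffD1, rotated])
      (auto simp: eventually_at_filter flat_def field_simps)
  moreover have "((\<lambda>h. flat p h / h) \<longlongrightarrow> 0) (at_left 0)"
    by (rule tendsto_eventually) (auto simp: eventually_at_filter flat_def)
  ultimately have "((\<lambda>h. flat p h / h) \<longlongrightarrow> 0) (at 0)"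
    by (rule filterlim_split_at_real[rotated])
  then show ?thesis
    using equal by (simp add: has_field_derivative_iff flat_def[of _ 0])
qed

text \<open>The induction runs over all polynomials at once, because each derivative replaces
  \<open>p\<close> by another one while the inner function \<open>g\<close> stays the same.\<close>

lemma Ck_flat:
  assumes "\<And>k. Ck k g"
  shows "Ck k (\<lambda>x. flat p (g x))"
proof (induction k arbitrary: p)
  case 0
  have "continuous_on UNIV (flat p)"
    by (rule DERIV_continuous_on) (rule has_field_derivative_at_within[OF flat_has_derivative])
  then have "continuous_on UNIV (\<lambda>x. flat p (g x))"
    by (rule continuous_on_compose2[OF _ Ck_continuous[OF assms]]) auto
  then show ?case by simp
next
  case (Suc k)
  have d: "((\<lambda>x. flat p (g x)) has_derivative
      (\<lambda>h. frechet_derivative g (at x) h * flat ([:0, 0, 1:] * (p - pderiv p)) (g x))) (at x)" for x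
  proof -
    have "(g has_derivative frechet_derivative g (at x)) (at x)"
      using assms[of 1] by (simp add: frechet_derivative_works[symmetric])
    from has_derivative_in_compose[OF this
        flat_has_derivative[THEN has_field_derivative_at_within, unfolded has_field_derivative_def]]
    show ?thesis by (simp add: mult.commute)
  qed
  have "partial_deriv i (\<lambda>x. flat p (g x)) =
      (\<lambda>x. partial_deriv i g x * flat ([:0, 0, 1:] * (p - pderiv p)) (g x))" for i
    by (rule ext, subst partial_deriv_eqI[OF d]) (simp add: partial_deriv_def)
  moreover have "Ck k (partial_deriv i g)" for i using assms[of "Suc k"] by simp
  ultimately show ?case using d Suc.IH by (auto simp: differentiable_def intro!: Ck_mult)
qed

lemma ex_bump_function:
  fixes c :: "real^2"
  assumes "0 < r"
  obtains \<phi> where "\<And>k. Ck k \<phi>" "\<And>x. 0 \<le> \<phi> x" "\<And>x. \<phi> x \<le> 1" "\<And>x. \<phi> x > 0 \<longleftrightarrow> x \<in> ball c r"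
proof
  \<comment> \<open>This is \<open>r^2 - |x - c|^2\<close>, spelled with sums, products, constants
    and coordinates only, the operations under which \<open>Ck\<close> is known to be
    closed.\<close>
  let ?g = "\<lambda>x. r\<^sup>2 + (-1) * ((x $ 1 + - c $ 1) * (x $ 1 + - c $ 1) + (x $ 2 + - c $ 2) * (x $ 2 + - c $ 2))"
  let ?\<phi> = "\<lambda>x. flat 1 (?g x)"
  have g: "?g x = r\<^sup>2 - (dist c x)\<^sup>2" for x
    by (simp add: dist_norm power2_norm_eq_inner inner_vec_def sum_2 algebra_simps)
  show "Ck k ?\<phi>" for k
    by (intro Ck_flat Ck_add Ck_mult Ck_const Ck_nth)
  show "0 \<le> ?\<phi> x" "?\<phi> x \<le> 1" for x by (auto simp: flat_def)
  have "?g x > 0 \<longleftrightarrow> x \<in> ball c r" for x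
    unfolding g using \<open>0 < r\<close> abs_le_square_iff[of r "dist c x"] by (auto simp: not_le[symmetric] simp del: not_le)
  moreover have "?\<phi> x > 0 \<longleftrightarrow> ?g x > 0" for x by (simp add: flat_def)
  ultimately show "?\<phi> x > 0 \<longleftrightarrow> x \<in> ball c r" for x by blast
qed

section \<open>Density of test functions\<close>

lemma test_functions_Ck: "\<phi> \<in> test_functions \<Omega> \<Longrightarrow> Ck k \<phi>"
  by (simp add: test_functions_def)

lemma test_functionsE:
  assumes "\<phi> \<in> test_functions \<Omega>"
  obtains K where "compact K" "K \<subseteq> \<Omega>" "\<And>x. x \<notin> K \<Longrightarrow> \<phi> x = 0"
  using assms by (auto simp: test_functions_def)

lemma test_functions_zero: "(\<lambda>x. 0) \<in> test_functions \<Omega>"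
  unfolding test_functions_def by (auto intro!: exI[of _ "{}"] Ck_const simp del: Ck.simps)

lemma test_functions_mult:
  assumes "\<phi> \<in> test_functions \<Omega>" "\<And>k. Ck k \<psi>" shows "(\<lambda>x. \<psi> x * \<phi> x) \<in> test_functions \<Omega>"
proof -
  obtain K where "compact K" "K \<subseteq> \<Omega>" "\<And>x. x \<notin> K \<Longrightarrow> \<phi> x = 0"
    using test_functionsE[OF assms(1)] by blast
  then show ?thesis
    unfolding test_functions_def
    by (auto intro!: exI[of _ K] Ck_mult assms(2) test_functions_Ck[OF assms(1)] simp del: Ck.simps)
qed

lemma test_functions_cmult: "\<phi> \<in> test_functions \<Omega> \<Longrightarrow> (\<lambda>x. c * \<phi> x) \<in> test_functions \<Omega>"
  by (intro test_functions_mult Ck_const)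

lemma test_functions_add:
  assumes "\<phi> \<in> test_functions \<Omega>" "\<psi> \<in> test_functions \<Omega>"
  shows "(\<lambda>x. \<phi> x + \<psi> x) \<in> test_functions \<Omega>"
proof -
  obtain K where K: "compact K" "K \<subseteq> \<Omega>" "\<And>x. x \<notin> K \<Longrightarrow> \<phi> x = 0"
    using test_functionsE[OF assms(1)] by blast
  obtain L where L: "compact L" "L \<subseteq> \<Omega>" "\<And>x. x \<notin> L \<Longrightarrow> \<psi> x = 0"
    using test_functionsE[OF assms(2)] by blast
  show ?thesis
    unfolding test_functions_def using K L compact_Un[OF K(1) L(1)]
    by (auto intro!: exI[of _ "K \<union> L"] Ck_add test_functions_Ck[OF assms(2)]
       test_functions_Ck[OF assms(1)] simp del: Ck.simps) blast
qed

text \<open>The product differs from 1 only where some \<open>\<phi> i\<close> is nonzero, so the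
  support stays compact. Adjoining \<open>\<phi> n\<close> to the combination \<open>P\<close> gives
  \<open>P + \<phi> n - P * \<phi> n\<close>, which remains in the class.\<close>

lemma test_functions_one_minus_prod:
  fixes n :: nat
  assumes "\<And>i. i < n \<Longrightarrow> \<phi> i \<in> test_functions \<Omega>"
  shows "(\<lambda>x. 1 - (\<Prod>i<n. 1 - \<phi> i x)) \<in> test_functions \<Omega>"
  using assms
proof (induction n)
  case 0
  then show ?case by (simp add: test_functions_zero)
next
  case (Suc n)
  let ?P = "\<lambda>x. 1 - (\<Prod>i<n. 1 - \<phi> i x)"
  have P: "?P \<in> test_functions \<Omega>" and n: "\<phi> n \<in> test_functions \<Omega>"
    using Suc by auto
  have "(\<lambda>x. ?P x + (\<phi> n x + (-1) * (?P x * \<phi> n x))) \<in> test_functions \<Omega>"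
    by (intro test_functions_add test_functions_cmult test_functions_mult P n test_functions_Ck[OF P])
  then show ?case by (simp add: algebra_simps)
qed

lemma test_functions_continuous: "\<phi> \<in> test_functions \<Omega> \<Longrightarrow> continuous_on UNIV \<phi>"
  using Ck_continuous test_functions_Ck by blast

lemma compact_support_bounded:
  fixes f :: "'a::metric_space \<Rightarrow> real"
  assumes "continuous_on UNIV f" "compact K" "\<And>x. x \<notin> K \<Longrightarrow> f x = 0"
  obtains B where "\<And>x. \<bar>f x\<bar> \<le> B"
proof -
  have "compact (f ` K)"
    by (rule compact_continuous_image[OF continuous_on_subset[OF assms(1)] assms(2)]) auto
  then obtain B where B: "\<forall>y\<in>f ` K. norm y \<le> B"
    using compact_imp_bounded bounded_iff by blast
  have "\<bar>f x\<bar> \<le> max 0 B" for x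
    using B assms(3) by (cases "x \<in> K") (auto simp: le_max_iff_disj)
  then show thesis by (rule that)
qed

lemma test_functions_bounded:
  assumes "\<phi> \<in> test_functions \<Omega>" obtains B where "\<And>x. \<bar>\<phi> x\<bar> \<le> B"
  using compact_support_bounded[OF test_functions_continuous[OF assms]] test_functionsE[OF assms]
  by metis

lemma borel_measurable_lebesgue_on_continuous:
  fixes f :: "'a::euclidean_space \<Rightarrow> 'b::topological_space"
  assumes "continuous_on UNIV f" shows "f \<in> borel_measurable (lebesgue_on S)"
  using borel_measurable_continuous_onI[OF assms]
  by (intro measurable_restrict_space1 measurable_completion) (simp add: measurable_lborel1)

lemma finite_measure_lebesgue_on:
  fixes S :: "'a::euclidean_space set"
  assumes "open S" "bounded S" shows "finite_measure (lebesgue_on S)"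
  using assms by (intro finite_measure_lebesgue_on lmeasurable_open) auto

lemma sq_integrable_test_function:
  assumes "open \<Omega>" "bounded \<Omega>" "\<phi> \<in> test_functions \<Omega>"
  shows "sq_integrable (lebesgue_on \<Omega>) \<phi>"
proof -
  obtain B where "\<And>x. \<bar>\<phi> x\<bar> \<le> B" using test_functions_bounded[OF assms(3)] by blast
  then show ?thesis
    by (intro sq_integrable_bounded[where c=B] finite_measure_lebesgue_on assms
        borel_measurable_lebesgue_on_continuous test_functions_continuous[OF assms(3)]) auto
qed

section \<open>Closure of a linear subspace of L2\<close>

definition l2_closure :: "'a measure \<Rightarrow> ('a \<Rightarrow> real) set \<Rightarrow> ('a \<Rightarrow> real) set" where
  "l2_closure M T = {f. sq_integrable M f \<and> (\<forall>e>0. \<exists>\<phi>\<in>T. l2norm M (\<lambda>x. f x - \<phi> x) < e)}"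

locale l2_subspace =
  fixes M :: "'a measure" and T :: "('a \<Rightarrow> real) set"
  assumes T_sq: "\<phi> \<in> T \<Longrightarrow> sq_integrable M \<phi>"
    and T_zero: "(\<lambda>x. 0) \<in> T"
    and T_add: "\<phi> \<in> T \<Longrightarrow> \<psi> \<in> T \<Longrightarrow> (\<lambda>x. \<phi> x + \<psi> x) \<in> T"
    and T_cmult: "\<phi> \<in> T \<Longrightarrow> (\<lambda>x. c * \<phi> x) \<in> T"
begin

lemma closure_zero: "(\<lambda>x. 0) \<in> l2_closure M T"
  unfolding l2_closure_def using T_zero by (auto intro!: bexI[of _ "\<lambda>x. 0"] simp: l2norm_def)

lemma closure_add:
  assumes "f \<in> l2_closure M T" "g \<in> l2_closure M T"
  shows "(\<lambda>x. f x + g x) \<in> l2_closure M T"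
proof -
  have f: "sq_integrable M f" and g: "sq_integrable M g" using assms by (auto simp: l2_closure_def)
  have "\<exists>\<phi>\<in>T. l2norm M (\<lambda>x. f x + g x - \<phi> x) < e" if "e > 0" for e
  proof -
    have "e / 2 > 0" using that by simp
    with assms obtain \<phi> \<psi> where p: "\<phi> \<in> T" "l2norm M (\<lambda>x. f x - \<phi> x) < e / 2"
      "\<psi> \<in> T" "l2norm M (\<lambda>x. g x - \<psi> x) < e / 2"
      unfolding l2_closure_def by blast
    have "l2norm M (\<lambda>x. f x + g x - (\<phi> x + \<psi> x)) = l2norm M (\<lambda>x. (f x - \<phi> x) + (g x - \<psi> x))"
      by (simp add: algebra_simps)
    also have "\<dots> \<le> l2norm M (\<lambda>x. f x - \<phi> x) + l2norm M (\<lambda>x. g x - \<psi> x)"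
      by (intro l2norm_triangle sq_integrable_diff f g T_sq p)
    finally show ?thesis using p T_add[OF p(1,3)] by (intro bexI[of _ "\<lambda>x. \<phi> x + \<psi> x"]) auto
  qed
  then show ?thesis using f g by (auto simp: l2_closure_def)
qed

lemma closure_cmult:
  assumes "f \<in> l2_closure M T"
  shows "(\<lambda>x. c * f x) \<in> l2_closure M T"
proof -
  have f: "sq_integrable M f" using assms by (auto simp: l2_closure_def)
  have "\<exists>\<phi>\<in>T. l2norm M (\<lambda>x. c * f x - \<phi> x) < e" if "e > 0" for e
  proof -
    \<comment> \<open>The added 1 keeps the divisor positive when \<open>c = 0\<close>.\<close>
    have "e / (\<bar>c\<bar> + 1) > 0" using that by simp
    with assms obtain \<phi> where p: "\<phi> \<in> T" "l2norm M (\<lambda>x. f x - \<phi> x) < e / (\<bar>c\<bar> + 1)"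
      unfolding l2_closure_def by blast
    have "l2norm M (\<lambda>x. c * f x - c * \<phi> x) = \<bar>c\<bar> * l2norm M (\<lambda>x. f x - \<phi> x)"
      using l2norm_scaleR[of M c "\<lambda>x. f x - \<phi> x"] by (simp add: right_diff_distrib)
    also have "\<dots> \<le> (\<bar>c\<bar> + 1) * l2norm M (\<lambda>x. f x - \<phi> x)" by (intro mult_right_mono) auto
    also have "\<dots> < e" using p(2) by (simp add: field_simps)
    finally show ?thesis using T_cmult[OF p(1), of c] by (intro bexI) auto
  qed
  then show ?thesis using sq_integrable_scaleR[OF f, of c] by (auto simp: l2_closure_def)
qed

lemma closure_sum:
  assumes "\<And>i. i \<in> I \<Longrightarrow> f i \<in> l2_closure M T"
  shows "(\<lambda>x. \<Sum>i\<in>I. f i x) \<in> l2_closure M T"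
  using assms by (induction I rule: infinite_finite_induct) (auto intro: closure_zero closure_add)

text \<open>Closing twice adds nothing: half of \<open>e\<close> is spent on reaching
  \<open>g\<close>, the other half on a member of \<open>T\<close> near \<open>g\<close>.\<close>

lemma closure_closed:
  assumes f: "sq_integrable M f"
    and g: "\<And>e. e > 0 \<Longrightarrow> \<exists>g\<in>l2_closure M T. l2norm M (\<lambda>x. f x - g x) < e"
  shows "f \<in> l2_closure M T"
proof -
  have "\<exists>\<phi>\<in>T. l2norm M (\<lambda>x. f x - \<phi> x) < e" if "e > 0" for e
  proof -
    have e: "e / 2 > 0" using that by simp
    from g[OF e] obtain g where g: "g \<in> l2_closure M T" "l2norm M (\<lambda>x. f x - g x) < e / 2" by blast
    with e obtain \<phi> where p: "\<phi> \<in> T" "l2norm M (\<lambda>x. g x - \<phi> x) < e / 2"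
      unfolding l2_closure_def by blast
    have "l2norm M (\<lambda>x. f x - \<phi> x) = l2norm M (\<lambda>x. (f x - g x) + (g x - \<phi> x))"
      by simp
    also have "\<dots> \<le> l2norm M (\<lambda>x. f x - g x) + l2norm M (\<lambda>x. g x - \<phi> x)"
      using g(1) by (intro l2norm_triangle sq_integrable_diff f T_sq[OF p(1)]) (auto simp: l2_closure_def)
    finally show ?thesis using p g(2) by (intro bexI[of _ \<phi>]) auto
  qed
  then show ?thesis using f by (auto simp: l2_closure_def)
qed

lemma closure_superset: "\<phi> \<in> T \<Longrightarrow> \<phi> \<in> l2_closure M T"
  unfolding l2_closure_def using T_sq by (auto intro!: bexI[of _ \<phi>] simp: l2norm_def)

lemma closure_sequentially_closed:
  assumes f: "sq_integrable M f" and g: "\<And>n::nat. g n \<in> l2_closure M T"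
    and lim: "(\<lambda>n. l2norm M (\<lambda>x. f x - g n x)) \<longlonglongrightarrow> 0"
  shows "f \<in> l2_closure M T"
proof (rule closure_closed[OF f])
  fix e :: real assume "0 < e"
  from order_tendstoD(2)[OF lim this] obtain n where "l2norm M (\<lambda>x. f x - g n x) < e"
    unfolding eventually_sequentially by blast
  then show "\<exists>g\<in>l2_closure M T. l2norm M (\<lambda>x. f x - g x) < e" using g by blast
qed

end

section \<open>From indicators of open sets to all square-integrable functions\<close>

lemma l2norm_dominated_convergence:
  fixes f :: "'a \<Rightarrow> 'b::euclidean_space"
  assumes f: "f \<in> borel_measurable M" and g: "\<And>i. g i \<in> borel_measurable M"
    and lim: "\<And>x. x \<in> space M \<Longrightarrow> (\<lambda>i. g i x) \<longlonglongrightarrow> f x"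
    and h: "sq_integrable M h" and le: "\<And>i x. x \<in> space M \<Longrightarrow> norm (f x - g i x) \<le> norm (h x)"
  shows "(\<lambda>i. l2norm M (\<lambda>x. f x - g i x)) \<longlonglongrightarrow> 0"
proof -
  have "(\<lambda>i. \<integral>x. (norm (f x - g i x))\<^sup>2 \<partial>M) \<longlonglongrightarrow> (\<integral>x. 0 \<partial>M)"
  proof (rule integral_dominated_convergence)
    show "integrable M (\<lambda>x. (norm (h x))\<^sup>2)" using h by (simp add: sq_integrable_def)
    show "AE x in M. norm ((norm (f x - g i x))\<^sup>2) \<le> (norm (h x))\<^sup>2" for i
      by (rule AE_I2) (auto intro: power_mono le)
    show "AE x in M. (\<lambda>i. (norm (f x - g i x))\<^sup>2) \<longlonglongrightarrow> 0"
    proof (rule AE_I2)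
      fix x assume "x \<in> space M"
      then have "(\<lambda>i. (norm (f x - g i x))\<^sup>2) \<longlonglongrightarrow> (norm (f x - f x))\<^sup>2"
        by (intro tendsto_intros lim)
      then show "(\<lambda>i. (norm (f x - g i x))\<^sup>2) \<longlonglongrightarrow> 0" by simp
    qed
  qed (use f g in auto)
  then have "(\<lambda>i. sqrt (\<integral>x. (norm (f x - g i x))\<^sup>2 \<partial>M)) \<longlonglongrightarrow> sqrt 0"
    by (intro tendsto_real_sqrt) simp
  then show ?thesis by (simp add: l2norm_def)
qed

text \<open>Cover \<open>U\<close> by countably many balls carrying bump functions
  \<open>\<phi> i\<close>. Then \<open>1 - (\<Prod>i<n. (1 - \<phi> i x) ^ n)\<close> tends to 1
  wherever some bump is positive and is 0 elsewhere, while each finite stage still has compact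
  support.\<close>

lemma ex_test_functions_tendsto_indicator:
  fixes U \<Omega> :: "(real^2) set"
  assumes U: "open U" "U \<subseteq> \<Omega>"
  obtains \<Phi> :: "nat \<Rightarrow> real^2 \<Rightarrow> real"
  where "\<And>n. \<Phi> n \<in> test_functions \<Omega>" "\<And>n x. \<Phi> n x \<in> {0..1}"
    "\<And>x. (\<lambda>n. \<Phi> n x) \<longlonglongrightarrow> indicator U x"
proof (cases "U = {}")
  case True
  then show thesis by (intro that[of "\<lambda>n x. 0"]) (auto simp: test_functions_zero)
next
  case False
  \<comment> \<open>Requiring the closed ball to lie in \<open>U\<close> gives each bump a compact
    support inside \<open>U\<close>.\<close>
  define F where "F = {ball c r | c r. 0 < r \<and> cball c r \<subseteq> U}"
  have "\<And>S. S \<in> F \<Longrightarrow> open S" by (auto simp: F_def)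
  then obtain F' where F': "F' \<subseteq> F" "countable F'" "\<Union>F' = \<Union>F" by (rule Lindelof)
  have UF: "\<Union>F = U"
  proof
    show "U \<subseteq> \<Union>F"
    proof
      fix x assume "x \<in> U"
      then obtain r where "0 < r" "cball x r \<subseteq> U" using U(1) open_contains_cball by blast
      then show "x \<in> \<Union>F" unfolding F_def by (intro UnionI[of "ball x r"]) auto
    qed
  qed (auto simp: F_def subset_iff)
  have "F' \<noteq> {}" using F' UF False by auto
  then have B: "range (from_nat_into F') = F'" using F'(2) by (rule range_from_nat_into)
  have "\<exists>\<phi>. (\<forall>k. Ck k \<phi>) \<and> (\<forall>x. \<phi> x \<in> {0..1}) \<and> (\<forall>x. \<phi> x > 0 \<longleftrightarrow> x \<in> from_nat_into F' i)
      \<and> \<phi> \<in> test_functions \<Omega>" for i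
  proof -
    have "from_nat_into F' i \<in> F" using B F'(1) by blast
    then obtain c r where cr: "from_nat_into F' i = ball c r" "0 < r" "cball c r \<subseteq> U"
      unfolding F_def by blast
    from ex_bump_function[OF cr(2), of c] obtain \<phi> where
      p: "\<And>k. Ck k \<phi>" "\<And>x. 0 \<le> \<phi> x" "\<And>x. \<phi> x \<le> 1" "\<And>x. \<phi> x > 0 \<longleftrightarrow> x \<in> ball c r" by blast
    have "\<phi> x = 0" if "x \<notin> cball c r" for x
      using that p(2)[of x] p(4)[of x] ball_subset_cball[of c r] by force
    then have "\<phi> \<in> test_functions \<Omega>"
      unfolding test_functions_def using p(1) cr(3) U(2)
      by (auto intro!: exI[of _ "cball c r"] simp del: Ck.simps)
    then show ?thesis using p cr by auto
  qed
  then obtain \<phi> where p: "\<And>i k. Ck k (\<phi> i)" "\<And>i x. \<phi> i x \<in> {0..1}"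
    "\<And>i x. \<phi> i x > 0 \<longleftrightarrow> x \<in> from_nat_into F' i" "\<And>i. \<phi> i \<in> test_functions \<Omega>"
    by metis
  \<comment> \<open>The index \<open>n\<close> works twice: as range it eventually admits every
    ball, as exponent it drives a factor below 1 to 0.\<close>
  define \<Phi> where "\<Phi> n x = 1 - (\<Prod>i<n. (1 - \<phi> i x) ^ n)" for n x
  have pow: "(\<lambda>x. 1 - (1 - \<phi> i x) ^ n) \<in> test_functions \<Omega>" for i n
    using test_functions_one_minus_prod[of n "\<lambda>_. \<phi> i" \<Omega>] p(4) by simp
  show thesis
  proof
    show "\<Phi> n \<in> test_functions \<Omega>" for n
      using test_functions_one_minus_prod[of n "\<lambda>i x. 1 - (1 - \<phi> i x) ^ n" \<Omega>] pow
      by (simp add: \<Phi>_def[abs_def])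
    have pr: "(1 - \<phi> i x) ^ n \<in> {0..1}" for i n x
      using p(2)[of i x] by (auto intro: power_le_one)
    then have P: "(\<Prod>i\<in>I. (1 - \<phi> i x) ^ n) \<in> {0..1}" for I n x
      by (auto intro!: prod_nonneg prod_le_1)
    then show "\<Phi> n x \<in> {0..1}" for n x by (simp add: \<Phi>_def)
    show "(\<lambda>n. \<Phi> n x) \<longlonglongrightarrow> indicator U x" for x
    proof (cases "x \<in> U")
      case True
      then obtain j where j: "x \<in> from_nat_into F' j" using UF F'(3) B by (metis UnionE imageE)
      then have q: "0 \<le> 1 - \<phi> j x" "1 - \<phi> j x < 1" using p(2,3)[of j x] by auto
      have "(\<lambda>n. \<Prod>i<n. (1 - \<phi> i x) ^ n) \<longlonglongrightarrow> 0"
      proof (rule tendsto_sandwich)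
        show "(\<lambda>n. 0::real) \<longlonglongrightarrow> 0" by simp
        show "(\<lambda>n. (1 - \<phi> j x) ^ n) \<longlonglongrightarrow> 0" using q by (intro LIMSEQ_power_zero) auto
        show "\<forall>\<^sub>F n in sequentially. (\<Prod>i<n. (1 - \<phi> i x) ^ n) \<le> (1 - \<phi> j x) ^ n"
          using eventually_gt_at_top[of j]
        proof eventually_elim
          case (elim n)
          \<comment> \<open>All factors lie in \<open>{0..1}\<close>, so the single factor of a ball
            containing \<open>x\<close> dominates the product.\<close>
          have "(\<Prod>i<n. (1 - \<phi> i x) ^ n) = (1 - \<phi> j x) ^ n * (\<Prod>i\<in>{..<n} - {j}. (1 - \<phi> i x) ^ n)"
            using elim by (intro prod.remove) auto
          also have "\<dots> \<le> (1 - \<phi> j x) ^ n * 1"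
            using P pr by (intro mult_left_mono) (auto simp: Ball_def)
          finally show ?case by simp
        qed
      qed (use P in auto)
      then have "(\<lambda>n. \<Phi> n x) \<longlonglongrightarrow> 1 - 0" unfolding \<Phi>_def by (intro tendsto_diff tendsto_const)
      then show ?thesis using True by simp
    next
      case False
      then have "\<not> \<phi> i x > 0" for i using p(3)[of i x] UF F'(3) B by blast
      then have "\<phi> i x = 0" for i using p(2)[of i x] by (auto simp: not_less intro: antisym)
      then show ?thesis using False by (simp add: \<Phi>_def)
    qed
  qed
qed

text \<open>The class of limits is enlarged step by step: indicators of open sets, indicators of
  measurable sets by outer regularity, simple functions by linearity, and finally all of L2 by
  dominated convergence.\<close>

lemma test_functions_dense:
  fixes \<Omega> :: "(real^2) set"
  assumes \<Omega>: "open \<Omega>" "bounded \<Omega>" and f: "sq_integrable (lebesgue_on \<Omega>) f" and "0 < e"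
  obtains \<phi> where "\<phi> \<in> test_functions \<Omega>" "l2norm (lebesgue_on \<Omega>) (\<lambda>x. f x - \<phi> x) < e"
proof -
  let ?M = "lebesgue_on \<Omega>"
  interpret M: finite_measure ?M by (rule finite_measure_lebesgue_on[OF \<Omega>])
  interpret l2_subspace ?M "test_functions \<Omega>"
    by unfold_locales
      (auto intro: sq_integrable_test_function[OF \<Omega>] test_functions_zero test_functions_add test_functions_cmult)
  have sets: "\<Omega> \<in> sets lebesgue" using \<Omega>(1) by (simp add: borel_open)
  have ind_sq: "sq_integrable ?M (indicator A :: _ \<Rightarrow> real)" if "A \<in> sets ?M" for A
    using that by (intro sq_integrable_bounded[where c=1]) (auto simp: M.finite_measure_axioms indicator_def)
  have open_case: "indicator U \<in> l2_closure ?M (test_functions \<Omega>)" if U: "open U" "U \<subseteq> \<Omega>" for U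
  proof -
    have US: "U \<in> sets ?M" using U sets by (simp add: sets_restrict_space_iff borel_open)
    from ex_test_functions_tendsto_indicator[OF U] obtain \<Phi> where
      P: "\<And>n. \<Phi> n \<in> test_functions \<Omega>" "\<And>n x. \<Phi> n x \<in> {0..1}" "\<And>x. (\<lambda>n. \<Phi> n x) \<longlonglongrightarrow> indicator U x"
      by blast
    have "(\<lambda>n. l2norm ?M (\<lambda>x. indicator U x - \<Phi> n x)) \<longlonglongrightarrow> 0"
    proof (rule l2norm_dominated_convergence)
      show "sq_integrable ?M (\<lambda>x. 1::real)" using M.finite_measure_axioms by (rule sq_integrable_bounded) auto
      show "norm (indicator U x - \<Phi> i x) \<le> norm (1::real)" for i x
        using P(2)[of i x] by (auto simp: indicator_def)
    qed (use P US in \<open>auto intro: sq_integrable_borel sq_integrable_test_function[OF \<Omega>]\<close>)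
    then show ?thesis
      by (rule closure_sequentially_closed[OF ind_sq[OF US] closure_superset[OF P(1)]])
  qed
  have sets_case: "indicator A \<in> l2_closure ?M (test_functions \<Omega>)" if A: "A \<in> sets ?M" for A
  proof (rule closure_closed[OF ind_sq[OF A]])
    fix e :: real assume "0 < e"
    have A': "A \<in> sets lebesgue" "A \<subseteq> \<Omega>" using A sets by (auto simp: sets_restrict_space_iff)
    have "0 < e\<^sup>2" using \<open>0 < e\<close> by simp
    \<comment> \<open>The L2 norm of a difference of two nested indicators is the square root of the
      measure of the gap, hence the bound \<open>e\<^sup>2\<close>.\<close>
    from sets_lebesgue_outer_open[OF A'(1) this] obtain W where
      W: "open W" "A \<subseteq> W" "W - A \<in> lmeasurable" "emeasure lebesgue (W - A) < ennreal (e\<^sup>2)" by blast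
    \<comment> \<open>The open case is available only for subsets of the domain, so the outer open
      set is cut down to \<open>\<Omega>\<close>.\<close>
    let ?U = "W \<inter> \<Omega>"
    have U: "open ?U" "?U \<subseteq> \<Omega>" "A \<subseteq> ?U" using W A' \<Omega> by auto
    have US: "?U - A \<in> sets ?M" using U A' sets by (auto simp: sets_restrict_space_iff borel_open)
    have UL: "?U - A \<in> lmeasurable"
      using W(3) US sets by (auto intro: fmeasurableI2[OF W(3)] simp: sets_restrict_space_iff)
    have "measure lebesgue (?U - A) \<le> measure lebesgue (W - A)"
      by (intro measure_mono_fmeasurable W(3) fmeasurableD[OF UL]) auto
    also have "\<dots> < e\<^sup>2"
      using W(3,4) by (simp add: emeasure_eq_measure2 ennreal_less_iff)
    finally have m: "measure lebesgue (?U - A) < e\<^sup>2" .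
    have "(l2norm ?M (\<lambda>x. indicator A x - indicator ?U x :: real))\<^sup>2 = (\<integral>x. indicator (?U - A) x \<partial>?M)"
      unfolding l2norm_sq by (rule Bochner_Integration.integral_cong) (use U(3) in \<open>auto simp: indicator_def\<close>)
    also have "\<dots> = measure ?M ((?U - A) \<inter> \<Omega>)" using US by simp
    also have "(?U - A) \<inter> \<Omega> = ?U - A" by blast
    also have "measure ?M (?U - A) = measure lebesgue (?U - A)"
      using sets by (intro measure_restrict_space) auto
    finally have "(l2norm ?M (\<lambda>x. indicator A x - indicator ?U x :: real))\<^sup>2 < e\<^sup>2" using m by simp
    then have "l2norm ?M (\<lambda>x. indicator A x - indicator ?U x :: real) < e"
      using \<open>0 < e\<close> by (intro power_less_imp_less_base[of _ 2 e]) auto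
    then show "\<exists>g\<in>l2_closure ?M (test_functions \<Omega>). l2norm ?M (\<lambda>x. indicator A x - g x) < e"
      using open_case[OF U(1,2)] by blast
  qed
  have simple_case: "s \<in> l2_closure ?M (test_functions \<Omega>)" if s: "simple_function ?M s" for s
  proof (rule closure_closed)
    have sm: "s \<in> borel_measurable ?M" using s by (rule borel_measurable_simple_function)
    have fin: "finite (s ` space ?M)" using s by (rule simple_functionD)
    show sq: "sq_integrable ?M s"
      using fin by (intro sq_integrable_bounded[where c="Max ((\<lambda>y. norm y) ` s ` space ?M)"] sm M.finite_measure_axioms) auto
    define g where "g = (\<lambda>x. \<Sum>y \<in> s ` space ?M. y * indicator (s -` {y} \<inter> space ?M) x)"
    have "g \<in> l2_closure ?M (test_functions \<Omega>)"
      unfolding g_def by (rule closure_sum, rule closure_cmult, rule sets_case, rule simple_functionD(2)[OF s])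
    moreover have "s x = g x" if "x \<in> space ?M" for x
      by (subst simple_function_indicator_representation_banach[OF s that]) (simp add: g_def mult.commute)
    then have "l2norm ?M (\<lambda>x. s x - g x) = 0"
      unfolding l2norm_def by (subst Bochner_Integration.integral_cong[of _ _ _ "\<lambda>_. 0"]) auto
    ultimately show "\<exists>g\<in>l2_closure ?M (test_functions \<Omega>). l2norm ?M (\<lambda>x. s x - g x) < e" if "e > 0" for e
      using that by (intro bexI[of _ g]) auto
  qed
  have "f \<in> l2_closure ?M (test_functions \<Omega>)"
  proof -
    have fm: "f \<in> borel_measurable ?M" using f by (rule sq_integrable_borel)
    from borel_measurable_implies_sequence_metric[OF fm, of 0] obtain s where
      s: "\<And>i. simple_function ?M (s i)" "\<And>x. x \<in> space ?M \<Longrightarrow> (\<lambda>i. s i x) \<longlonglongrightarrow> f x"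
        "\<And>i x. x \<in> space ?M \<Longrightarrow> dist (s i x) 0 \<le> 2 * dist (f x) 0" by blast
    have "(\<lambda>i. l2norm ?M (\<lambda>x. f x - s i x)) \<longlonglongrightarrow> 0"
    \<comment> \<open>The simple functions obey \<open>norm (s i x) \<le> 2 * norm (f x)\<close>, so
      the error is at most \<open>3 * norm (f x)\<close>.\<close>
    proof (rule l2norm_dominated_convergence[where h="\<lambda>x. 3 *\<^sub>R f x"])
      show "norm (f x - s i x) \<le> norm (3 *\<^sub>R f x)" if "x \<in> space ?M" for i x
        using s(3)[OF that, of i] by auto
    qed (use s fm sq_integrable_scaleR[OF f, of 3] in \<open>auto intro: borel_measurable_simple_function\<close>)
    then show ?thesis by (rule closure_sequentially_closed[OF f simple_case[OF s(1)]])
  qed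
  then show thesis using \<open>0 < e\<close> that unfolding l2_closure_def by blast
qed

section \<open>Weak gradients\<close>

lemma L2_iff_sq_integrable: "f \<in> L2 \<Omega> \<longleftrightarrow> sq_integrable (lebesgue_on \<Omega>) f"
  by (simp add: L2_def sq_integrable_def)

lemma norm_vec_sq: "(norm (x :: ('b::real_inner)^'n))\<^sup>2 = (\<Sum>i\<in>UNIV. (norm (x $ i))\<^sup>2)"
  by (simp add: power2_norm_eq_inner inner_vec_def)

text \<open>A matrix is a vector of rows, so two applications reach its entries; for this the
  components may themselves lie in any Euclidean space.\<close>

lemma sq_integrable_vec_iff:
  fixes f :: "'a \<Rightarrow> ('b::euclidean_space)^'n"
  shows "sq_integrable M f \<longleftrightarrow> (\<forall>i. sq_integrable M (\<lambda>x. f x $ i))"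
proof
  assume f: "sq_integrable M f"
  show "\<forall>i. sq_integrable M (\<lambda>x. f x $ i)"
  proof
    fix i
    have "(\<lambda>x. f x $ i) \<in> borel_measurable M"
      by (rule measurable_compose[OF sq_integrable_borel[OF f]])
        (intro borel_measurable_continuous_onI continuous_intros)
    then show "sq_integrable M (\<lambda>x. f x $ i)"
      by (rule sq_integrable_bound[OF f, where c=1]) (simp add: Finite_Cartesian_Product.norm_nth_le)
  qed
next
  assume f: "\<forall>i. sq_integrable M (\<lambda>x. f x $ i)"
  then have "(\<lambda>x. f x $ i \<bullet> b) \<in> borel_measurable M" for i b
    by (auto intro!: borel_measurable_inner dest!: sq_integrable_borel)
  then have "f \<in> borel_measurable M"
    by (auto simp: borel_measurable_euclidean_space[of f] Basis_vec_def inner_axis)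
  then show "sq_integrable M f"
    using f by (simp add: sq_integrable_def norm_vec_sq)
qed

lemma l2norm_sq_vec:
  fixes f :: "'a \<Rightarrow> ('b::euclidean_space)^'n"
  assumes "sq_integrable M f"
  shows "(l2norm M f)\<^sup>2 = (\<Sum>i\<in>UNIV. (l2norm M (\<lambda>x. f x $ i))\<^sup>2)"
  using assms by (simp add: l2norm_sq norm_vec_sq sq_integrable_vec_iff sq_integrable_def)

lemma l2norm_nth_le:
  fixes f :: "'a \<Rightarrow> ('b::euclidean_space)^'n"
  assumes "sq_integrable M f"
  shows "l2norm M (\<lambda>x. f x $ i) \<le> l2norm M f"
proof (rule power2_le_imp_le)
  show "(l2norm M (\<lambda>x. f x $ i))\<^sup>2 \<le> (l2norm M f)\<^sup>2"
    unfolding l2norm_sq_vec[OF assms] by (rule member_le_sum) auto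
qed simp

lemma l2inner_vec:
  fixes f g :: "'a \<Rightarrow> ('b::euclidean_space)^'n"
  assumes "sq_integrable M f" "sq_integrable M g"
  shows "l2inner M f g = (\<Sum>i\<in>UNIV. l2inner M (\<lambda>x. f x $ i) (\<lambda>x. g x $ i))"
  using assms unfolding l2inner_def inner_vec_def
  by (intro Bochner_Integration.integral_sum sq_integrable_inner) (auto simp: sq_integrable_vec_iff)

section \<open>Partial derivatives of test functions and their integrals\<close>

lemma test_functions_partial_deriv:
  assumes "\<phi> \<in> test_functions \<Omega>" shows "partial_deriv i \<phi> \<in> test_functions \<Omega>"
proof -
  obtain K where K: "compact K" "K \<subseteq> \<Omega>" "\<And>x. x \<notin> K \<Longrightarrow> \<phi> x = 0"
    using test_functionsE[OF assms] by blast
  have "partial_deriv i \<phi> x = 0" if "x \<notin> K" for x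
  proof -
    have "((\<lambda>x. 0 :: real) has_derivative (\<lambda>x. 0)) (at x)" by simp
    then have "(\<phi> has_derivative (\<lambda>x. 0)) (at x)"
      by (rule has_derivative_transform_within_open[of _ _ _ _ "- K"])
        (use K that in \<open>auto simp: compact_imp_closed open_Compl\<close>)
    then show ?thesis by (rule partial_deriv_eqI)
  qed
  moreover have "Ck k (partial_deriv i \<phi>)" for k
    using test_functions_Ck[OF assms, of "Suc k"] by simp
  ultimately show ?thesis
    unfolding test_functions_def using K(1,2) by (auto intro!: exI[of _ K] simp del: Ck.simps)
qed

lemma test_function_has_partial_derivative:
  assumes "\<phi> \<in> test_functions \<Omega>"
  shows "((\<lambda>t. \<phi> (x + t *\<^sub>R axis i 1)) has_real_derivative partial_deriv i \<phi> (x + t *\<^sub>R axis i 1)) (at t)"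
proof -
  let ?y = "x + t *\<^sub>R axis i 1"
  have "\<phi> differentiable (at ?y)"
    using test_functions_Ck[OF assms, of 1] by simp
  then have d: "(\<phi> has_derivative frechet_derivative \<phi> (at ?y)) (at ?y)"
    by (simp add: frechet_derivative_works[symmetric])
  have "((\<lambda>t. x + t *\<^sub>R axis i 1) has_derivative (\<lambda>h. h *\<^sub>R axis i 1)) (at t)"
    by (auto intro!: derivative_eq_intros)
  from diff_chain_at[OF this d]
  have "((\<lambda>t. \<phi> (x + t *\<^sub>R axis i 1)) has_derivative (\<lambda>h. frechet_derivative \<phi> (at ?y) (h *\<^sub>R axis i 1))) (at t)"
    by (simp add: o_def)
  moreover have "frechet_derivative \<phi> (at ?y) (h *\<^sub>R axis i 1) = partial_deriv i \<phi> ?y * h" for h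
    using linear_scale[OF has_derivative_linear[OF d]] by (simp add: partial_deriv_def)
  ultimately show ?thesis by (simp add: has_field_derivative_def)
qed

lemma integral_test_function:
  assumes "open \<Omega>" "\<phi> \<in> test_functions \<Omega>"
  shows "(\<integral>x. \<phi> x \<partial>lebesgue_on \<Omega>) = (\<integral>x. \<phi> x \<partial>lborel)"
proof -
  obtain K where K: "compact K" "K \<subseteq> \<Omega>" "\<And>x. x \<notin> K \<Longrightarrow> \<phi> x = 0"
    using test_functionsE[OF assms(2)] by blast
  have "(\<integral>x. \<phi> x \<partial>lebesgue_on \<Omega>) = (\<integral>x. indicator \<Omega> x *\<^sub>R \<phi> x \<partial>lebesgue)"
    by (rule integral_restrict_space) (use assms(1) in \<open>simp add: borel_open\<close>)
  also have "\<dots> = (\<integral>x. \<phi> x \<partial>lebesgue)"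
    using K by (intro Bochner_Integration.integral_cong) (auto simp: indicator_def)
  also have "\<dots> = (\<integral>x. \<phi> x \<partial>lborel)"
    using borel_measurable_continuous_onI[OF test_functions_continuous[OF assms(2)]]
    by (intro integral_completion) simp
  finally show ?thesis .
qed

text \<open>Each difference quotient has integral zero because Lebesgue measure is translation
  invariant, and the quotients converge dominatedly to the partial derivative. This is what gives
  constants a vanishing weak gradient.\<close>

lemma integral_partial_deriv_test_function:
  assumes "open \<Omega>" "\<phi> \<in> test_functions \<Omega>"
  shows "(\<integral>x. partial_deriv i \<phi> x \<partial>lebesgue_on \<Omega>) = 0"
proof -
  let ?e = "axis i 1 :: real^2" and ?d = "partial_deriv i \<phi>"
  define h where "h n = inverse (real (Suc n))" for n
  have h: "0 < h n" "h n \<le> 1" for n by (auto simp: h_def inverse_le_1_iff)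
  have h0: "h \<longlonglongrightarrow> 0" unfolding h_def by (rule LIMSEQ_inverse_real_of_nat)
  obtain K where K: "compact K" "K \<subseteq> \<Omega>" "\<And>x. x \<notin> K \<Longrightarrow> \<phi> x = 0"
    using test_functionsE[OF assms(2)] by blast
  obtain R where R: "\<And>x. x \<in> K \<Longrightarrow> norm x \<le> R"
    using compact_imp_bounded[OF K(1)] unfolding bounded_iff by blast
  have d: "?d \<in> test_functions \<Omega>" by (rule test_functions_partial_deriv[OF assms(2)])
  obtain B where B: "\<And>x. \<bar>?d x\<bar> \<le> B" using test_functions_bounded[OF d] by blast
  then have "0 \<le> B" using abs_ge_zero order_trans by blast
  have m: "\<phi> \<in> borel_measurable borel" "?d \<in> borel_measurable borel"
    by (intro borel_measurable_continuous_onI test_functions_continuous[OF assms(2)] test_functions_continuous[OF d])+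
  note m[measurable]
  obtain C where C: "\<And>x. \<bar>\<phi> x\<bar> \<le> C" using test_functions_bounded[OF assms(2)] by blast
  have int: "integrable lborel \<phi>"
  proof (rule Bochner_Integration.integrable_bound)
    show "integrable lborel (\<lambda>x. C * indicator K x :: real)"
      using K(1) emeasure_bounded_finite[OF compact_imp_bounded[OF K(1)]]
      by (intro integrable_mult_right integrable_real_indicator) (auto intro: borel_compact)
    show "AE x in lborel. norm (\<phi> x) \<le> norm (C * indicator K x)"
    proof (rule AE_I2)
      fix x
      show "norm (\<phi> x) \<le> norm (C * indicator K x)"
        using C[of x] K(3)[of x] by (cases "x \<in> K") auto
    qed
  qed (simp add: m)
  define g where "g n x = (\<phi> (x + h n *\<^sub>R ?e) - \<phi> x) / h n" for n x
  have "(\<lambda>n. \<integral>x. g n x \<partial>lborel) \<longlonglongrightarrow> (\<integral>x. ?d x \<partial>lborel)"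
  proof (rule integral_dominated_convergence)
    \<comment> \<open>By the mean value theorem a quotient is at most \<open>B\<close>, the bound of
      the partial derivative; since the step \<open>h n\<close> is at most 1, it vanishes outside
      the ball of radius \<open>R + 1\<close>.\<close>
    show "integrable lborel (\<lambda>x. B * indicator (cball 0 (R + 1)) (x :: real^2) :: real)"
      using emeasure_bounded_finite[OF bounded_cball[of "0 :: real^2" "R + 1"]]
      by (intro integrable_mult_right integrable_real_indicator) auto
    show "AE x in lborel. norm (g n x) \<le> B * indicator (cball 0 (R + 1)) x" for n
    proof (rule AE_I2)
      fix x
      show "norm (g n x) \<le> B * indicator (cball 0 (R + 1)) x"
      proof (cases "x \<in> cball 0 (R + 1)")
        case True
        obtain z where "\<phi> (x + h n *\<^sub>R ?e) - \<phi> (x + 0 *\<^sub>R ?e) = (h n - 0) * ?d (x + z *\<^sub>R ?e)"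
          using MVT2[of 0 "h n" "\<lambda>t. \<phi> (x + t *\<^sub>R ?e)" "\<lambda>t. ?d (x + t *\<^sub>R ?e)"]
            test_function_has_partial_derivative[OF assms(2)] h(1)[of n] by blast
        then have "g n x = ?d (x + z *\<^sub>R ?e)" using h(1)[of n] by (simp add: g_def)
        then show ?thesis using True B by simp
      next
        case False
        have "norm x \<le> norm (x + h n *\<^sub>R ?e) + norm (h n *\<^sub>R ?e)"
          by (metis add_diff_cancel_right' norm_triangle_ineq4)
        then have "norm x \<le> norm (x + h n *\<^sub>R ?e) + 1" using h[of n] by simp
        then have "x \<notin> K" "x + h n *\<^sub>R ?e \<notin> K" using R[of x] R[of "x + h n *\<^sub>R ?e"] False by auto
        then show ?thesis using False K(3) by (simp add: g_def)
      qed
    qed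
    show "AE x in lborel. (\<lambda>n. g n x) \<longlonglongrightarrow> ?d x"
    proof (rule AE_I2)
      fix x
      have "((\<lambda>s. (\<phi> (x + s *\<^sub>R ?e) - \<phi> x) / s) \<longlongrightarrow> ?d x) (at 0)"
        using test_function_has_partial_derivative[OF assms(2), of x i 0]
        by (simp add: has_field_derivative_iff)
      moreover have "filterlim h (at 0) sequentially"
        using h0 h(1) by (auto simp: filterlim_at less_imp_neq[OF h(1), symmetric])
      ultimately show "(\<lambda>n. g n x) \<longlonglongrightarrow> ?d x"
        unfolding g_def by (rule filterlim_compose)
    qed
  qed (auto simp: g_def)
  moreover have "(\<integral>x. g n x \<partial>lborel) = 0" for n
  proof -
    have t: "integrable lborel (\<lambda>x. \<phi> (x + h n *\<^sub>R ?e))"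
      "(\<integral>x. \<phi> (x + h n *\<^sub>R ?e) \<partial>lborel) = (\<integral>x. \<phi> x \<partial>lborel)"
    proof -
      have eq: "lborel = distr lborel borel ((+) (h n *\<^sub>R ?e))" by (rule lborel_distr_plus[symmetric])
      show "integrable lborel (\<lambda>x. \<phi> (x + h n *\<^sub>R ?e))"
        using int by (subst (asm) eq) (simp add: integrable_distr_eq add.commute)
      show "(\<integral>x. \<phi> (x + h n *\<^sub>R ?e) \<partial>lborel) = (\<integral>x. \<phi> x \<partial>lborel)"
        by (subst (2) eq) (simp add: integral_distr add.commute)
    qed
    show ?thesis unfolding g_def using t int by simp
  qed
  ultimately have "(\<integral>x. ?d x \<partial>lborel) = 0" by (simp add: LIMSEQ_const_iff)
  then show ?thesis using integral_test_function[OF assms(1) d] by simp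
qed

lemma has_weak_gradient_iff:
  "has_weak_gradient \<Omega> f g \<longleftrightarrow> sq_integrable (lebesgue_on \<Omega>) g \<and>
     (\<forall>\<phi>\<in>test_functions \<Omega>. \<forall>i.
        l2inner (lebesgue_on \<Omega>) f (partial_deriv i \<phi>) = - l2inner (lebesgue_on \<Omega>) (\<lambda>x. g x $ i) \<phi>)"
  unfolding has_weak_gradient_def L2_iff_sq_integrable sq_integrable_vec_iff[of _ g] l2inner_def by simp

lemma has_weak_gradient_const:
  assumes "open \<Omega>" shows "has_weak_gradient \<Omega> (\<lambda>x. c) (\<lambda>x. 0)"
  unfolding has_weak_gradient_iff
  using integral_partial_deriv_test_function[OF assms] by (simp add: l2inner_def)

section \<open>Calculus of weak gradients on a bounded open set\<close>

locale bounded_domain =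
  fixes \<Omega> :: "(real^2) set"
  assumes open_dom: "open \<Omega>" and bounded_dom: "bounded \<Omega>"
begin

abbreviation M where "M \<equiv> lebesgue_on \<Omega>"

sublocale M: finite_measure M
  by (rule finite_measure_lebesgue_on[OF open_dom bounded_dom])

lemma test_sq: "\<phi> \<in> test_functions \<Omega> \<Longrightarrow> sq_integrable M \<phi>"
  by (rule sq_integrable_test_function[OF open_dom bounded_dom])

text \<open>If \<open>h\<close> had positive norm, some test function would be closer to
  \<open>h\<close> than that norm; orthogonality and Cauchy-Schwarz would then make the squared norm
  smaller than itself.\<close>

lemma orthogonal_to_test_functions:
  assumes h: "sq_integrable M h" and orth: "\<And>\<phi>. \<phi> \<in> test_functions \<Omega> \<Longrightarrow> l2inner M h \<phi> = 0"
  shows "AE x in M. h x = 0"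
proof (rule l2norm_eq_0_AE[OF h], rule ccontr)
  let ?n = "l2norm M h"
  assume "?n \<noteq> 0"
  then have "0 < ?n" by (simp add: less_le)
  from test_functions_dense[OF open_dom bounded_dom h this]
  obtain \<phi> where p: "\<phi> \<in> test_functions \<Omega>" "l2norm M (\<lambda>x. h x - \<phi> x) < ?n" .
  have "?n\<^sup>2 = l2inner M h (\<lambda>x. h x - \<phi> x)"
    using orth[OF p(1)] by (simp add: l2norm_sq_inner l2inner_diff_right h test_sq[OF p(1)])
  also have "\<dots> \<le> ?n * l2norm M (\<lambda>x. h x - \<phi> x)"
    using l2_Cauchy_Schwarz[OF h sq_integrable_diff[OF h test_sq[OF p(1)]]] by simp
  also have "\<dots> < ?n * ?n" using p(2) \<open>0 < ?n\<close> by (rule mult_strict_left_mono)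
  finally show False by (simp add: power2_eq_square)
qed

text \<open>Justifies the choice in \<open>weak_gradient\<close>: whichever representative
  \<open>SOME\<close> picks, it equals any known gradient up to a null set.\<close>

lemma has_weak_gradient_unique:
  assumes "has_weak_gradient \<Omega> f g" "has_weak_gradient \<Omega> f g'"
  shows "AE x in M. g x = g' x"
proof -
  have sq: "sq_integrable M (\<lambda>x. g x $ i)" "sq_integrable M (\<lambda>x. g' x $ i)" for i
    using assms by (auto simp: has_weak_gradient_iff sq_integrable_vec_iff)
  have "AE x in M. g x $ i - g' x $ i = 0" for i
    by (rule orthogonal_to_test_functions)
      (use assms in \<open>auto simp: has_weak_gradient_iff sq l2inner_diff_left test_sq intro!: sq_integrable_diff sq\<close>)
  then have "AE x in M. \<forall>i\<in>UNIV. g x $ i - g' x $ i = 0"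
    by (intro AE_finite_allI) auto
  then show ?thesis by (simp add: vec_eq_iff)
qed

text \<open>Two coefficients at once cover sums, differences and scalar multiples.\<close>

lemma has_weak_gradient_lincomb:
  assumes "has_weak_gradient \<Omega> f F" "has_weak_gradient \<Omega> g G" "f \<in> L2 \<Omega>" "g \<in> L2 \<Omega>"
  shows "has_weak_gradient \<Omega> (\<lambda>x. a * f x + b * g x) (\<lambda>x. a *\<^sub>R F x + b *\<^sub>R G x)"
proof -
  have sq: "sq_integrable M (\<lambda>x. a * f x)" "sq_integrable M (\<lambda>x. b * g x)"
    using assms(3,4) sq_integrable_scaleR[of M f a] sq_integrable_scaleR[of M g b]
    by (auto simp: L2_iff_sq_integrable)
  have FG: "sq_integrable M (\<lambda>x. a *\<^sub>R F x)" "sq_integrable M (\<lambda>x. b *\<^sub>R G x)"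
    using assms(1,2) by (auto simp: has_weak_gradient_iff)
  then have FGi: "sq_integrable M (\<lambda>x. a * F x $ i)" "sq_integrable M (\<lambda>x. b * G x $ i)" for i
    by (auto simp: sq_integrable_vec_iff)
  have s: "l2inner M (\<lambda>x. c * u x) v = c * l2inner M u v" for c u and v :: "real^2 \<Rightarrow> real"
    using l2inner_scaleR_left[of M c u v] by simp
  show ?thesis
    unfolding has_weak_gradient_iff
    using assms(1,2)
    by (auto simp: has_weak_gradient_iff l2inner_add_left sq FGi test_sq test_functions_partial_deriv s algebra_simps
      intro!: sq_integrable_add FG)
qed

lemma weak_gradient: "f \<in> H1 \<Omega> \<Longrightarrow> has_weak_gradient \<Omega> f (weak_gradient \<Omega> f)"
  unfolding weak_gradient_def H1_def by (metis (mono_tags, lifting) mem_Collect_eq someI_ex)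

lemma H1_L2: "f \<in> H1 \<Omega> \<Longrightarrow> f \<in> L2 \<Omega>" by (simp add: H1_def)

lemma H1_sq: "f \<in> H1 \<Omega> \<Longrightarrow> sq_integrable M f" by (simp add: H1_def L2_iff_sq_integrable)

lemma weak_gradient_sq: "f \<in> H1 \<Omega> \<Longrightarrow> sq_integrable M (weak_gradient \<Omega> f)"
  using weak_gradient by (simp add: has_weak_gradient_iff)

lemma weak_gradient_AE_eq: "f \<in> L2 \<Omega> \<Longrightarrow> has_weak_gradient \<Omega> f g \<Longrightarrow> AE x in M. weak_gradient \<Omega> f x = g x"
  by (rule has_weak_gradient_unique[OF weak_gradient]) (auto simp: H1_def)

lemma H1_lincomb:
  assumes "f \<in> H1 \<Omega>" "g \<in> H1 \<Omega>"
  shows "(\<lambda>x. a * f x + b * g x) \<in> H1 \<Omega>"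
    and "AE x in M. weak_gradient \<Omega> (\<lambda>x. a * f x + b * g x) x = a *\<^sub>R weak_gradient \<Omega> f x + b *\<^sub>R weak_gradient \<Omega> g x"
proof -
  have w: "has_weak_gradient \<Omega> (\<lambda>x. a * f x + b * g x) (\<lambda>x. a *\<^sub>R weak_gradient \<Omega> f x + b *\<^sub>R weak_gradient \<Omega> g x)"
    by (intro has_weak_gradient_lincomb weak_gradient H1_L2 assms)
  have l: "(\<lambda>x. a * f x + b * g x) \<in> L2 \<Omega>"
    using sq_integrable_add[OF sq_integrable_scaleR[OF H1_sq[OF assms(1)], of a] sq_integrable_scaleR[OF H1_sq[OF assms(2)], of b]]
    by (simp add: L2_iff_sq_integrable)
  show "(\<lambda>x. a * f x + b * g x) \<in> H1 \<Omega>" using w l by (auto simp: H1_def)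
  show "AE x in M. weak_gradient \<Omega> (\<lambda>x. a * f x + b * g x) x = a *\<^sub>R weak_gradient \<Omega> f x + b *\<^sub>R weak_gradient \<Omega> g x"
    by (rule weak_gradient_AE_eq[OF l w])
qed

lemma H1_const:
  shows "(\<lambda>x. c) \<in> H1 \<Omega>" and "AE x in M. weak_gradient \<Omega> (\<lambda>x. c) x = 0"
proof -
  have l: "(\<lambda>x. c) \<in> L2 \<Omega>" by (simp add: L2_def)
  show "(\<lambda>x. c) \<in> H1 \<Omega>" using l has_weak_gradient_const[OF open_dom] by (auto simp: H1_def)
  show "AE x in M. weak_gradient \<Omega> (\<lambda>x. c) x = 0"
    by (rule weak_gradient_AE_eq[OF l has_weak_gradient_const[OF open_dom]])
qed

lemma X0_iff: "f \<in> X0 \<Omega> \<longleftrightarrow> sq_integrable M f"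
  by (simp add: X0_def L2_iff_sq_integrable sq_integrable_vec_iff)

lemma X1_sq: "f \<in> X1 \<Omega> \<Longrightarrow> sq_integrable M f"
  by (simp add: X1_def H1_sq sq_integrable_vec_iff)

lemma norm_X0_eq: "sq_integrable M f \<Longrightarrow> norm_X0 \<Omega> f = l2norm M f"
  using l2norm_sq_vec[of M f] by (simp add: norm_X0_def l2norm_sq real_sqrt_unique)

lemma weak_jacobian_sq: "f \<in> X1 \<Omega> \<Longrightarrow> sq_integrable M (weak_jacobian \<Omega> f)"
  unfolding sq_integrable_vec_iff[of M "weak_jacobian \<Omega> f"]
  by (simp add: X1_def weak_jacobian_def weak_gradient_sq)

lemma X1_lincomb:
  assumes "f \<in> X1 \<Omega>" "g \<in> X1 \<Omega>"
  shows "(\<lambda>x. a *\<^sub>R f x + b *\<^sub>R g x) \<in> X1 \<Omega>"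
    and "AE x in M. weak_jacobian \<Omega> (\<lambda>x. a *\<^sub>R f x + b *\<^sub>R g x) x = a *\<^sub>R weak_jacobian \<Omega> f x + b *\<^sub>R weak_jacobian \<Omega> g x"
proof -
  have fg: "(\<lambda>x. f x $ i) \<in> H1 \<Omega>" "(\<lambda>x. g x $ i) \<in> H1 \<Omega>" for i using assms by (auto simp: X1_def)
  show "(\<lambda>x. a *\<^sub>R f x + b *\<^sub>R g x) \<in> X1 \<Omega>"
    using H1_lincomb(1)[OF fg] by (simp add: X1_def)
  have "AE x in M. \<forall>i\<in>UNIV. weak_gradient \<Omega> (\<lambda>x. a * f x $ i + b * g x $ i) x
      = a *\<^sub>R weak_gradient \<Omega> (\<lambda>x. f x $ i) x + b *\<^sub>R weak_gradient \<Omega> (\<lambda>x. g x $ i) x"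
    using H1_lincomb(2)[OF fg] by (intro AE_finite_allI) auto
  then show "AE x in M. weak_jacobian \<Omega> (\<lambda>x. a *\<^sub>R f x + b *\<^sub>R g x) x = a *\<^sub>R weak_jacobian \<Omega> f x + b *\<^sub>R weak_jacobian \<Omega> g x"
    by eventually_elim (simp add: weak_jacobian_def vec_eq_iff)
qed

lemma X1_diff:
  assumes "f \<in> X1 \<Omega>" "g \<in> X1 \<Omega>"
  shows "(\<lambda>x. f x - g x) \<in> X1 \<Omega>"
    and "AE x in M. weak_jacobian \<Omega> (\<lambda>x. f x - g x) x = weak_jacobian \<Omega> f x - weak_jacobian \<Omega> g x"
  using X1_lincomb[OF assms, of 1 "-1"] by simp_all

lemma X1_add:
  assumes "f \<in> X1 \<Omega>" "g \<in> X1 \<Omega>"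
  shows "(\<lambda>x. f x + g x) \<in> X1 \<Omega>"
    and "AE x in M. weak_jacobian \<Omega> (\<lambda>x. f x + g x) x = weak_jacobian \<Omega> f x + weak_jacobian \<Omega> g x"
  using X1_lincomb[OF assms, of 1 1] by simp_all

lemma X1_const:
  shows "(\<lambda>x. c) \<in> X1 \<Omega>" and "AE x in M. weak_jacobian \<Omega> (\<lambda>x. c) x = 0"
proof -
  show "(\<lambda>x. c) \<in> X1 \<Omega>" by (simp add: X1_def H1_const)
  have "AE x in M. \<forall>i\<in>UNIV. weak_gradient \<Omega> (\<lambda>x. c $ i) x = 0"
    by (intro AE_finite_allI H1_const) auto
  then show "AE x in M. weak_jacobian \<Omega> (\<lambda>x. c) x = 0"
    by eventually_elim (simp add: weak_jacobian_def vec_eq_iff)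
qed

text \<open>The part of \<open>F\<close> that is a test function is integrated by parts; the rest is small.\<close>

lemma pairing_weak_gradient_small:
  assumes F: "sq_integrable M F" and "0 < \<delta>"
  obtains C where "0 \<le> C" "\<And>f. f \<in> H1 \<Omega> \<Longrightarrow>
    \<bar>l2inner M F (\<lambda>x. weak_gradient \<Omega> f x $ i)\<bar> \<le> \<delta> * l2norm M (weak_gradient \<Omega> f) + C * l2norm M f"
proof -
  from test_functions_dense[OF open_dom bounded_dom assms]
  obtain \<phi> where p: "\<phi> \<in> test_functions \<Omega>" "l2norm M (\<lambda>x. F x - \<phi> x) < \<delta>" .
  have d: "sq_integrable M (partial_deriv i \<phi>)" by (intro test_sq test_functions_partial_deriv p)
  show thesis
  proof
    show "0 \<le> l2norm M (partial_deriv i \<phi>)" by simp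
    fix f assume f: "f \<in> H1 \<Omega>"
    let ?g = "\<lambda>x. weak_gradient \<Omega> f x $ i"
    have g: "sq_integrable M ?g" using weak_gradient_sq[OF f] by (simp add: sq_integrable_vec_iff)
    have "l2inner M F ?g = l2inner M (\<lambda>x. (F x - \<phi> x) + \<phi> x) ?g" by simp
    also have "\<dots> = l2inner M (\<lambda>x. F x - \<phi> x) ?g + l2inner M \<phi> ?g"
      by (intro l2inner_add_left sq_integrable_diff F test_sq p g)
    also have "l2inner M \<phi> ?g = - l2inner M f (partial_deriv i \<phi>)"
      using weak_gradient[OF f] p(1) by (simp add: has_weak_gradient_iff l2inner_commute[of M \<phi>])
    finally have eq: "l2inner M F ?g = l2inner M (\<lambda>x. F x - \<phi> x) ?g - l2inner M f (partial_deriv i \<phi>)" by simp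
    have "\<bar>l2inner M (\<lambda>x. F x - \<phi> x) ?g\<bar> \<le> l2norm M (\<lambda>x. F x - \<phi> x) * l2norm M ?g"
      by (intro l2_Cauchy_Schwarz sq_integrable_diff F test_sq p g)
    also have "\<dots> \<le> \<delta> * l2norm M (weak_gradient \<Omega> f)"
      using p(2) \<open>0 < \<delta>\<close> by (intro mult_mono l2norm_nth_le weak_gradient_sq f) auto
    finally have 1: "\<bar>l2inner M (\<lambda>x. F x - \<phi> x) ?g\<bar> \<le> \<delta> * l2norm M (weak_gradient \<Omega> f)" .
    have 2: "\<bar>l2inner M f (partial_deriv i \<phi>)\<bar> \<le> l2norm M (partial_deriv i \<phi>) * l2norm M f"
      using l2_Cauchy_Schwarz[OF H1_sq[OF f] d] by (simp add: mult.commute)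
    show "\<bar>l2inner M F ?g\<bar> \<le> \<delta> * l2norm M (weak_gradient \<Omega> f) + l2norm M (partial_deriv i \<phi>) * l2norm M f"
      unfolding eq using 1 2 by linarith
  qed
qed

text \<open>Sums the scalar bound over the four entries, with \<open>\<delta> / 4\<close> for each.
  As \<open>C\<close> does not depend on \<open>w\<close>, a small L2 norm of \<open>w\<close> makes
  the second term small, and only a small multiple of the Jacobian norm remains, which coercivity
  can absorb.\<close>

lemma pairing_weak_jacobian_small:
  assumes F: "sq_integrable M F" and "0 < \<delta>"
  obtains C where "0 \<le> C" "\<And>w. w \<in> X1 \<Omega> \<Longrightarrow>
    \<bar>l2inner M F (weak_jacobian \<Omega> w)\<bar> \<le> \<delta> * l2norm M (weak_jacobian \<Omega> w) + C * l2norm M w"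
proof -
  have Fij: "sq_integrable M (\<lambda>x. F x $ i $ j)" for i j using F by (simp add: sq_integrable_vec_iff)
  have "\<exists>C. 0 \<le> C \<and> (\<forall>f\<in>H1 \<Omega>. \<bar>l2inner M (\<lambda>x. F x $ i $ j) (\<lambda>x. weak_gradient \<Omega> f x $ j)\<bar>
      \<le> \<delta> / 4 * l2norm M (weak_gradient \<Omega> f) + C * l2norm M f)" for i j
    by (rule pairing_weak_gradient_small[OF Fij, of "\<delta> / 4" i j j]) (use \<open>0 < \<delta>\<close> in auto)
  then obtain C where C: "\<And>i j. 0 \<le> C i j" "\<And>i j f. f \<in> H1 \<Omega> \<Longrightarrow>
      \<bar>l2inner M (\<lambda>x. F x $ i $ j) (\<lambda>x. weak_gradient \<Omega> f x $ j)\<bar>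
      \<le> \<delta> / 4 * l2norm M (weak_gradient \<Omega> f) + C i j * l2norm M f" by metis
  show thesis
  proof
    show "0 \<le> (\<Sum>i\<in>UNIV. \<Sum>j\<in>UNIV. C i j)" by (intro sum_nonneg C)
    fix w assume w: "w \<in> X1 \<Omega>"
    have wi: "(\<lambda>x. w x $ i) \<in> H1 \<Omega>" for i using w by (simp add: X1_def)
    have J: "weak_jacobian \<Omega> w x $ i = weak_gradient \<Omega> (\<lambda>x. w x $ i) x" for x i
      by (simp add: weak_jacobian_def)
    let ?t = "\<lambda>i j. l2inner M (\<lambda>x. F x $ i $ j) (\<lambda>x. weak_gradient \<Omega> (\<lambda>x. w x $ i) x $ j)"
    let ?b = "\<lambda>i j. \<delta> / 4 * l2norm M (weak_jacobian \<Omega> w) + C i j * l2norm M w"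
    have t: "\<bar>?t i j\<bar> \<le> ?b i j" for i j
    proof -
      have "l2norm M (weak_gradient \<Omega> (\<lambda>x. w x $ i)) \<le> l2norm M (weak_jacobian \<Omega> w)"
        using l2norm_nth_le[OF weak_jacobian_sq[OF w], of i] by (simp add: J)
      moreover have "l2norm M (\<lambda>x. w x $ i) \<le> l2norm M w" by (rule l2norm_nth_le[OF X1_sq[OF w]])
      ultimately show ?thesis
        using C(1)[of i j] \<open>0 < \<delta>\<close>
        by (intro order_trans[OF C(2)[OF wi]] add_mono mult_left_mono) auto
    qed
    have "l2inner M F (weak_jacobian \<Omega> w) = (\<Sum>i\<in>UNIV. \<Sum>j\<in>UNIV. ?t i j)"
      using F weak_jacobian_sq[OF w]
      by (simp add: l2inner_vec sq_integrable_vec_iff J weak_gradient_sq[OF wi])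
    also have "\<bar>\<dots>\<bar> \<le> (\<Sum>i\<in>UNIV. \<Sum>j\<in>UNIV. ?b i j)"
      by (intro order_trans[OF sum_abs] sum_mono t)
    also have "\<dots> = \<delta> * l2norm M (weak_jacobian \<Omega> w) + (\<Sum>i\<in>UNIV. \<Sum>j\<in>UNIV. C i j) * l2norm M w"
      by (simp add: sum_2 algebra_simps)
    finally show "\<bar>l2inner M F (weak_jacobian \<Omega> w)\<bar>
      \<le> \<delta> * l2norm M (weak_jacobian \<Omega> w) + (\<Sum>i\<in>UNIV. \<Sum>j\<in>UNIV. C i j) * l2norm M w" .
  qed
qed

end

section \<open>The diffusion form\<close>

text \<open>The integrand of the weak formulation is a Frobenius inner product, so the L2 calculus
  of matrix fields applies to it.\<close>

lemma trace_transpose_mult_eq_inner: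
  fixes A D B :: "real^2^2"
  shows "trace (transpose A ** D ** B) = A \<bullet> (D ** B)"
  by (simp add: trace_def transpose_def matrix_matrix_mult_def inner_vec_def sum_2 algebra_simps)

text \<open>Moves the coefficient to the fixed Jacobian, which leaves the unknown Jacobian bare and
  open to integration by parts.\<close>

lemma inner_matrix_mult_transpose:
  fixes A D B :: "real^2^2"
  shows "A \<bullet> (D ** B) = (transpose D ** A) \<bullet> B"
  by (simp add: transpose_def matrix_matrix_mult_def inner_vec_def sum_2 algebra_simps)

text \<open>Both sides split over the columns of \<open>A\<close>: left multiplication by
  \<open>D\<close> acts on each column separately, and ellipticity is used on each.\<close>

lemma inner_matrix_mult_coercive:
  fixes A D :: "real^2^2"
  assumes "\<And>\<xi>. \<alpha> * (norm \<xi>)\<^sup>2 \<le> \<xi> \<bullet> (D *v \<xi>)"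
  shows "\<alpha> * (norm A)\<^sup>2 \<le> A \<bullet> (D ** A)"
proof -
  have "A \<bullet> (D ** A) = (\<Sum>k\<in>UNIV. column k A \<bullet> (D *v column k A))"
    by (simp add: column_def matrix_vector_mult_def matrix_matrix_mult_def inner_vec_def sum_2 algebra_simps)
  moreover have "(norm A)\<^sup>2 = (\<Sum>k\<in>UNIV. (norm (column k A))\<^sup>2)"
    by (simp add: column_def norm_vec_sq sum_2)
  ultimately show ?thesis
    using assms by (simp add: sum_distrib_left sum_mono)
qed

text \<open>The factor 8 is crude: the norm is at most the sum of the absolute values of four
  entries, and each entry is a sum of two products.\<close>

lemma norm_matrix_mult_entries_le:
  fixes A B :: "real^2^2"
  assumes "\<And>i j. \<bar>A $ i $ j\<bar> \<le> a"
  shows "norm (A ** B) \<le> 8 * a * norm B"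
proof -
  have B: "\<bar>B $ i $ j\<bar> \<le> norm B" for i j
    using order_trans[OF component_le_norm_cart Finite_Cartesian_Product.norm_nth_le] by blast
  have ent: "\<bar>(A ** B) $ i $ j\<bar> \<le> 2 * (a * norm B)" for i j
  proof -
    have k: "\<bar>A $ i $ k * B $ k $ j\<bar> \<le> a * norm B" for k
      unfolding abs_mult using order_trans[OF abs_ge_zero assms] by (intro mult_mono assms B) auto
    have "(A ** B) $ i $ j = A $ i $ 1 * B $ 1 $ j + A $ i $ 2 * B $ 2 $ j"
      by (simp add: matrix_matrix_mult_def sum_2)
    then show ?thesis using k[of 1] k[of 2] by linarith
  qed
  have "norm (A ** B) \<le> (\<Sum>i\<in>UNIV. norm ((A ** B) $ i))"
    by (simp add: norm_vec_def L2_set_le_sum)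
  also have "\<dots> \<le> (\<Sum>i\<in>UNIV. \<Sum>j\<in>UNIV. \<bar>(A ** B) $ i $ j\<bar>)"
    by (intro sum_mono norm_le_l1_cart)
  also have "\<dots> \<le> (\<Sum>i\<in>(UNIV::2 set). \<Sum>j\<in>(UNIV::2 set). 2 * (a * norm B))"
    by (intro sum_mono ent)
  finally show ?thesis by simp
qed

lemma borel_measurable_matrix_mult:
  fixes A B :: "'a \<Rightarrow> real^2^2"
  assumes "A \<in> borel_measurable M" "B \<in> borel_measurable M"
  shows "(\<lambda>x. A x ** B x) \<in> borel_measurable M"
proof (rule borel_measurable_continuous_Pair[OF assms])
  show "continuous_on UNIV (\<lambda>x::(real^2^2) \<times> (real^2^2). fst x ** snd x)"
    unfolding matrix_matrix_mult_def by (intro continuous_intros)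
qed

lemma matrix_sub_rdistrib:
  fixes A B C :: "real^2^2" shows "(A - B) ** C = A ** C - B ** C"
  by (simp add: matrix_matrix_mult_def vec_eq_iff sum_2 algebra_simps)

text \<open>Entrywise Lipschitz and uniform bounds pass to the transpose, so \<open>D\<close> and
  its transpose are both instances; the transpose appears when the coefficient is moved across an
  inner product.\<close>

locale coefficient = bounded_domain \<Omega> for \<Omega> +
  fixes A :: "real^2 \<Rightarrow> real^2^2" and L K :: real
  assumes lipschitz: "\<And>y z i j. \<bar>A z $ i $ j - A y $ i $ j\<bar> \<le> L * norm (z - y)"
    and bounded: "\<And>z i j. \<bar>A z $ i $ j\<bar> \<le> K"
    and L_pos: "0 < L" and K_pos: "0 < K"
begin

lemma A_continuous: "continuous_on UNIV A"
proof -
  have "continuous_on UNIV (\<lambda>z. A z $ i $ j)" for i j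
    by (rule lipschitz_on_continuous_on[of L])
      (use lipschitz L_pos in \<open>auto intro!: lipschitz_onI simp: dist_norm\<close>)
  then have "continuous_on UNIV (\<lambda>z. \<chi> i j. A z $ i $ j)"
    by (intro continuous_on_vec_lambda)
  then show ?thesis by simp
qed

lemma A_measurable: "v \<in> borel_measurable M \<Longrightarrow> (\<lambda>x. A (v x)) \<in> borel_measurable M"
  by (rule measurable_compose[OF _ borel_measurable_continuous_onI[OF A_continuous]])

lemma A_mult_sq:
  fixes G :: "real^2 \<Rightarrow> real^2^2"
  assumes "v \<in> borel_measurable M" "sq_integrable M G"
  shows "sq_integrable M (\<lambda>x. A (v x) ** G x)"
proof (rule sq_integrable_bound[OF assms(2), where c="8 * K"])
  show "(\<lambda>x. A (v x) ** G x) \<in> borel_measurable M"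
    by (intro borel_measurable_matrix_mult A_measurable assms(1) sq_integrable_borel[OF assms(2)])
  show "norm (A (v x) ** G x) \<le> 8 * K * norm (G x)" for x
    by (rule norm_matrix_mult_entries_le[OF bounded])
qed

lemma A_diff_mult_sq:
  fixes G :: "real^2 \<Rightarrow> real^2^2"
  assumes "v \<in> borel_measurable M" "z \<in> borel_measurable M" "sq_integrable M G"
  shows "sq_integrable M (\<lambda>x. (A (v x) - A (z x)) ** G x)"
  using sq_integrable_diff[OF A_mult_sq[OF assms(1,3)] A_mult_sq[OF assms(2,3)]]
  by (simp add: matrix_sub_rdistrib)

text \<open>An L2 bound on \<open>A (v x) - A (z x)\<close> alone does not control its product with
  an L2 field. So \<open>G\<close> is cut off at height \<open>n\<close>: the bound on
  \<open>A\<close> handles the tail, and the Lipschitz bound handles the truncated part.\<close>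

lemma A_diff_small:
  fixes G :: "real^2 \<Rightarrow> real^2^2"
  assumes z: "sq_integrable M z" and G: "sq_integrable M G" and "0 < \<delta>"
  obtains \<eta> where "0 < \<eta>"
    "\<And>v. sq_integrable M v \<Longrightarrow> l2norm M (\<lambda>x. v x - z x) \<le> \<eta> \<Longrightarrow>
      l2norm M (\<lambda>x. (A (v x) - A (z x)) ** G x) \<le> \<delta>"
proof -
  define H where "H n x = (if norm (G x) \<le> real n then G x else 0)" for n :: nat and x
  have Gm[measurable]: "G \<in> borel_measurable M" by (rule sq_integrable_borel[OF G])
  have Hm: "H n \<in> borel_measurable M" for n unfolding H_def by measurable
  have lim: "(\<lambda>n. l2norm M (\<lambda>x. G x - H n x)) \<longlonglongrightarrow> 0"
  proof (rule l2norm_dominated_convergence[OF Gm Hm _ G])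
    show "(\<lambda>n. H n x) \<longlonglongrightarrow> G x" for x
    proof (rule tendsto_eventually)
      obtain N :: nat where "norm (G x) \<le> real N" using real_arch_simple by blast
      then show "\<forall>\<^sub>F n in sequentially. H n x = G x"
        unfolding eventually_sequentially H_def by (intro exI[of _ N]) auto
    qed
  qed (simp add: H_def)
  \<comment> \<open>Entries of the difference are at most \<open>2 * K\<close>, so the tail
    contributes at most \<open>8 * (2 * K) * \<delta> / (32 * K)\<close>, half of
    \<open>\<delta>\<close>.\<close>
  have "0 < \<delta> / (32 * K)" using \<open>0 < \<delta>\<close> K_pos by simp
  from order_tendstoD(2)[OF lim this] obtain n where n: "l2norm M (\<lambda>x. G x - H n x) < \<delta> / (32 * K)"
    unfolding eventually_sequentially by blast
  have HG: "norm (H n x) \<le> norm (G x)" for x by (simp add: H_def)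
  have Hn: "norm (H n x) \<le> real n" for x by (simp add: H_def)
  have Hsq: "sq_integrable M (H n)" by (rule sq_integrable_bound[OF G Hm, where c=1]) (use HG in simp)
  \<comment> \<open>Matches the factor \<open>8 * L * n\<close> of the truncated part, for which
    half of \<open>\<delta>\<close> is left; \<open>n + 1\<close> replaces \<open>n\<close> to keep
    the divisor positive.\<close>
  define \<eta> where "\<eta> = \<delta> / (16 * L * (real n + 1))"
  show thesis
  proof
    show "0 < \<eta>" using \<open>0 < \<delta>\<close> L_pos by (simp add: \<eta>_def)
    fix v :: "real^2 \<Rightarrow> real^2" assume v: "sq_integrable M v" and vz: "l2norm M (\<lambda>x. v x - z x) \<le> \<eta>"
    have vm: "v \<in> borel_measurable M" and zm: "z \<in> borel_measurable M"
      using v z by (auto intro: sq_integrable_borel)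
    let ?E = "\<lambda>x. A (v x) - A (z x)"
    have s1: "sq_integrable M (\<lambda>x. ?E x ** (G x - H n x))" and s2: "sq_integrable M (\<lambda>x. ?E x ** H n x)"
      by (intro A_diff_mult_sq vm zm sq_integrable_diff G Hsq)+
    have "l2norm M (\<lambda>x. ?E x ** G x) = l2norm M (\<lambda>x. ?E x ** (G x - H n x) + ?E x ** H n x)"
      by (simp flip: matrix_add_ldistrib)
    also have "\<dots> \<le> l2norm M (\<lambda>x. ?E x ** (G x - H n x)) + l2norm M (\<lambda>x. ?E x ** H n x)"
      by (rule l2norm_triangle[OF s1 s2])
    also have "l2norm M (\<lambda>x. ?E x ** (G x - H n x)) \<le> 8 * (2 * K) * l2norm M (\<lambda>x. G x - H n x)"
    proof (rule l2norm_bound[OF sq_integrable_diff[OF G Hsq] sq_integrable_borel[OF s1]])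
      fix x
      have "\<bar>?E x $ i $ j\<bar> \<le> 2 * K" for i j
        using bounded[of "v x" i j] bounded[of "z x" i j] by simp
      then show "norm (?E x ** (G x - H n x)) \<le> 8 * (2 * K) * norm (G x - H n x)"
        by (rule norm_matrix_mult_entries_le)
    qed (use K_pos in simp)
    also have "\<dots> \<le> \<delta> / 2" using n K_pos by (simp add: field_simps)
    also have "l2norm M (\<lambda>x. ?E x ** H n x) \<le> 8 * L * real n * l2norm M (\<lambda>x. v x - z x)"
    proof (rule l2norm_bound[OF sq_integrable_diff[OF v z] sq_integrable_borel[OF s2]])
      fix x
      have "norm (?E x ** H n x) \<le> 8 * (L * norm (v x - z x)) * norm (H n x)"
        by (rule norm_matrix_mult_entries_le) (simp add: lipschitz)
      also have "\<dots> \<le> 8 * (L * norm (v x - z x)) * real n"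
        using Hn L_pos by (intro mult_left_mono) auto
      finally show "norm (?E x ** H n x) \<le> 8 * L * real n * norm (v x - z x)" by (simp add: mult_ac)
    qed (use L_pos in simp)
    also have "\<dots> \<le> 8 * L * (real n + 1) * \<eta>"
      using vz L_pos by (intro mult_mono) auto
    also have "\<dots> = \<delta> / 2"
    proof -
      have "8 * c * (\<delta> / (16 * c)) = \<delta> / 2" if "0 < c" for c :: real using that by (simp add: field_simps)
      from this[of "L * (real n + 1)"] show ?thesis using L_pos by (simp add: \<eta>_def mult.assoc)
    qed
    finally show "l2norm M (\<lambda>x. ?E x ** G x) \<le> \<delta>" by simp
  qed
qed

end

section \<open>The diffusion form near a fixed function\<close>

locale cross_diffusion = coefficient \<Omega> D L K for \<Omega> D L K +
  fixes \<alpha> :: real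
  assumes \<alpha>_pos: "0 < \<alpha>" and elliptic: "\<And>z \<xi>. \<alpha> * (norm \<xi>)\<^sup>2 \<le> \<xi> \<bullet> (D z *v \<xi>)"
begin

sublocale DT: coefficient \<Omega> "\<lambda>z. transpose (D z)" L K
  by unfold_locales (use lipschitz bounded L_pos K_pos in \<open>auto simp: transpose_def\<close>)

abbreviation J where "J \<equiv> weak_jacobian \<Omega>"

definition bform :: "(real^2 \<Rightarrow> real^2) \<Rightarrow> (real^2 \<Rightarrow> real^2) \<Rightarrow> (real^2 \<Rightarrow> real^2) \<Rightarrow> real" where
  "bform v y w = l2inner M (J w) (\<lambda>x. D (v x) ** J y x)"

lemma bform_eq_trace: "bform v y w = (\<integral>x. trace (transpose (J w x) ** D (v x) ** J y x) \<partial>M)"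
  by (simp add: bform_def l2inner_def trace_transpose_mult_eq_inner)

lemma bform_coercive:
  fixes W :: "real^2 \<Rightarrow> real^2^2"
  assumes "v \<in> borel_measurable M" and W: "sq_integrable M W"
  shows "\<alpha> * (l2norm M W)\<^sup>2 \<le> l2inner M W (\<lambda>x. D (v x) ** W x)"
proof -
  have "(\<integral>x. \<alpha> * (norm (W x))\<^sup>2 \<partial>M) \<le> (\<integral>x. W x \<bullet> (D (v x) ** W x) \<partial>M)"
  proof (rule integral_mono)
    show "integrable M (\<lambda>x. \<alpha> * (norm (W x))\<^sup>2)" using W by (simp add: sq_integrable_def)
    show "integrable M (\<lambda>x. W x \<bullet> (D (v x) ** W x))" by (intro sq_integrable_inner A_mult_sq assms)
    show "\<alpha> * (norm (W x))\<^sup>2 \<le> W x \<bullet> (D (v x) ** W x)" for x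
      by (rule inner_matrix_mult_coercive[OF elliptic])
  qed
  then show ?thesis by (simp add: l2norm_sq l2inner_def)
qed

text \<open>With \<open>W\<close> the Jacobian of \<open>v - z\<close>, the form expands into a
  quadratic term in \<open>W\<close>, two terms linear in \<open>W\<close> and one free of
  \<open>W\<close>. Coercivity controls the first. In the others \<open>D (v x)\<close> is replaced
  by \<open>D (z x)\<close> at a small cost by \<open>A_diff_small\<close>; the linear terms become
  a pairing with the fixed field \<open>F\<close>, small by integration by parts, and half of the
  coercive term absorbs what is left.\<close>

lemma bform_rate_bound:
  assumes y: "y \<in> X1 \<Omega>" and z: "z \<in> X1 \<Omega>" and "0 < \<epsilon>"
  obtains \<eta> where "0 < \<eta>"
    "\<And>v. v \<in> X1 \<Omega> \<Longrightarrow> l2norm M (\<lambda>x. v x - z x) \<le> \<eta> \<Longrightarrow>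
      - bform v v (\<lambda>x. v x - z x + y x)
      \<le> - (\<alpha> / 2) * (l2norm M (J (\<lambda>x. v x - z x)))\<^sup>2 - bform z z y + \<epsilon>"
proof -
  have Jy: "sq_integrable M (J y)" and Jz: "sq_integrable M (J z)"
    by (intro weak_jacobian_sq y z)+
  have zs: "sq_integrable M z" and zm: "z \<in> borel_measurable M"
    using X1_sq[OF z] by (auto intro: sq_integrable_borel)
  have cancel: "c * (\<epsilon> / (3 * c)) = \<epsilon> / 3" if "0 < c" for c :: real using that by (simp add: field_simps)
  \<comment> \<open>The bound 1 gives \<open>\<delta>^2 \<le> \<delta>\<close>; the other two keep
    the Young remainder and the error paired with \<open>J y\<close> below
    \<open>\<epsilon> / 3\<close> each.\<close>
  define \<delta> where "\<delta> = min 1 (min (2 * \<alpha> * \<epsilon> / 27) (\<epsilon> / (3 * (l2norm M (J y) + 1))))"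
  have \<delta>: "0 < \<delta>" using \<open>0 < \<epsilon>\<close> \<alpha>_pos by (simp add: \<delta>_def add_nonneg_pos)
  have "\<delta> * \<delta> \<le> 1 * \<delta>" using \<delta> by (intro mult_right_mono) (auto simp: \<delta>_def)
  then have "9 * \<delta>\<^sup>2 / (2 * \<alpha>) \<le> 9 * \<delta> / (2 * \<alpha>)"
    using \<alpha>_pos by (intro divide_right_mono) (auto simp: power2_eq_square)
  also have "\<dots> \<le> \<epsilon> / 3"
  proof -
    have "\<delta> \<le> 2 * \<alpha> * \<epsilon> / 27"
      unfolding \<delta>_def by (rule order_trans[OF min.cobounded2 min.cobounded1])
    then show ?thesis using \<alpha>_pos by (simp add: field_simps)
  qed
  finally have \<delta>1: "9 * \<delta>\<^sup>2 / (2 * \<alpha>) \<le> \<epsilon> / 3" .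
  have \<delta>2: "l2norm M (J y) * \<delta> \<le> \<epsilon> / 3"
  proof -
    have "\<delta> \<le> \<epsilon> / (3 * (l2norm M (J y) + 1))"
      unfolding \<delta>_def by (rule order_trans[OF min.cobounded2 min.cobounded2])
    then have "(l2norm M (J y) + 1) * \<delta> \<le> (l2norm M (J y) + 1) * (\<epsilon> / (3 * (l2norm M (J y) + 1)))"
      by (intro mult_left_mono) auto
    also have "\<dots> = \<epsilon> / 3" by (rule cancel) (simp add: add_nonneg_pos)
    finally show ?thesis using \<delta> by (simp add: algebra_simps)
  qed
  \<comment> \<open>Collects the coefficients of both linear terms, frozen at \<open>z\<close>; the
    transpose comes from moving \<open>D\<close> onto \<open>J y\<close>.\<close>
  define F where "F x = D (z x) ** J z x + transpose (D (z x)) ** J y x" for x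
  have F1: "sq_integrable M (\<lambda>x. D (z x) ** J z x)" and F2: "sq_integrable M (\<lambda>x. transpose (D (z x)) ** J y x)"
    by (intro A_mult_sq DT.A_mult_sq zm Jy Jz)+
  have F: "sq_integrable M F" unfolding F_def by (intro sq_integrable_add F1 F2)
  obtain C where C: "0 \<le> C" "\<And>w. w \<in> X1 \<Omega> \<Longrightarrow> \<bar>l2inner M F (J w)\<bar> \<le> \<delta> * l2norm M (J w) + C * l2norm M w"
    by (rule pairing_weak_jacobian_small[OF F \<delta>]) blast
  obtain \<eta>1 where \<eta>1: "0 < \<eta>1" "\<And>v. sq_integrable M v \<Longrightarrow> l2norm M (\<lambda>x. v x - z x) \<le> \<eta>1 \<Longrightarrow>
      l2norm M (\<lambda>x. (D (v x) - D (z x)) ** J z x) \<le> \<delta>"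
    by (rule A_diff_small[OF zs Jz \<delta>]) blast
  obtain \<eta>2 where \<eta>2: "0 < \<eta>2" "\<And>v. sq_integrable M v \<Longrightarrow> l2norm M (\<lambda>x. v x - z x) \<le> \<eta>2 \<Longrightarrow>
      l2norm M (\<lambda>x. (transpose (D (v x)) - transpose (D (z x))) ** J y x) \<le> \<delta>"
    by (rule DT.A_diff_small[OF zs Jy \<delta>]) blast
  \<comment> \<open>The first bound spends the last third of \<open>\<epsilon>\<close> on
    \<open>C\<close> times the L2 norm of \<open>v - z\<close>; the other two keep the cost of
    freezing the coefficients below \<open>\<delta>\<close>. \<open>C\<close> may be 0, hence
    \<open>C + 1\<close>.\<close>
  define \<eta> where "\<eta> = min (\<epsilon> / (3 * (C + 1))) (min \<eta>1 \<eta>2)"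
  show thesis
  proof
    show "0 < \<eta>" using \<open>0 < \<epsilon>\<close> C(1) \<eta>1(1) \<eta>2(1) by (simp add: \<eta>_def add_nonneg_pos)
    fix v assume v: "v \<in> X1 \<Omega>" and vz: "l2norm M (\<lambda>x. v x - z x) \<le> \<eta>"
    have vs: "sq_integrable M v" and vm: "v \<in> borel_measurable M"
      using X1_sq[OF v] by (auto intro: sq_integrable_borel)
    let ?w = "\<lambda>x. v x - z x"
    define W where "W = J ?w"
    define g where "g = l2norm M W"
    have g: "0 \<le> g" by (simp add: g_def)
    have w: "?w \<in> X1 \<Omega>" by (rule X1_diff[OF v z])
    have W: "sq_integrable M W" unfolding W_def by (rule weak_jacobian_sq[OF w])
    have Jv: "sq_integrable M (J v)" by (rule weak_jacobian_sq[OF v])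
    have wy: "(\<lambda>x. ?w x + y x) \<in> X1 \<Omega>" by (rule X1_add[OF w y])
    have Jwy: "sq_integrable M (J (\<lambda>x. ?w x + y x))" by (rule weak_jacobian_sq[OF wy])
    have aeW: "AE x in M. J v x = W x + J z x"
      using X1_diff(2)[OF v z] unfolding W_def by eventually_elim simp
    have aewy: "AE x in M. J (\<lambda>x. ?w x + y x) x = W x + J y x"
      using X1_add(2)[OF w y] unfolding W_def .
    let ?DW = "\<lambda>x. D (v x) ** W x" and ?DZ = "\<lambda>x. D (v x) ** J z x"
    have DW: "sq_integrable M ?DW" and DZ: "sq_integrable M ?DZ" and Dv: "sq_integrable M (\<lambda>x. D (v x) ** J v x)"
      by (intro A_mult_sq vm W Jz Jv)+
    have "bform v v (\<lambda>x. ?w x + y x) = l2inner M (\<lambda>x. W x + J y x) (\<lambda>x. D (v x) ** J v x)"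
      unfolding bform_def
      by (rule l2inner_cong_AE) (use aewy Jwy W Jy Dv in \<open>auto intro: sq_integrable_borel sq_integrable_add\<close>)
    also have "\<dots> = l2inner M (\<lambda>x. D (v x) ** J v x) (\<lambda>x. W x + J y x)" by (rule l2inner_commute)
    also have "\<dots> = l2inner M (\<lambda>x. ?DW x + ?DZ x) (\<lambda>x. W x + J y x)"
    proof (rule l2inner_cong_AE)
      show "AE x in M. D (v x) ** J v x = ?DW x + ?DZ x"
        using aeW by eventually_elim (simp add: matrix_add_ldistrib)
    qed (use Dv DW DZ W Jy in \<open>auto intro: sq_integrable_borel sq_integrable_add\<close>)
    also have "\<dots> = l2inner M ?DW W + l2inner M ?DZ W + l2inner M ?DW (J y) + l2inner M ?DZ (J y)"
      by (simp add: l2inner_add_left l2inner_add_right sq_integrable_add DW DZ W Jy)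
    finally have eq: "bform v v (\<lambda>x. ?w x + y x) =
      l2inner M W ?DW + l2inner M ?DZ W + l2inner M (J y) ?DW + l2inner M (J y) ?DZ"
      by (simp add: l2inner_commute)
    let ?R1 = "\<lambda>x. (D (v x) - D (z x)) ** J z x"
    let ?R2 = "\<lambda>x. (transpose (D (v x)) - transpose (D (z x))) ** J y x"
    have R1: "sq_integrable M ?R1" and R2: "sq_integrable M ?R2"
      by (intro A_diff_mult_sq DT.A_diff_mult_sq vm zm Jz Jy)+
    have e1: "l2inner M ?DZ W = l2inner M (\<lambda>x. D (z x) ** J z x) W + l2inner M ?R1 W"
      by (subst l2inner_add_left[symmetric, OF F1 R1 W]) (simp add: matrix_sub_rdistrib)
    have "l2inner M (J y) ?DW = l2inner M (\<lambda>x. transpose (D (v x)) ** J y x) W"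
      by (simp add: l2inner_def inner_matrix_mult_transpose)
    also have "\<dots> = l2inner M (\<lambda>x. transpose (D (z x)) ** J y x) W + l2inner M ?R2 W"
      by (subst l2inner_add_left[symmetric, OF F2 R2 W]) (simp add: matrix_sub_rdistrib)
    finally have e2: "l2inner M (J y) ?DW = \<dots>" .
    have e3: "l2inner M (J y) ?DZ = bform z z y + l2inner M (J y) ?R1"
      unfolding bform_def by (subst l2inner_add_right[symmetric, OF F1 R1 Jy]) (simp add: matrix_sub_rdistrib)
    have e4: "l2inner M F W = l2inner M (\<lambda>x. D (z x) ** J z x) W + l2inner M (\<lambda>x. transpose (D (z x)) ** J y x) W"
      unfolding F_def by (rule l2inner_add_left[OF F1 F2 W])
    have "bform v v (\<lambda>x. ?w x + y x) = l2inner M W ?DW + l2inner M F W + l2inner M ?R1 W + l2inner M ?R2 W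
        + bform z z y + l2inner M (J y) ?R1"
      using eq e1 e2 e3 e4 by simp
    moreover have "\<alpha> * g\<^sup>2 \<le> l2inner M W ?DW"
      unfolding g_def by (rule bform_coercive[OF vm W])
    moreover have "\<bar>l2inner M F W\<bar> \<le> \<delta> * g + \<epsilon> / 3"
    proof -
      have "C * l2norm M ?w \<le> (C + 1) * (\<epsilon> / (3 * (C + 1)))"
        using C(1) vz \<open>0 < \<epsilon>\<close> by (intro mult_mono) (auto simp: \<eta>_def)
      also have "\<dots> = \<epsilon> / 3" by (rule cancel) (use C(1) in simp)
      finally show ?thesis using C(2)[OF w] unfolding W_def g_def by simp
    qed
    moreover have "\<bar>l2inner M ?R1 W\<bar> \<le> \<delta> * g"
      using vz unfolding g_def
      by (intro order_trans[OF l2_Cauchy_Schwarz[OF R1 W]] mult_right_mono \<eta>1(2) vs) (auto simp: \<eta>_def)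
    moreover have "\<bar>l2inner M ?R2 W\<bar> \<le> \<delta> * g"
      using vz unfolding g_def
      by (intro order_trans[OF l2_Cauchy_Schwarz[OF R2 W]] mult_right_mono \<eta>2(2) vs) (auto simp: \<eta>_def)
    moreover have "\<bar>l2inner M (J y) ?R1\<bar> \<le> \<epsilon> / 3"
    proof -
      have "l2norm M (J y) * l2norm M ?R1 \<le> l2norm M (J y) * \<delta>"
        using vz by (intro mult_left_mono \<eta>1(2) vs) (auto simp: \<eta>_def)
      then show ?thesis using l2_Cauchy_Schwarz[OF Jy R1] \<delta>2 by linarith
    qed
    \<comment> \<open>Young's inequality, by completing the square: the three linear contributions
      \<open>\<delta> * g\<close> cost half of the coercive term and a remainder of at most
      \<open>\<epsilon> / 3\<close>.\<close>
    moreover have "3 * (\<delta> * g) \<le> \<alpha> / 2 * g\<^sup>2 + \<epsilon> / 3"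
    proof -
      have "0 \<le> (\<alpha> * g - 3 * \<delta>)\<^sup>2 / (2 * \<alpha>)" using \<alpha>_pos by simp
      also have "\<dots> = \<alpha> / 2 * g\<^sup>2 - 3 * (\<delta> * g) + 9 * \<delta>\<^sup>2 / (2 * \<alpha>)"
        using \<alpha>_pos by (simp add: power2_eq_square field_simps)
      finally show ?thesis using \<delta>1 by simp
    qed
    ultimately have "- bform v v (\<lambda>x. ?w x + y x) \<le> - (\<alpha> / 2) * g\<^sup>2 - bform z z y + \<epsilon>"
      by (simp add: field_simps)
    then show "- bform v v (\<lambda>x. v x - z x + y x)
      \<le> - (\<alpha> / 2) * (l2norm M (J (\<lambda>x. v x - z x)))\<^sup>2 - bform z z y + \<epsilon>"
      unfolding g_def W_def .
  qed
qed

text \<open>The coefficient \<open>D (z x) ** J z x\<close> is fixed from the start, so integration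
  by parts alone suffices. It is applied to increments of the solution, whose Jacobians have no
  bound known in advance.\<close>

lemma bform_fixed_small:
  assumes z: "z \<in> X1 \<Omega>" and "0 < \<delta>"
  obtains C where "0 \<le> C" "\<And>w. w \<in> X1 \<Omega> \<Longrightarrow> \<bar>bform z z w\<bar> \<le> \<delta> * l2norm M (J w) + C * l2norm M w"
proof -
  have "sq_integrable M (\<lambda>x. D (z x) ** J z x)"
    by (intro A_mult_sq sq_integrable_borel X1_sq weak_jacobian_sq z)
  then obtain C where C: "0 \<le> C" "\<And>w. w \<in> X1 \<Omega> \<Longrightarrow>
      \<bar>l2inner M (\<lambda>x. D (z x) ** J z x) (J w)\<bar> \<le> \<delta> * l2norm M (J w) + C * l2norm M w"
    using \<open>0 < \<delta>\<close> by (rule pairing_weak_jacobian_small) blast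
  show thesis
    by (rule that[OF C(1)]) (unfold bform_def, subst l2inner_commute, rule C(2))
qed

lemma bform_self_nonneg: "z \<in> X1 \<Omega> \<Longrightarrow> 0 \<le> bform z z z"
  using bform_coercive[OF sq_integrable_borel[OF X1_sq] weak_jacobian_sq, of z z] \<alpha>_pos
  unfolding bform_def by (smt (verit) mult_nonneg_nonneg zero_le_power2)

lemma bform_const: "v \<in> borel_measurable M \<Longrightarrow> y \<in> X1 \<Omega> \<Longrightarrow> bform v y (\<lambda>x. c) = 0"
proof -
  assume v: "v \<in> borel_measurable M" and y: "y \<in> X1 \<Omega>"
  have "bform v y (\<lambda>x. c) = l2inner M (\<lambda>x. 0) (\<lambda>x. D (v x) ** J y x)"
    unfolding bform_def
    by (intro l2inner_cong_AE X1_const sq_integrable_borel[OF A_mult_sq] sq_integrable_borel[OF weak_jacobian_sq] v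
        weak_jacobian_sq y) auto
  then show ?thesis by (simp add: l2inner_def)
qed

end

section \<open>Left Dini derivatives and the dual norm\<close>

text \<open>Bounds by \<open>c\<close> the upper left Dini derivative, the limit superior of
  \<open>(f t - f s) / (t - s)\<close> as \<open>s\<close> increases to \<open>t\<close>. The slack
  \<open>e\<close> expresses the limit superior without extended reals.\<close>

definition left_dini_le :: "(real \<Rightarrow> real) \<Rightarrow> real \<Rightarrow> real \<Rightarrow> bool" where
  "left_dini_le f t c \<longleftrightarrow> (\<forall>e>0. \<forall>\<^sub>F s in at_left t. f t - f s \<le> (c + e) * (t - s))"

lemma left_dini_le_mono: "left_dini_le f t c \<Longrightarrow> c \<le> c' \<Longrightarrow> left_dini_le f t c'"
  unfolding left_dini_le_def
proof (intro allI impI)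
  fix e :: real assume *: "\<forall>e>0. \<forall>\<^sub>F s in at_left t. f t - f s \<le> (c + e) * (t - s)" "c \<le> c'" "0 < e"
  then have "\<forall>\<^sub>F s in at_left t. f t - f s \<le> (c + e) * (t - s)" by blast
  moreover have "\<forall>\<^sub>F s in at_left t. s < t" by (auto simp: eventually_at_filter)
  ultimately show "\<forall>\<^sub>F s in at_left t. f t - f s \<le> (c' + e) * (t - s)"
  proof eventually_elim
    case (elim s)
    have "(c + e) * (t - s) \<le> (c' + e) * (t - s)" using elim *(2) by (intro mult_right_mono) auto
    then show ?case using elim by linarith
  qed
qed

text \<open>A mean value inequality from one side. Subtract a line of slope \<open>c + e\<close>: a
  maximum at some \<open>t > a\<close> would make the left quotients of \<open>f\<close> at
  \<open>t\<close> at least \<open>c + e\<close>, so the maximum is at \<open>a\<close>.\<close>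

lemma left_dini_le_bound:
  assumes "a \<le> b" and cont: "continuous_on {a..b} f"
    and dini: "\<And>t. a < t \<Longrightarrow> t \<le> b \<Longrightarrow> left_dini_le f t c"
  shows "f b - f a \<le> c * (b - a)"
proof -
  have main: "f b - f a \<le> (c + e) * (b - a)" if "0 < e" for e
  proof -
    let ?g = "\<lambda>t. f t - (c + e) * t"
    have "continuous_on {a..b} ?g" by (intro continuous_intros cont)
    then obtain t where t: "t \<in> {a..b}" "\<And>s. s \<in> {a..b} \<Longrightarrow> ?g s \<le> ?g t"
      using continuous_attains_sup[of "{a..b}" ?g] \<open>a \<le> b\<close> by auto
    have "t = a"
    proof (rule ccontr)
      assume "t \<noteq> a"
      then have at: "a < t" using t by auto
      \<comment> \<open>The slack \<open>e / 2\<close> stays strictly below the slope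
        \<open>c + e\<close> that a maximum would enforce.\<close>
      then have "\<forall>\<^sub>F s in at_left t. f t - f s \<le> (c + e / 2) * (t - s)"
        using dini t(1) \<open>0 < e\<close> by (auto simp: left_dini_le_def)
      moreover have "\<forall>\<^sub>F s in at_left t. s < t" by (auto simp: eventually_at_filter)
      moreover have "\<forall>\<^sub>F s in at_left t. a < s" using at by (rule eventually_at_left_field[THEN iffD2, OF exI[of _ a], OF conjI]) auto
      ultimately have "\<forall>\<^sub>F s in at_left t. False"
      proof eventually_elim
        case (elim s)
        then have "?g s \<le> ?g t" using t(1) by (intro t(2)) auto
        then have "(c + e) * (t - s) \<le> (c + e / 2) * (t - s)" using elim(1) by (simp add: algebra_simps)
        then have "c + e \<le> c + e / 2" by (rule mult_right_le_imp_le) (use elim(2) in simp)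
        then show ?case using \<open>0 < e\<close> by simp
      qed
      then show False by simp
    qed
    then show ?thesis using t(2)[of b] \<open>a \<le> b\<close> by (simp add: algebra_simps)
  qed
  have le: "f b - f a - c * (b - a) \<le> e" if "0 < e" for e
  proof -
    have "0 < e / (b - a + 1)" using that \<open>a \<le> b\<close> by simp
    from main[OF this] have "f b - f a - c * (b - a) \<le> e / (b - a + 1) * (b - a)"
      by (simp only: distrib_right)
    also have "\<dots> \<le> e" using that \<open>a \<le> b\<close> by (simp add: field_simps)
    finally show ?thesis .
  qed
  show ?thesis using field_le_epsilon[of "f b - f a - c * (b - a)" 0] le by simp
qed

text \<open>A product rule that permits integrating factors. The weight has to be positive near
  \<open>t\<close> because it multiplies a one-sided bound.\<close>

lemma left_dini_le_mult_add:
  assumes f: "left_dini_le f t d" and m: "(m has_real_derivative m') (at t)" and "0 < m t"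
    and g: "(g has_real_derivative g') (at t)"
  shows "left_dini_le (\<lambda>s. f s * m s + g s) t (d * m t + f t * m' + g')"
  unfolding left_dini_le_def
proof (intro allI impI)
  fix e :: real assume "0 < e"
  define e1 where "e1 = e / (2 * m t)"
  have e1: "0 < e1" "e1 * m t < e" using \<open>0 < e\<close> \<open>0 < m t\<close> by (auto simp: e1_def)
  have qm: "((\<lambda>s. (m s - m t) / (s - t)) \<longlongrightarrow> m') (at_left t)"
    and qg: "((\<lambda>s. (g s - g t) / (s - t)) \<longlongrightarrow> g') (at_left t)"
    using m g by (auto simp: has_field_derivative_iff intro: tendsto_within_subset[where S=UNIV])
  have cm: "(m \<longlongrightarrow> m t) (at_left t)"
    using DERIV_isCont[OF m] by (auto simp: isCont_def intro: tendsto_within_subset[where S=UNIV])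
  have "((\<lambda>s. (d + e1) * m s + f t * ((m s - m t) / (s - t)) + (g s - g t) / (s - t)) \<longlongrightarrow>
      (d + e1) * m t + f t * m' + g') (at_left t)"
    by (intro tendsto_intros cm qm qg)
  then have "\<forall>\<^sub>F s in at_left t. (d + e1) * m s + f t * ((m s - m t) / (s - t)) + (g s - g t) / (s - t)
      < d * m t + f t * m' + g' + e"
    by (rule order_tendstoD(2)) (use e1 in \<open>simp add: algebra_simps\<close>)
  moreover have "\<forall>\<^sub>F s in at_left t. 0 < m s" using cm \<open>0 < m t\<close> by (rule order_tendstoD(1))
  moreover have "\<forall>\<^sub>F s in at_left t. f t - f s \<le> (d + e1) * (t - s)"
    using f e1(1) by (simp add: left_dini_le_def)
  moreover have "\<forall>\<^sub>F s in at_left t. s < t" by (auto simp: eventually_at_filter)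
  ultimately show "\<forall>\<^sub>F s in at_left t. f t * m t + g t - (f s * m s + g s) \<le> (d * m t + f t * m' + g' + e) * (t - s)"
  proof eventually_elim
    case (elim s)
    have "f t * m t + g t - (f s * m s + g s) = (f t - f s) * m s + (f t * (m t - m s) + (g t - g s))"
      by (simp add: algebra_simps)
    also have "\<dots> \<le> (d + e1) * (t - s) * m s + (f t * (m t - m s) + (g t - g s))"
      using elim by (intro add_right_mono mult_right_mono) auto
    also have "\<dots> = ((d + e1) * m s + f t * ((m s - m t) / (s - t)) + (g s - g t) / (s - t)) * (t - s)"
    proof -
      obtain p q where pq: "(m s - m t) / (s - t) = p" "(g s - g t) / (s - t) = q" by blast
      then have eq: "m t - m s = p * (t - s)" "g t - g s = q * (t - s)"
        using elim(4) by (auto simp: field_simps)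
      show ?thesis unfolding pq eq by (simp add: algebra_simps)
    qed
    also have "\<dots> \<le> (d * m t + f t * m' + g' + e) * (t - s)"
      using elim by (intro mult_right_mono) auto
    finally show ?case .
  qed
qed

text \<open>\<open>1 / (t0 - t)^2\<close> is the integrating factor of
  \<open>f' \<le> c - 2 f / (t0 - t)\<close>: the product has derivative at most
  \<open>c / (t0 - t)^2\<close>, which is the derivative of \<open>c / (t0 - t)\<close>. The
  difference of the two is therefore nonincreasing.\<close>

lemma left_dini_decay:
  fixes f :: "real \<Rightarrow> real"
  assumes "a \<le> b" "b < t0" and cont: "continuous_on {a..b} f"
    and dini: "\<And>t. a < t \<Longrightarrow> t \<le> b \<Longrightarrow> left_dini_le f t (c - 2 * f t / (t0 - t))"
  shows "f b / (t0 - b)\<^sup>2 - c / (t0 - b) \<le> f a / (t0 - a)\<^sup>2 - c / (t0 - a)"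
proof -
  let ?m = "\<lambda>t. 1 / (t0 - t)\<^sup>2" and ?g = "\<lambda>t. - c / (t0 - t)"
  let ?h = "\<lambda>t. f t * ?m t + ?g t"
  have "?h b - ?h a \<le> 0 * (b - a)"
  proof (rule left_dini_le_bound[OF \<open>a \<le> b\<close>])
    show "continuous_on {a..b} ?h"
      using \<open>b < t0\<close> by (intro continuous_intros cont) auto
    fix t assume t: "a < t" "t \<le> b"
    then have pos: "0 < t0 - t" using \<open>b < t0\<close> by simp
    have h: "((\<lambda>t. t0 - t) has_real_derivative - 1) (at t)" by (auto intro!: derivative_eq_intros)
    have "((\<lambda>h. 1 / h\<^sup>2) has_real_derivative - 2 / h^3) (at h)" if "0 < h" for h :: real
      using that by (auto intro!: derivative_eq_intros simp: field_simps power2_eq_square power3_eq_cube)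
    from DERIV_chain2[OF this[OF pos] h] have m: "(?m has_real_derivative 2 / (t0 - t)^3) (at t)" by simp
    have "((\<lambda>h. - c / h) has_real_derivative c / h\<^sup>2) (at h)" if "0 < h" for h :: real
      using that by (auto intro!: derivative_eq_intros simp: field_simps power2_eq_square)
    from DERIV_chain2[OF this[OF pos] h] have g: "(?g has_real_derivative - c / (t0 - t)\<^sup>2) (at t)" by simp
    have "left_dini_le ?h t ((c - 2 * f t / (t0 - t)) * ?m t + f t * (2 / (t0 - t)^3) + (- c / (t0 - t)\<^sup>2))"
      by (rule left_dini_le_mult_add[OF dini[OF t] m _ g]) (use pos in simp)
    moreover have "(c - 2 * f t / (t0 - t)) * ?m t + f t * (2 / (t0 - t)^3) + (- c / (t0 - t)\<^sup>2) = 0"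
    proof -
      have "(c - 2 * x / h) * (1 / h\<^sup>2) + x * (2 / h^3) + (- c / h\<^sup>2) = 0" if "0 < h" for h x :: real
        using that by (simp add: field_simps power2_eq_square power3_eq_cube)
      then show ?thesis using pos by blast
    qed
    ultimately show "left_dini_le ?h t 0" by simp
  qed
  then show ?thesis by simp
qed

section \<open>Dual norm and difference quotients in time\<close>

context bounded_domain begin

lemma norm_H1_eq: "norm_H1 \<Omega> f = sqrt ((l2norm M f)\<^sup>2 + (l2norm M (weak_gradient \<Omega> f))\<^sup>2)"
  by (simp add: norm_H1_def l2norm_sq)

lemma norm_H1_nonneg: "0 \<le> norm_H1 \<Omega> f"
  by (simp add: norm_H1_eq)

lemma norm_H1_le: "norm_H1 \<Omega> f \<le> l2norm M f + l2norm M (weak_gradient \<Omega> f)"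
  unfolding norm_H1_eq by (rule sqrt_sum_squares_le_sum) auto

lemma l2norm_le_norm_H1: "l2norm M f \<le> norm_H1 \<Omega> f"
  unfolding norm_H1_eq by (rule real_le_rsqrt) simp

lemma H1_scale: "f \<in> H1 \<Omega> \<Longrightarrow> (\<lambda>x. c * f x) \<in> H1 \<Omega>"
  using H1_lincomb(1)[of f f c 0] by simp

lemma norm_H1_scale:
  assumes f: "f \<in> H1 \<Omega>" shows "norm_H1 \<Omega> (\<lambda>x. c * f x) = \<bar>c\<bar> * norm_H1 \<Omega> f"
proof -
  have "l2norm M (weak_gradient \<Omega> (\<lambda>x. c * f x)) = l2norm M (\<lambda>x. c *\<^sub>R weak_gradient \<Omega> f x)"
    using H1_lincomb(2)[OF f f, of c 0] weak_gradient_sq[OF f] weak_gradient_sq[OF H1_scale[OF f]]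
    by (intro l2norm_cong_AE) (auto intro: sq_integrable_borel)
  then have "norm_H1 \<Omega> (\<lambda>x. c * f x) = sqrt (c\<^sup>2 * ((l2norm M f)\<^sup>2 + (l2norm M (weak_gradient \<Omega> f))\<^sup>2))"
    using l2norm_scaleR[of M c f]
    by (simp add: norm_H1_eq l2norm_scaleR power_mult_distrib distrib_left)
  then show ?thesis by (simp add: norm_H1_eq real_sqrt_mult)
qed

text \<open>Rescale \<open>f\<close> to the unit ball. \<open>norm_H1_dual\<close> is a supremum of
  reals and bounds its members only if they are bounded above; the constant \<open>C\<close> ensures
  this, and it also settles norm zero, where rescaling is impossible.\<close>

lemma norm_H1_dual_bound:
  assumes hom: "\<And>f c. f \<in> H1 \<Omega> \<Longrightarrow> Q (\<lambda>x. c * f x) = c * Q f"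
    and bd: "\<And>f. f \<in> H1 \<Omega> \<Longrightarrow> \<bar>Q f\<bar> \<le> C * norm_H1 \<Omega> f" and f: "f \<in> H1 \<Omega>"
  shows "\<bar>Q f\<bar> \<le> norm_H1_dual \<Omega> Q * norm_H1 \<Omega> f"
proof (cases "norm_H1 \<Omega> f = 0")
  case True
  then show ?thesis using bd[OF f] by simp
next
  case False
  let ?n = "norm_H1 \<Omega> f" and ?B = "{f \<in> H1 \<Omega>. norm_H1 \<Omega> f \<le> 1}"
  have n: "0 < ?n" using False norm_H1_nonneg[of f] by simp
  let ?g = "\<lambda>x. (1 / ?n) * f x"
  have "norm_H1 \<Omega> ?g = 1" unfolding norm_H1_scale[OF f] using n by simp
  then have g: "?g \<in> ?B" using H1_scale[OF f, of "1 / ?n"] by simp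
  have "bdd_above ((\<lambda>f. \<bar>Q f\<bar>) ` ?B)"
  proof (rule bdd_aboveI2)
    fix h assume h: "h \<in> ?B"
    have "\<bar>Q h\<bar> \<le> C * norm_H1 \<Omega> h" using h by (intro bd) simp
    also have "\<dots> \<le> \<bar>C\<bar> * norm_H1 \<Omega> h" by (intro mult_right_mono norm_H1_nonneg) simp
    also have "\<dots> \<le> \<bar>C\<bar> * 1" using h by (intro mult_left_mono) auto
    finally show "\<bar>Q h\<bar> \<le> \<bar>C\<bar>" by simp
  qed
  then have "\<bar>Q ?g\<bar> \<le> norm_H1_dual \<Omega> Q" unfolding norm_H1_dual_def by (rule cSUP_upper[OF g])
  then have "\<bar>1 / ?n * Q f\<bar> \<le> norm_H1_dual \<Omega> Q" unfolding hom[OF f] .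
  then show ?thesis using n by (simp add: abs_mult field_simps)
qed

lemma L2_embed_eq: "L2_embed \<Omega> f w = l2inner M f w"
  by (simp add: L2_embed_def l2inner_def)

text \<open>For fixed \<open>s\<close> the difference quotient minus \<open>l\<close> is a bounded
  homogeneous functional, so its dual norm controls it. The same factor serves all \<open>w\<close>,
  so \<open>w\<close> may later depend on \<open>s\<close>.\<close>

lemma time_derivative_bound:
  assumes der: "has_time_derivative \<Omega> f l t S" and fs: "sq_integrable M (f s)" and ft: "sq_integrable M (f t)"
    and w: "w \<in> H1 \<Omega>"
  shows "\<bar>l2inner M (\<lambda>x. f s x - f t x) w / (s - t) - l w\<bar> \<le>
    \<bar>norm_H1_dual \<Omega> (\<lambda>w. (L2_embed \<Omega> (f s) w - L2_embed \<Omega> (f t) w) / (s - t) - l w)\<bar>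
      * (l2norm M w + l2norm M (weak_gradient \<Omega> w))"
proof -
  let ?Q = "\<lambda>w. (L2_embed \<Omega> (f s) w - L2_embed \<Omega> (f t) w) / (s - t) - l w"
  have "l \<in> H1_dual \<Omega>" using der by (simp add: has_time_derivative_def)
  then obtain C where l: "\<And>f c. f \<in> H1 \<Omega> \<Longrightarrow> l (\<lambda>x. c * f x) = c * l f"
    "\<And>f. f \<in> H1 \<Omega> \<Longrightarrow> \<bar>l f\<bar> \<le> C * norm_H1 \<Omega> f"
    unfolding H1_dual_def by blast
  let ?d = "\<lambda>x. f s x - f t x"
  have d: "sq_integrable M ?d" by (intro sq_integrable_diff fs ft)
  have Q: "?Q w = l2inner M ?d w / (s - t) - l w" if "w \<in> H1 \<Omega>" for w
    using H1_sq[OF that] by (simp add: L2_embed_eq l2inner_diff_left fs ft)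
  have "\<bar>?Q w\<bar> \<le> norm_H1_dual \<Omega> ?Q * norm_H1 \<Omega> w"
  proof (rule norm_H1_dual_bound[OF _ _ w])
    fix w :: "real^2 \<Rightarrow> real" and c assume w: "w \<in> H1 \<Omega>"
    have "l2inner M h (\<lambda>x. c * w x) = c * l2inner M h w" for h
      using l2inner_scaleR_left[of M c w h] by (simp add: l2inner_commute)
    then show "?Q (\<lambda>x. c * w x) = c * ?Q w"
      by (simp add: L2_embed_eq l(1)[OF w] algebra_simps diff_divide_distrib)
  next
    fix w assume w: "w \<in> H1 \<Omega>"
    have "\<bar>l2inner M ?d w / (s - t)\<bar> \<le> l2norm M ?d * l2norm M w / \<bar>s - t\<bar>"
      using l2_Cauchy_Schwarz[OF d H1_sq[OF w]] by (simp add: abs_divide divide_right_mono)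
    also have "\<dots> \<le> l2norm M ?d * norm_H1 \<Omega> w / \<bar>s - t\<bar>"
      by (intro divide_right_mono mult_left_mono l2norm_le_norm_H1) auto
    \<comment> \<open>This constant may blow up as \<open>s\<close> tends to \<open>t\<close>, which
      is harmless: it only certifies that the supremum is finite at this \<open>s\<close>.\<close>
    finally show "\<bar>?Q w\<bar> \<le> (l2norm M ?d / \<bar>s - t\<bar> + C) * norm_H1 \<Omega> w"
      unfolding Q[OF w] using l(2)[OF w] abs_triangle_ineq4[of "l2inner M ?d w / (s - t)" "l w"]
      by (simp only: distrib_right times_divide_eq_left)
  qed
  also have "\<dots> \<le> \<bar>norm_H1_dual \<Omega> ?Q\<bar> * (l2norm M w + l2norm M (weak_gradient \<Omega> w))"
    by (intro mult_mono norm_H1_le norm_H1_nonneg) auto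
  finally show ?thesis unfolding Q[OF w] .
qed

end

section \<open>The energy along a weak solution\<close>

locale weak_solution_curve = cross_diffusion \<Omega> D L K \<alpha> for \<Omega> D L K \<alpha> +
  fixes u0 :: "real^2 \<Rightarrow> real^2" and u :: "real \<Rightarrow> real^2 \<Rightarrow> real^2"
  assumes u0_X1: "u0 \<in> X1 \<Omega>" and sol: "\<And>T. T > 0 \<Longrightarrow> weak_solution \<Omega> D u0 T u"
begin

lemma u_sq: "0 \<le> t \<Longrightarrow> sq_integrable M (u t)"
  using sol[of "t + 1"] by (auto simp: weak_solution_def C_X0_def X0_iff)

lemma u_X1: "0 < t \<Longrightarrow> u t \<in> X1 \<Omega>"
  using sol[of t] by (auto simp: weak_solution_def)

lemma u_initial: "AE x in M. u 0 x = u0 x"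
  using sol[of 1] by (auto simp: weak_solution_def)

lemma at_within_up_to: "0 \<le> t \<Longrightarrow> at t within {0..t + 1} = at t within {0..}" for t :: real
  by (rule at_within_nhd[where S="{..<t + 1}"]) auto

lemma u_continuous:
  assumes "0 \<le> t" shows "((\<lambda>s. l2norm M (\<lambda>x. u s x - u t x)) \<longlongrightarrow> 0) (at t within {0..})"
proof -
  have "u \<in> C_X0 \<Omega> (t + 1)" using sol[of "t + 1"] assms by (simp add: weak_solution_def)
  then have "((\<lambda>s. norm_X0 \<Omega> (\<lambda>x. u s x - u t x)) \<longlongrightarrow> 0) (at t within {0..t + 1})"
    using assms by (auto simp: C_X0_def)
  then have "((\<lambda>s. norm_X0 \<Omega> (\<lambda>x. u s x - u t x)) \<longlongrightarrow> 0) (at t within {0..})"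
    using assms by (simp add: at_within_up_to)
  then show ?thesis
    by (rule tendsto_cong[THEN iffD1, rotated])
      (auto simp: eventually_at_filter norm_X0_eq u_sq assms sq_integrable_diff)
qed

text \<open>\<open>N\<close> adds the dual-norm errors of the two components and is free of
  \<open>w\<close>, which allows testing with the increment of the solution itself. The equation at
  time \<open>t\<close> identifies the sum of the two derivatives with minus the form.\<close>

lemma difference_quotient:
  assumes "0 < t"
  obtains N where "(N \<longlongrightarrow> 0) (at t)" "\<And>s. 0 \<le> N s"
    "\<And>s w. 0 \<le> s \<Longrightarrow> w \<in> X1 \<Omega> \<Longrightarrow>
      \<bar>l2inner M (\<lambda>x. u s x - u t x) w / (s - t) + bform (u t) (u t) w\<bar> \<le> N s * (l2norm M w + l2norm M (J w))"
proof -
  \<comment> \<open>On \<open>{0..t + 1}\<close> the time \<open>t\<close> is interior, so the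
    derivative in the dual is two-sided.\<close>
  have "weak_solution \<Omega> D u0 (t + 1) u" "t \<in> {0<..t + 1}" using sol[of "t + 1"] assms by auto
  then obtain l1 l2 where l: "has_time_derivative \<Omega> (\<lambda>s x. u s x $ 1) l1 t {0..t + 1}"
    "has_time_derivative \<Omega> (\<lambda>s x. u s x $ 2) l2 t {0..t + 1}"
    and eq: "\<And>w. w \<in> X1 \<Omega> \<Longrightarrow> l1 (\<lambda>x. w x $ 1) + l2 (\<lambda>x. w x $ 2) + bform (u t) (u t) w = 0"
    unfolding weak_solution_def bform_eq_trace by blast
  define Q where "Q i l s w = (L2_embed \<Omega> (\<lambda>x. u s x $ i) w - L2_embed \<Omega> (\<lambda>x. u t x $ i) w) / (s - t) - l w"
    for i :: 2 and l :: "(real^2 \<Rightarrow> real) \<Rightarrow> real" and s :: real and w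
  define N where "N s = \<bar>norm_H1_dual \<Omega> (Q 1 l1 s)\<bar> + \<bar>norm_H1_dual \<Omega> (Q 2 l2 s)\<bar>" for s
  show thesis
  proof
    have at: "at t within {0..t + 1} = at t"
      using assms by (intro at_within_interior) (simp add: interior_atLeastAtMost_real)
    have "((\<lambda>s. norm_H1_dual \<Omega> (Q 1 l1 s)) \<longlongrightarrow> 0) (at t)" "((\<lambda>s. norm_H1_dual \<Omega> (Q 2 l2 s)) \<longlongrightarrow> 0) (at t)"
      using l unfolding has_time_derivative_def at Q_def by auto
    then have "(N \<longlongrightarrow> \<bar>0\<bar> + \<bar>0\<bar>) (at t)" unfolding N_def by (intro tendsto_add tendsto_rabs)
    then show "(N \<longlongrightarrow> 0) (at t)" by simp
    show "0 \<le> N s" for s by (simp add: N_def)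
    fix s :: real and w assume s: "0 \<le> s" and w: "w \<in> X1 \<Omega>"
    let ?d = "\<lambda>x. u s x - u t x"
    have us: "sq_integrable M (u s)" and ut: "sq_integrable M (u t)" using u_sq s assms by auto
    have wi: "(\<lambda>x. w x $ i) \<in> H1 \<Omega>" for i using w by (simp add: X1_def)
    have comp: "\<bar>l2inner M (\<lambda>x. ?d x $ i) (\<lambda>x. w x $ i) / (s - t) - l (\<lambda>x. w x $ i)\<bar>
        \<le> \<bar>norm_H1_dual \<Omega> (Q i l s)\<bar> * (l2norm M w + l2norm M (J w))"
      if "has_time_derivative \<Omega> (\<lambda>s x. u s x $ i) l t {0..t + 1}" for i l
    proof -
      have sqi: "sq_integrable M (\<lambda>x. u s x $ i)" "sq_integrable M (\<lambda>x. u t x $ i)"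
        using us ut by (auto simp: sq_integrable_vec_iff)
      have "l2norm M (\<lambda>x. w x $ i) \<le> l2norm M w" by (rule l2norm_nth_le[OF X1_sq[OF w]])
      moreover have "l2norm M (weak_gradient \<Omega> (\<lambda>x. w x $ i)) \<le> l2norm M (J w)"
        using l2norm_nth_le[OF weak_jacobian_sq[OF w], of i] by (simp add: weak_jacobian_def)
      ultimately have "\<bar>norm_H1_dual \<Omega> (Q i l s)\<bar> * (l2norm M (\<lambda>x. w x $ i) + l2norm M (weak_gradient \<Omega> (\<lambda>x. w x $ i)))
          \<le> \<bar>norm_H1_dual \<Omega> (Q i l s)\<bar> * (l2norm M w + l2norm M (J w))"
        by (intro mult_left_mono add_mono) auto
      with time_derivative_bound[where f="\<lambda>s x. u s x $ i", OF that sqi wi[of i]]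
      show ?thesis unfolding Q_def[symmetric] vector_minus_component by (rule order_trans)
    qed
    have "l2inner M ?d w = l2inner M (\<lambda>x. ?d x $ 1) (\<lambda>x. w x $ 1) + l2inner M (\<lambda>x. ?d x $ 2) (\<lambda>x. w x $ 2)"
      by (subst l2inner_vec[OF sq_integrable_diff[OF us ut] X1_sq[OF w]]) (simp add: sum_2)
    then have "l2inner M ?d w / (s - t) + bform (u t) (u t) w
      = (l2inner M (\<lambda>x. ?d x $ 1) (\<lambda>x. w x $ 1) / (s - t) - l1 (\<lambda>x. w x $ 1))
      + (l2inner M (\<lambda>x. ?d x $ 2) (\<lambda>x. w x $ 2) / (s - t) - l2 (\<lambda>x. w x $ 2))"
      using eq[OF w] by (simp add: add_divide_distrib)
    also have "\<bar>\<dots>\<bar> \<le> N s * (l2norm M w + l2norm M (J w))"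
      unfolding N_def distrib_right[of "\<bar>_\<bar>" "\<bar>_\<bar>"]
      by (rule order_trans[OF abs_triangle_ineq add_mono[OF comp[OF l(1)] comp[OF l(2)]]])
    finally show "\<bar>l2inner M ?d w / (s - t) + bform (u t) (u t) w\<bar> \<le> N s * (l2norm M w + l2norm M (J w))" .
  qed
qed

lemma pairing_derivative:
  assumes "0 < t" "w \<in> X1 \<Omega>"
  shows "((\<lambda>s. l2inner M (\<lambda>x. u s x - u t x) w / (s - t)) \<longlongrightarrow> - bform (u t) (u t) w) (at t)"
proof -
  obtain N where N: "(N \<longlongrightarrow> 0) (at t)" "\<And>s w. 0 \<le> s \<Longrightarrow> w \<in> X1 \<Omega> \<Longrightarrow>
      \<bar>l2inner M (\<lambda>x. u s x - u t x) w / (s - t) + bform (u t) (u t) w\<bar> \<le> N s * (l2norm M w + l2norm M (J w))"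
    by (rule difference_quotient[OF assms(1)]) blast
  have "((\<lambda>s. N s * (l2norm M w + l2norm M (J w))) \<longlongrightarrow> 0 * (l2norm M w + l2norm M (J w))) (at t)"
    by (intro tendsto_intros N(1))
  then have "((\<lambda>s. N s * (l2norm M w + l2norm M (J w))) \<longlongrightarrow> 0) (at t)" by simp
  then have "((\<lambda>s. l2inner M (\<lambda>x. u s x - u t x) w / (s - t) + bform (u t) (u t) w) \<longlongrightarrow> 0) (at t)"
  proof (rule Lim_null_comparison[rotated])
    have "\<forall>\<^sub>F s in at t. 0 < s"
      using assms(1) by (intro order_tendstoD(1)[OF tendsto_ident_at])
    then show "\<forall>\<^sub>F s in at t. norm (l2inner M (\<lambda>x. u s x - u t x) w / (s - t) + bform (u t) (u t) w)
        \<le> N s * (l2norm M w + l2norm M (J w))"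
      by eventually_elim (use N(2)[OF _ assms(2)] in auto)
  qed
  from tendsto_diff[OF this tendsto_const[of "bform (u t) (u t) w"]] show ?thesis by simp
qed

text \<open>Up to a constant, \<open>y = z\<close> gives the energy. With \<open>y = 0\<close> it is
  half the squared distance to \<open>z\<close>, and \<open>y = - z\<close> serves for lower
  bounds.\<close>

definition shifted_energy :: "(real^2 \<Rightarrow> real^2) \<Rightarrow> (real^2 \<Rightarrow> real^2) \<Rightarrow> real \<Rightarrow> real" where
  "shifted_energy z y s = (l2norm M (\<lambda>x. u s x - z x))\<^sup>2 / 2 + l2inner M (\<lambda>x. u s x - z x) y"

text \<open>Exact expansion of a quadratic functional at \<open>u t\<close>; its gradient there is
  \<open>u t - z + y\<close>, which becomes the test function.\<close>

lemma shifted_energy_diff: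
  assumes "0 \<le> s" "0 \<le> t" and z: "sq_integrable M z" and y: "sq_integrable M y"
  shows "shifted_energy z y s - shifted_energy z y t = l2inner M (\<lambda>x. u s x - u t x) (\<lambda>x. u t x - z x + y x)
    + (l2norm M (\<lambda>x. u s x - u t x))\<^sup>2 / 2"
proof -
  let ?A = "\<lambda>x. u t x - z x" and ?d = "\<lambda>x. u s x - u t x"
  have A: "sq_integrable M ?A" and d: "sq_integrable M ?d" by (intro sq_integrable_diff u_sq assms)+
  have "shifted_energy z y s = (l2norm M (\<lambda>x. ?A x + ?d x))\<^sup>2 / 2 + l2inner M (\<lambda>x. ?A x + ?d x) y"
    by (simp add: shifted_energy_def)
  also have "\<dots> = shifted_energy z y t + (l2inner M ?d ?A + l2inner M ?d y) + (l2norm M ?d)\<^sup>2 / 2"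
    unfolding l2norm_sq_add[OF A d] l2inner_add_left[OF A d y] shifted_energy_def l2inner_commute[of M ?A ?d]
    by (simp add: field_simps)
  also have "l2inner M ?d ?A + l2inner M ?d y = l2inner M ?d (\<lambda>x. u t x - z x + y x)"
    by (rule l2inner_add_right[OF A y d, symmetric])
  finally show ?thesis by simp
qed

lemma shifted_energy_continuous:
  assumes "0 \<le> a" and z: "sq_integrable M z" and y: "sq_integrable M y"
  shows "continuous_on {a..b} (shifted_energy z y)"
  unfolding continuous_on_def
proof
  fix t assume "t \<in> {a..b}"
  then have t: "0 \<le> t" using assms by auto
  let ?d = "\<lambda>s. l2norm M (\<lambda>x. u s x - u t x)" and ?w = "\<lambda>x. u t x - z x + y x"
  have w: "sq_integrable M ?w" by (intro sq_integrable_add sq_integrable_diff u_sq t z y)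
  have "((\<lambda>s. ?d s * l2norm M ?w + (?d s)\<^sup>2 / 2) \<longlongrightarrow> 0 * l2norm M ?w + 0\<^sup>2 / 2) (at t within {0..})"
    by (intro tendsto_intros u_continuous t) simp
  then have "((\<lambda>s. ?d s * l2norm M ?w + (?d s)\<^sup>2 / 2) \<longlongrightarrow> 0) (at t within {0..})" by simp
  then have "((\<lambda>s. shifted_energy z y s - shifted_energy z y t) \<longlongrightarrow> 0) (at t within {0..})"
  proof (rule Lim_null_comparison[rotated])
    have "norm (shifted_energy z y s - shifted_energy z y t) \<le> ?d s * l2norm M ?w + (?d s)\<^sup>2 / 2" if "0 \<le> s" for s
    proof -
      have "\<bar>l2inner M (\<lambda>x. u s x - u t x) ?w\<bar> \<le> ?d s * l2norm M ?w"
        by (intro l2_Cauchy_Schwarz sq_integrable_diff u_sq t that w)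
      then show ?thesis
        unfolding shifted_energy_diff[OF that t z y] real_norm_def
        using abs_triangle_ineq[of "l2inner M (\<lambda>x. u s x - u t x) ?w" "(?d s)\<^sup>2 / 2"] by simp
    qed
    then show "\<forall>\<^sub>F s in at t within {0..}. norm (shifted_energy z y s - shifted_energy z y t) \<le> ?d s * l2norm M ?w + (?d s)\<^sup>2 / 2"
      by (auto simp: eventually_at_filter)
  qed
  then have "(shifted_energy z y \<longlongrightarrow> shifted_energy z y t) (at t within {0..})" using LIM_zero_iff by blast
  then show "(shifted_energy z y \<longlongrightarrow> shifted_energy z y t) (at t within {a..b})"
    by (rule tendsto_within_subset) (use assms in auto)
qed

lemma shifted_energy_left_dini:
  assumes "0 < t" and z: "z \<in> X1 \<Omega>" and y: "y \<in> X1 \<Omega>"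
  shows "left_dini_le (shifted_energy z y) t (- bform (u t) (u t) (\<lambda>x. u t x - z x + y x))"
  unfolding left_dini_le_def
proof (intro allI impI)
  fix e :: real assume "0 < e"
  let ?w = "\<lambda>x. u t x - z x + y x"
  have w: "?w \<in> X1 \<Omega>" by (intro X1_add X1_diff u_X1 assms)
  have "((\<lambda>s. l2inner M (\<lambda>x. u s x - u t x) ?w / (s - t)) \<longlongrightarrow> - bform (u t) (u t) ?w) (at_left t)"
    using pairing_derivative[OF assms(1) w] by (rule tendsto_within_subset) simp
  then have "\<forall>\<^sub>F s in at_left t. l2inner M (\<lambda>x. u s x - u t x) ?w / (s - t) < - bform (u t) (u t) ?w + e"
    by (rule order_tendstoD(2)) (use \<open>0 < e\<close> in simp)
  moreover have "\<forall>\<^sub>F s in at_left t. 0 < s"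
    using assms(1) by (intro order_tendstoD(1)[OF tendsto_ident_at])
  moreover have "\<forall>\<^sub>F s in at_left t. s < t" by (auto simp: eventually_at_filter)
  ultimately show "\<forall>\<^sub>F s in at_left t. shifted_energy z y t - shifted_energy z y s \<le> (- bform (u t) (u t) ?w + e) * (t - s)"
  proof eventually_elim
    case (elim s)
    let ?p = "l2inner M (\<lambda>x. u s x - u t x) ?w"
    have "shifted_energy z y s - shifted_energy z y t = ?p + (l2norm M (\<lambda>x. u s x - u t x))\<^sup>2 / 2"
      by (intro shifted_energy_diff X1_sq z y) (use elim assms(1) in auto)
    then have "shifted_energy z y t - shifted_energy z y s \<le> - ?p"
      using zero_le_power2[of "l2norm M (\<lambda>x. u s x - u t x)"] by linarith
    also have "- ?p = ?p / (s - t) * (t - s)" using elim(3) by (simp add: field_simps)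
    also have "\<dots> \<le> (- bform (u t) (u t) ?w + e) * (t - s)"
      using elim by (intro mult_right_mono) auto
    finally show ?case .
  qed
qed

end

lemma (in bounded_domain) energy_eq: "energy \<Omega> f = (l2norm M f)\<^sup>2 / 2"
  by (simp add: energy_def l2norm_sq norm_vec_sq sum_2)

section \<open>One-sided derivatives of the energy\<close>

context weak_solution_curve begin

text \<open>Continuity into L2 turns closeness in time into closeness to \<open>z\<close>. The
  condition \<open>zt\<close> stands in for equality of \<open>u t0\<close> and \<open>z\<close>
  because at time 0 the function \<open>z\<close> is \<open>u0\<close>, which agrees with
  \<open>u 0\<close> only almost everywhere.\<close>

lemma bform_rate_bound_near:
  assumes t0: "0 \<le> t0" and z: "z \<in> X1 \<Omega>" and zt: "l2norm M (\<lambda>x. u t0 x - z x) = 0"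
    and y: "y \<in> X1 \<Omega>" and "0 < \<epsilon>"
  obtains r where "0 < r" "\<And>s. 0 < s \<Longrightarrow> \<bar>s - t0\<bar> < r \<Longrightarrow>
    - bform (u s) (u s) (\<lambda>x. u s x - z x + y x)
      \<le> - (\<alpha> / 2) * (l2norm M (J (\<lambda>x. u s x - z x)))\<^sup>2 - bform z z y + \<epsilon>"
proof -
  obtain \<eta> where \<eta>: "0 < \<eta>"
    "\<And>v. v \<in> X1 \<Omega> \<Longrightarrow> l2norm M (\<lambda>x. v x - z x) \<le> \<eta> \<Longrightarrow> - bform v v (\<lambda>x. v x - z x + y x)
      \<le> - (\<alpha> / 2) * (l2norm M (J (\<lambda>x. v x - z x)))\<^sup>2 - bform z z y + \<epsilon>"
    by (rule bform_rate_bound[OF y z \<open>0 < \<epsilon>\<close>]) blast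
  have "\<forall>\<^sub>F s in at t0 within {0..}. l2norm M (\<lambda>x. u s x - u t0 x) < \<eta>"
    using u_continuous[OF t0] \<eta>(1) by (rule order_tendstoD(2))
  then obtain r where r: "0 < r" "\<And>s. 0 \<le> s \<Longrightarrow> s \<noteq> t0 \<Longrightarrow> \<bar>s - t0\<bar> < r \<Longrightarrow> l2norm M (\<lambda>x. u s x - u t0 x) < \<eta>"
    unfolding eventually_at by (auto simp: dist_real_def)
  show thesis
  proof
    show "0 < r" by fact
    fix s assume s: "0 < s" "\<bar>s - t0\<bar> < r"
    have "l2norm M (\<lambda>x. u s x - z x) = l2norm M (\<lambda>x. (u s x - u t0 x) + (u t0 x - z x))" by simp
    also have "\<dots> \<le> l2norm M (\<lambda>x. u s x - u t0 x) + l2norm M (\<lambda>x. u t0 x - z x)"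
      by (intro l2norm_triangle sq_integrable_diff u_sq X1_sq z) (use s t0 in auto)
    also have "\<dots> \<le> \<eta>"
      \<comment> \<open>The choice of \<open>r\<close> leaves out \<open>s = t0\<close>, where the
        distance is zero.\<close>
      using r(2)[of s] s \<eta>(1) zt by (cases "s = t0") (auto simp: l2norm_def)
    finally show "- bform (u s) (u s) (\<lambda>x. u s x - z x + y x)
      \<le> - (\<alpha> / 2) * (l2norm M (J (\<lambda>x. u s x - z x)))\<^sup>2 - bform z z y + \<epsilon>"
      by (intro \<eta>(2) u_X1 s(1))
  qed
qed

lemma shifted_energy_at:
  assumes t0: "0 \<le> t0" and z: "z \<in> X1 \<Omega>" and zt: "l2norm M (\<lambda>x. u t0 x - z x) = 0" and y: "y \<in> X1 \<Omega>"
  shows "shifted_energy z y t0 = 0"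
  using l2_Cauchy_Schwarz[OF sq_integrable_diff[OF u_sq[OF t0] X1_sq[OF z]] X1_sq[OF y]]
  by (simp add: shifted_energy_def zt)

text \<open>Integrates the Dini bound forward from \<open>t0\<close>. It is used only at later
  times, and continuity covers the end point, so \<open>t0 = 0\<close> is included.\<close>

lemma shifted_energy_right_bound:
  assumes t0: "0 \<le> t0" and z: "z \<in> X1 \<Omega>" and zt: "l2norm M (\<lambda>x. u t0 x - z x) = 0"
    and y: "y \<in> X1 \<Omega>" and "0 < \<epsilon>"
  shows "\<forall>\<^sub>F s in at_right t0. shifted_energy z y s \<le> (- bform z z y + \<epsilon>) * (s - t0)"
proof -
  obtain r where r: "0 < r" "\<And>s. 0 < s \<Longrightarrow> \<bar>s - t0\<bar> < r \<Longrightarrow>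
    - bform (u s) (u s) (\<lambda>x. u s x - z x + y x)
      \<le> - (\<alpha> / 2) * (l2norm M (J (\<lambda>x. u s x - z x)))\<^sup>2 - bform z z y + \<epsilon>"
    by (rule bform_rate_bound_near[OF assms]) blast
  have "shifted_energy z y s \<le> (- bform z z y + \<epsilon>) * (s - t0)" if s: "t0 < s" "s < t0 + r" for s
  proof -
    have "shifted_energy z y s - shifted_energy z y t0 \<le> (- bform z z y + \<epsilon>) * (s - t0)"
    proof (rule left_dini_le_bound)
      show "continuous_on {t0..s} (shifted_energy z y)" by (intro shifted_energy_continuous t0 X1_sq z y)
      fix t assume t: "t0 < t" "t \<le> s"
      have rate: "- bform (u t) (u t) (\<lambda>x. u t x - z x + y x) \<le> - bform z z y + \<epsilon>"
      proof -
        have "0 \<le> (\<alpha> / 2) * (l2norm M (J (\<lambda>x. u t x - z x)))\<^sup>2" using \<alpha>_pos by simp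
        then show ?thesis using r(2)[of t] t t0 s by simp
      qed
      have "0 < t" using t t0 by simp
      from left_dini_le_mono[OF shifted_energy_left_dini[OF this z y] rate]
      show "left_dini_le (shifted_energy z y) t (- bform z z y + \<epsilon>)" .
    qed (use s in simp)
    then show ?thesis by (simp add: shifted_energy_at[OF t0 z zt y])
  qed
  then show ?thesis
    using eventually_at_right_real[of t0 "t0 + r"] r(1) by (auto elim!: eventually_mono)
qed

lemma energy_diff:
  assumes t0: "0 \<le> t0" and s: "0 \<le> s" and z: "z \<in> X1 \<Omega>" and zt: "l2norm M (\<lambda>x. u t0 x - z x) = 0"
  shows "energy \<Omega> (u s) - energy \<Omega> (u t0) = shifted_energy z z s"
proof -
  have zs: "sq_integrable M z" by (rule X1_sq[OF z])
  have e: "energy \<Omega> (u r) = shifted_energy z z r + (l2norm M z)\<^sup>2 / 2" if "0 \<le> r" for r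
  proof -
    have "(l2norm M (\<lambda>x. (u r x - z x) + z x))\<^sup>2 = 
      (l2norm M (\<lambda>x. u r x - z x))\<^sup>2 + 2 * l2inner M (\<lambda>x. u r x - z x) z + (l2norm M z)\<^sup>2"
      by (intro l2norm_sq_add sq_integrable_diff u_sq that zs)
    then show ?thesis by (simp add: energy_eq shifted_energy_def field_simps)
  qed
  show ?thesis using e[OF s] e[OF t0] shifted_energy_at[OF t0 z zt z] by simp
qed

text \<open>\<open>y = z\<close> yields the upper bound on the quotient. For the lower bound,
  \<open>y = - z\<close> gives a functional that exceeds minus the energy increment by the squared
  distance to \<open>z\<close>; discarding this square leaves the bound wanted.\<close>

lemma energy_right_derivative:
  assumes t0: "0 \<le> t0" and z: "z \<in> X1 \<Omega>" and zt: "l2norm M (\<lambda>x. u t0 x - z x) = 0"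
  shows "((\<lambda>s. (energy \<Omega> (u s) - energy \<Omega> (u t0)) / (s - t0)) \<longlongrightarrow> - bform z z z) (at_right t0)"
proof (rule tendstoI)
  fix e :: real assume "0 < e"
  then have e: "0 < e / 2" by simp
  have mz: "(\<lambda>x. - z x) \<in> X1 \<Omega>" and ae: "AE x in M. J (\<lambda>x. - z x) x = - J z x"
    using X1_lincomb[OF z z, of "-1" 0] by simp_all
  have "bform z z (\<lambda>x. - z x) = l2inner M (\<lambda>x. - J z x) (\<lambda>x. D (z x) ** J z x)"
    unfolding bform_def
    by (rule l2inner_cong_AE)
      (use ae mz z in \<open>auto intro!: borel_measurable_uminus sq_integrable_borel[OF weak_jacobian_sq]
        sq_integrable_borel[OF A_mult_sq] sq_integrable_borel[OF X1_sq] weak_jacobian_sq\<close>)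
  then have b: "bform z z (\<lambda>x. - z x) = - bform z z z" by (simp add: l2inner_minus_left bform_def)
  have "\<forall>\<^sub>F s in at_right t0. t0 < s" by (auto simp: eventually_at_filter)
  with shifted_energy_right_bound[OF t0 z zt z e] shifted_energy_right_bound[OF t0 z zt mz e]
  show "\<forall>\<^sub>F s in at_right t0. dist ((energy \<Omega> (u s) - energy \<Omega> (u t0)) / (s - t0)) (- bform z z z) < e"
  proof eventually_elim
    case (elim s)
    have s: "0 \<le> s" "0 < s - t0" using elim t0 by auto
    let ?p = "shifted_energy z z s" and ?b = "bform z z z"
    have "shifted_energy z (\<lambda>x. - z x) s = (l2norm M (\<lambda>x. u s x - z x))\<^sup>2 - ?p"
      by (simp add: shifted_energy_def l2inner_minus_right field_simps)
    then have "- ?p \<le> shifted_energy z (\<lambda>x. - z x) s" by simp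
    then have "- ?p \<le> (?b + e / 2) * (s - t0)" using elim(2) by (simp add: b)
    moreover have "?p \<le> (- ?b + e / 2) * (s - t0)" by (rule elim(1))
    moreover have "- ((?b + e / 2) * (s - t0)) = (- ?b - e / 2) * (s - t0)" by (simp add: algebra_simps)
    ultimately have "?p / (s - t0) \<le> - ?b + e / 2" "- ?b - e / 2 \<le> ?p / (s - t0)"
      by (auto simp only: pos_divide_le_eq[OF s(2)] pos_le_divide_eq[OF s(2)])
    then show ?case
      unfolding energy_diff[OF t0 s(1) z zt] dist_real_def using \<open>0 < e\<close> by (simp add: abs_less_iff)
  qed
qed

text \<open>A Dini bound limits growth forward in time only, so integrating it up to
  \<open>t0\<close> gives no upper bound before \<open>t0\<close>. Instead, the dual difference
  quotient at \<open>t0\<close>, tested with the increment itself, bounds half the squared increment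
  over \<open>t0 - s\<close> by the Jacobian norm; the coercive term then acts as a damping that
  forces decay at the required rate.\<close>

lemma sq_increment_small_left:
  assumes t0: "0 < t0" and "0 < e"
  shows "\<forall>\<^sub>F s in at_left t0. (l2norm M (\<lambda>x. u s x - u t0 x))\<^sup>2 / 2 \<le> e * (t0 - s)"
proof -
  define z where "z = u t0"
  have z: "z \<in> X1 \<Omega>" unfolding z_def by (rule u_X1[OF t0])
  have zt: "l2norm M (\<lambda>x. u t0 x - z x) = 0" by (simp add: z_def l2norm_def)
  \<comment> \<open>The cap 1 gives \<open>\<epsilon>^2 \<le> \<epsilon>\<close>, hence
    \<open>c \<le> \<epsilon> * (3 + 2 / \<alpha>)\<close>; the other bound makes this at most
    \<open>e / 2\<close>.\<close>
  define \<epsilon> where "\<epsilon> = min 1 (e / (2 * (3 + 2 / \<alpha>)))"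
  have \<epsilon>: "0 < \<epsilon>" using \<open>0 < e\<close> \<alpha>_pos by (simp add: \<epsilon>_def add_pos_pos)
  \<comment> \<open>One \<open>\<epsilon>\<close> comes from the rate bound and two from the
    quotient tested with the increment; \<open>2 * \<epsilon>^2 / \<alpha>\<close> is the Young
    remainder.\<close>
  define c where "c = 3 * \<epsilon> + 2 * \<epsilon>\<^sup>2 / \<alpha>"
  have c: "0 \<le> c" "c \<le> e / 2"
  proof -
    show "0 \<le> c" using \<epsilon> \<alpha>_pos by (simp add: c_def)
    have "\<epsilon> * \<epsilon> \<le> 1 * \<epsilon>" using \<epsilon> by (intro mult_right_mono) (auto simp: \<epsilon>_def)
    then have "c \<le> 3 * \<epsilon> + 2 * \<epsilon> / \<alpha>"
      using \<alpha>_pos by (auto simp: c_def power2_eq_square intro!: divide_right_mono)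
    also have "\<dots> = \<epsilon> * (3 + 2 / \<alpha>)" by (simp add: algebra_simps)
    also have "\<dots> \<le> e / (2 * (3 + 2 / \<alpha>)) * (3 + 2 / \<alpha>)"
      using \<alpha>_pos by (intro mult_right_mono) (auto simp: \<epsilon>_def)
    also have "\<dots> = e / 2"
    proof -
      have k: "e / (2 * k) * k = e / 2" if "0 < k" for k :: real using that by simp
      show ?thesis by (rule k) (use \<alpha>_pos in \<open>simp add: add_pos_pos\<close>)
    qed
    finally show "c \<le> e / 2" .
  qed
  have zero: "(\<lambda>x. 0) \<in> X1 \<Omega>" by (rule X1_const)
  let ?\<phi> = "shifted_energy z (\<lambda>x. 0)"
  have \<phi>: "?\<phi> s = (l2norm M (\<lambda>x. u s x - z x))\<^sup>2 / 2" for s by (simp add: shifted_energy_def l2inner_def)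
  obtain r where r: "0 < r" "\<And>s. 0 < s \<Longrightarrow> \<bar>s - t0\<bar> < r \<Longrightarrow>
    - bform (u s) (u s) (\<lambda>x. u s x - z x + 0)
      \<le> - (\<alpha> / 2) * (l2norm M (J (\<lambda>x. u s x - z x)))\<^sup>2 - bform z z (\<lambda>x. 0) + \<epsilon>"
    by (rule bform_rate_bound_near[OF less_imp_le[OF t0] z zt zero \<epsilon>]) blast
  have b0: "bform z z (\<lambda>x. 0) = 0" by (intro bform_const sq_integrable_borel X1_sq z)
  obtain C where C: "0 \<le> C" "\<And>w. w \<in> X1 \<Omega> \<Longrightarrow> \<bar>bform z z w\<bar> \<le> \<epsilon> * l2norm M (J w) + C * l2norm M w"
    by (rule bform_fixed_small[OF z \<epsilon>]) blast
  obtain N where N: "(N \<longlongrightarrow> 0) (at t0)" "\<And>s. 0 \<le> N s" "\<And>s w. 0 \<le> s \<Longrightarrow> w \<in> X1 \<Omega> \<Longrightarrow>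
      \<bar>l2inner M (\<lambda>x. u s x - z x) w / (s - t0) + bform z z w\<bar> \<le> N s * (l2norm M w + l2norm M (J w))"
    unfolding z_def by (rule difference_quotient[OF t0]) blast
  have near: "\<forall>\<^sub>F s in at_left t0. left_dini_le ?\<phi> s (c - 2 * ?\<phi> s / (t0 - s)) \<and> 0 < s \<and> s < t0"
  proof -
    have lim: "((\<lambda>s. l2norm M (\<lambda>x. u s x - z x)) \<longlongrightarrow> 0) (at_left t0)"
    proof -
      have "at t0 within {0..} = at t0" using t0 by (intro at_within_interior) simp
      then show ?thesis
        using u_continuous[of t0] t0 unfolding z_def by (auto intro: tendsto_within_subset[where S=UNIV])
    qed
    have "(N \<longlongrightarrow> 0) (at_left t0)" using N(1) by (rule tendsto_within_subset) simp
    then have "\<forall>\<^sub>F s in at_left t0. N s < \<epsilon>" using \<epsilon> by (rule order_tendstoD(2))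
    moreover have "\<forall>\<^sub>F s in at_left t0. l2norm M (\<lambda>x. u s x - z x) < min 1 (\<epsilon> / (C + 1))"
      using lim by (rule order_tendstoD(2)) (use \<epsilon> C(1) in simp)
    moreover have "\<forall>\<^sub>F s in at_left t0. 0 < s" "\<forall>\<^sub>F s in at_left t0. t0 - r < s"
      using t0 r(1) by (auto intro!: order_tendstoD(1)[OF tendsto_ident_at])
    moreover have "\<forall>\<^sub>F s in at_left t0. s < t0" by (auto simp: eventually_at_filter)
    ultimately show ?thesis
    proof eventually_elim
      case (elim s)
      let ?w = "\<lambda>x. u s x - z x"
      define d where "d = l2norm M ?w"
      define G where "G = l2norm M (J ?w)"
      have G: "0 \<le> G" and d: "0 \<le> d" "d \<le> 1" using elim(2) by (auto simp: d_def G_def)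
      have h: "0 < t0 - s" using elim by simp
      have w: "?w \<in> X1 \<Omega>" by (intro X1_diff u_X1 z elim)
      have "d \<le> \<epsilon> / (C + 1)" using elim(2) by (simp add: d_def)
      then have "(C + 1) * d \<le> \<epsilon>" using C(1) by (simp add: field_simps)
      then have Cd: "C * d \<le> \<epsilon>" using d(1) by (simp add: algebra_simps)
      have "N s * (d + G) \<le> \<epsilon> * (1 + G)"
        using elim(1) d G \<epsilon> by (intro mult_mono) auto
      then have "\<bar>l2inner M ?w ?w / (s - t0) + bform z z ?w\<bar> \<le> \<epsilon> * (1 + G)"
        using N(3)[OF _ w, of s] elim(3) by (simp add: d_def G_def)
      moreover have "\<bar>bform z z ?w\<bar> \<le> \<epsilon> * (1 + G)"
        using C(2)[OF w] Cd by (simp add: d_def G_def algebra_simps)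
      ultimately have "- (l2inner M ?w ?w / (s - t0)) \<le> 2 * (\<epsilon> * (1 + G))" by linarith
      \<comment> \<open>The test function is the increment itself, so the pairing is
        \<open>2 * ?\<phi> s\<close>; the sign changes because \<open>s < t0\<close>.\<close>
      moreover have "- (l2inner M ?w ?w / (s - t0)) = 2 * ?\<phi> s / (t0 - s)"
        using h unfolding \<phi> l2norm_sq_inner by (simp add: field_simps)
      ultimately have quot: "2 * ?\<phi> s / (t0 - s) \<le> 2 * \<epsilon> + 2 * \<epsilon> * G" by (simp add: algebra_simps)
      \<comment> \<open>Young's inequality charges the term linear in \<open>G\<close> to the
        coercive term of the rate bound, which exchanges control of the Jacobian for damping of
        \<open>?\<phi>\<close>.\<close>
      have "2 * \<epsilon> * G \<le> (\<alpha> / 2) * G\<^sup>2 + 2 * \<epsilon>\<^sup>2 / \<alpha>"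
      proof -
        have "0 \<le> (\<alpha> * G - 2 * \<epsilon>)\<^sup>2 / (2 * \<alpha>)" using \<alpha>_pos by simp
        also have "\<dots> = (\<alpha> / 2) * G\<^sup>2 - 2 * \<epsilon> * G + 2 * \<epsilon>\<^sup>2 / \<alpha>"
          using \<alpha>_pos by (simp add: power2_eq_square field_simps)
        finally show ?thesis by simp
      qed
      moreover have "- bform (u s) (u s) (\<lambda>x. u s x - z x + 0) \<le> - (\<alpha> / 2) * G\<^sup>2 + \<epsilon>"
        using r(2)[of s] elim b0 unfolding G_def by simp
      ultimately have "- bform (u s) (u s) (\<lambda>x. u s x - z x + 0) \<le> c - 2 * ?\<phi> s / (t0 - s)"
        using quot unfolding c_def by linarith
      then show ?case
        using left_dini_le_mono[OF shifted_energy_left_dini[OF elim(3) z zero]] elim by blast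
    qed
  qed
  then obtain a where a: "a < t0" "\<And>s. a < s \<Longrightarrow> s < t0 \<Longrightarrow> left_dini_le ?\<phi> s (c - 2 * ?\<phi> s / (t0 - s)) \<and> 0 < s"
    unfolding eventually_at_left_field by blast
  \<comment> \<open>Any base point between \<open>a\<close> and \<open>t0\<close> serves; its value
    enters only through the finite constant \<open>A\<close>.\<close>
  define b where "b = (a + t0) / 2"
  have b: "a < b" "b < t0" using a(1) by (auto simp: b_def)
  have b0: "0 < b" using a(2)[OF b] by simp
  define A where "A = ?\<phi> b / (t0 - b)\<^sup>2"
  have A: "0 \<le> A" by (simp add: A_def \<phi>)
  have main: "?\<phi> s \<le> (c + A * (t0 - s)) * (t0 - s)" if s: "b \<le> s" "s < t0" for s
  proof -
    have h: "0 < t0 - s" using s by simp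
    have "?\<phi> s / (t0 - s)\<^sup>2 - c / (t0 - s) \<le> ?\<phi> b / (t0 - b)\<^sup>2 - c / (t0 - b)"
    proof (rule left_dini_decay[OF s])
      show "continuous_on {b..s} ?\<phi>" using b0 by (intro shifted_energy_continuous X1_sq z zero) simp
      show "left_dini_le ?\<phi> t (c - 2 * ?\<phi> t / (t0 - t))" if "b < t" "t \<le> s" for t
        using a(2)[of t] that b s by auto
    qed
    also have "\<dots> \<le> A" using c(1) b by (simp add: A_def)
    finally have "?\<phi> s / (t0 - s)\<^sup>2 \<le> c / (t0 - s) + A" by simp
    moreover have "x \<le> (c + A * k) * k" if "x / k\<^sup>2 \<le> c / k + A" "0 < k" for x k
      using that by (simp add: field_simps power2_eq_square)
    ultimately show ?thesis using h by blast
  qed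
  \<comment> \<open>Half of \<open>e\<close> covers \<open>c\<close>, and
    \<open>A * (t0 - s)\<close> tends to 0.\<close>
  have "((\<lambda>s. c + A * (t0 - s)) \<longlongrightarrow> c + A * (t0 - t0)) (at_left t0)" by (intro tendsto_intros)
  then have "\<forall>\<^sub>F s in at_left t0. c + A * (t0 - s) < e"
    by (rule order_tendstoD(2)) (use c \<open>0 < e\<close> in simp)
  moreover have "\<forall>\<^sub>F s in at_left t0. b < s"
    using b(2) by (intro order_tendstoD(1)[OF tendsto_ident_at])
  moreover have "\<forall>\<^sub>F s in at_left t0. s < t0" by (auto simp: eventually_at_filter)
  ultimately show ?thesis
  proof eventually_elim
    case (elim s)
    have "?\<phi> s \<le> (c + A * (t0 - s)) * (t0 - s)" using elim by (intro main) auto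
    also have "\<dots> \<le> e * (t0 - s)" using elim by (intro mult_right_mono) auto
    finally show ?case unfolding \<phi> by (simp only: z_def)
  qed
qed

text \<open>The energy increment is the pairing of the increment with \<open>u t0\<close> plus half
  its squared norm. The pairing has the derivative prescribed by the equation, and
  \<open>sq_increment_small_left\<close> makes the square negligible.\<close>

lemma energy_left_derivative:
  assumes t0: "0 < t0"
  shows "((\<lambda>s. (energy \<Omega> (u s) - energy \<Omega> (u t0)) / (s - t0)) \<longlongrightarrow> - bform (u t0) (u t0) (u t0)) (at_left t0)"
proof -
  let ?z = "u t0"
  let ?q = "\<lambda>s. (l2norm M (\<lambda>x. u s x - ?z x))\<^sup>2 / 2 / (s - t0)"
  have z: "?z \<in> X1 \<Omega>" by (rule u_X1[OF t0])
  have zt: "l2norm M (\<lambda>x. u t0 x - ?z x) = 0" by (simp add: l2norm_def)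
  have "(?q \<longlongrightarrow> 0) (at_left t0)"
  proof (rule tendstoI)
    fix e :: real assume "0 < e"
    then have "0 < e / 2" by simp
    from sq_increment_small_left[OF t0 this]
    have "\<forall>\<^sub>F s in at_left t0. (l2norm M (\<lambda>x. u s x - u t0 x))\<^sup>2 / 2 \<le> e / 2 * (t0 - s)" .
    moreover have "\<forall>\<^sub>F s in at_left t0. s < t0" by (auto simp: eventually_at_filter)
    ultimately show "\<forall>\<^sub>F s in at_left t0. dist (?q s) 0 < e"
    proof eventually_elim
      case (elim s)
      have "\<bar>?q s\<bar> = (l2norm M (\<lambda>x. u s x - u t0 x))\<^sup>2 / 2 / (t0 - s)"
        using elim(2) by (simp add: abs_divide)
      also have "\<dots> \<le> e / 2" using elim(2) by (subst pos_divide_le_eq) (use elim(1) in auto)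
      finally show ?case using \<open>0 < e\<close> unfolding dist_real_def diff_0_right by linarith
    qed
  qed
  moreover have "((\<lambda>s. l2inner M (\<lambda>x. u s x - ?z x) ?z / (s - t0)) \<longlongrightarrow> - bform ?z ?z ?z) (at_left t0)"
    using pairing_derivative[OF t0 z] by (rule tendsto_within_subset) simp
  ultimately have "((\<lambda>s. ?q s + l2inner M (\<lambda>x. u s x - ?z x) ?z / (s - t0)) \<longlongrightarrow> 0 + - bform ?z ?z ?z) (at_left t0)"
    by (rule tendsto_add)
  then have "((\<lambda>s. ?q s + l2inner M (\<lambda>x. u s x - ?z x) ?z / (s - t0)) \<longlongrightarrow> - bform ?z ?z ?z) (at_left t0)" by simp
  then show ?thesis
  proof (rule tendsto_cong[THEN iffD1, rotated])
    have "\<forall>\<^sub>F s in at_left t0. 0 < s" using t0 by (intro order_tendstoD(1)[OF tendsto_ident_at])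
    then show "\<forall>\<^sub>F s in at_left t0. ?q s + l2inner M (\<lambda>x. u s x - ?z x) ?z / (s - t0)
        = (energy \<Omega> (u s) - energy \<Omega> (u t0)) / (s - t0)"
      by eventually_elim (use energy_diff[OF _ _ z zt] t0 in \<open>simp add: shifted_energy_def add_divide_distrib\<close>)
  qed
qed

text \<open>At time 0 the derivative is one-sided, and \<open>u0\<close> stands in for
  \<open>u 0\<close>, since membership in \<open>X1\<close> is given for \<open>u0\<close> and at
  positive times. At positive times the two one-sided limits agree.\<close>

lemma energy_derivative:
  assumes t: "0 \<le> t"
  shows "\<exists>V'. ((\<lambda>s. energy \<Omega> (u s)) has_real_derivative V') (at t within {0..}) \<and> V' \<le> 0"
proof (cases "t = 0")
  case True
  have "AE x in M. u 0 x - u0 x = 0" using u_initial by eventually_elim simp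
  then have "l2norm M (\<lambda>x. u 0 x - u0 x) = l2norm M (\<lambda>x. 0 :: real^2)"
    by (intro l2norm_cong_AE sq_integrable_borel[OF sq_integrable_diff[OF u_sq X1_sq[OF u0_X1]]]) auto
  then have "l2norm M (\<lambda>x. u 0 x - u0 x) = 0" by (simp add: l2norm_def)
  from energy_right_derivative[OF _ u0_X1 this]
  have "((\<lambda>s. energy \<Omega> (u s)) has_real_derivative - bform u0 u0 u0) (at_right 0)"
    by (simp add: has_field_derivative_iff)
  moreover have "at 0 within {0..} = at_right (0::real)"
    by (rule at_within_nhd[where S=UNIV]) auto
  ultimately show ?thesis using bform_self_nonneg[OF u0_X1] True by auto
next
  case False
  then have t: "0 < t" using t by simp
  have zt: "l2norm M (\<lambda>x. u t x - u t x) = 0" by (simp add: l2norm_def)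
  have "((\<lambda>s. (energy \<Omega> (u s) - energy \<Omega> (u t)) / (s - t)) \<longlongrightarrow> - bform (u t) (u t) (u t)) (at t)"
    using energy_left_derivative[OF t] energy_right_derivative[OF less_imp_le[OF t] u_X1[OF t] zt]
    by (rule filterlim_split_at_real)
  then have "((\<lambda>s. energy \<Omega> (u s)) has_real_derivative - bform (u t) (u t) (u t)) (at t)"
    by (simp add: has_field_derivative_iff)
  then show ?thesis
    using bform_self_nonneg[OF u_X1[OF t]] has_field_derivative_at_within by force
qed

section \<open>Conservation of the mean and the lower bound\<close>

lemma mean_conserved:
  assumes "0 \<le> t" shows "l2inner M (u t) (\<lambda>x. c) = l2inner M u0 (\<lambda>x. c)"
proof -
  have cX: "(\<lambda>x. c) \<in> X1 \<Omega>" by (rule X1_const)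
  note cs = X1_sq[OF cX]
  let ?f = "\<lambda>s. l2inner M (u s) (\<lambda>x. c)"
  have 0: "?f 0 = l2inner M u0 (\<lambda>x. c)"
    by (rule l2inner_cong_AE[OF sq_integrable_borel[OF u_sq] sq_integrable_borel[OF X1_sq[OF u0_X1]]
          sq_integrable_borel[OF cs] u_initial]) simp
  have "?f t = ?f 0"
  proof (cases "t = 0")
    case False
    show ?thesis
    proof (rule DERIV_isconst_end[of 0 t ?f])
      show "0 < t" using False assms by simp
      \<comment> \<open>The pairing is differentiated only at positive times, so continuity has to
        carry its constancy down to time 0.\<close>
      show "continuous_on {0..t} ?f"
        unfolding continuous_on_def
      proof
        fix r assume r: "r \<in> {0..t}"
        let ?d = "\<lambda>s. l2norm M (\<lambda>x. u s x - u r x)"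
        have "((\<lambda>s. ?d s * l2norm M (\<lambda>x. c)) \<longlongrightarrow> 0 * l2norm M (\<lambda>x. c)) (at r within {0..t})"
          by (intro tendsto_intros tendsto_within_subset[OF u_continuous]) (use r in auto)
        then have lim: "((\<lambda>s. ?d s * l2norm M (\<lambda>x. c)) \<longlongrightarrow> 0) (at r within {0..t})" by simp
        have "((\<lambda>s. ?f s - ?f r) \<longlongrightarrow> 0) (at r within {0..t})"
        proof (rule Lim_null_comparison[OF _ lim])
          have "norm (?f s - ?f r) \<le> ?d s * l2norm M (\<lambda>x. c)" if "0 \<le> s" for s
            using l2_Cauchy_Schwarz[OF sq_integrable_diff[OF u_sq[OF that] u_sq] cs, of r] r
            by (simp add: l2inner_diff_left u_sq cs that)
          then show "\<forall>\<^sub>F s in at r within {0..t}. norm (?f s - ?f r) \<le> ?d s * l2norm M (\<lambda>x. c)"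
            by (auto simp: eventually_at_filter)
        qed
        then show "(?f \<longlongrightarrow> ?f r) (at r within {0..t})" using LIM_zero_iff by blast
      qed
      fix r assume r: "0 < r" "r < t"
      \<comment> \<open>A constant has vanishing Jacobian, so testing the equation with it makes the
        pairing stationary.\<close>
      have "bform (u r) (u r) (\<lambda>x. c) = 0"
        by (intro bform_const u_X1 r(1) sq_integrable_borel[OF X1_sq[OF u_X1[OF r(1)]]])
      then have lim: "((\<lambda>s. l2inner M (\<lambda>x. u s x - u r x) (\<lambda>x. c) / (s - r)) \<longlongrightarrow> 0) (at r)"
        using pairing_derivative[OF r(1) cX] by simp
      have ev: "\<forall>\<^sub>F s in at r. l2inner M (\<lambda>x. u s x - u r x) (\<lambda>x. c) / (s - r) = (?f s - ?f r) / (s - r)"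
      proof -
        have "\<forall>\<^sub>F s in at r. 0 < s" using r(1) by (intro order_tendstoD(1)[OF tendsto_ident_at])
        then show ?thesis
          by eventually_elim (use r in \<open>simp add: l2inner_diff_left u_sq cs\<close>)
      qed
      have "((\<lambda>s. (?f s - ?f r) / (s - r)) \<longlongrightarrow> 0) (at r)"
        by (rule tendsto_cong[THEN iffD1, OF ev lim])
      then show "DERIV ?f r :> 0" by (simp add: has_field_derivative_iff)
    qed
  qed simp
  then show ?thesis using 0 by simp
qed

text \<open>Pythagoras: by conservation the deviation of \<open>u t\<close> from the mean is
  orthogonal to the mean, so its squared norm is the squared norm of \<open>u t\<close> minus that
  of the mean, and it is nonnegative.\<close>

lemma energy_mean_le:
  assumes t: "0 \<le> t" and ne: "\<Omega> \<noteq> {}"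
  shows "energy \<Omega> (\<lambda>_. mean_vec \<Omega> u0) \<le> energy \<Omega> (u t)"
proof -
  let ?m = "mean_vec \<Omega> u0"
  have ms: "sq_integrable M (\<lambda>x. ?m)" by (intro X1_sq X1_const)
  \<comment> \<open>A nonempty open set has positive area, so the division in \<open>mean\<close> is
    a genuine one.\<close>
  have pos: "0 < measure lebesgue \<Omega>"
    using open_not_negligible[OF open_dom ne] lmeasurable_open[OF bounded_dom open_dom]
    by (simp add: negligible_iff_measure zero_less_measure_iff)
  have int: "integrable M (\<lambda>x. u0 x $ i)" for i
  proof -
    have "integrable M (\<lambda>x. u0 x \<bullet> axis i 1)"
      by (intro sq_integrable_inner X1_sq u0_X1 X1_const)
    then show ?thesis by (simp add: inner_axis)
  qed
  have mi: "(\<integral>x. u0 x $ i \<partial>M) = measure lebesgue \<Omega> * ?m $ i" for i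
    using pos by (simp add: mean_vec_def mean_def)
  have msq: "(l2norm M (\<lambda>x. ?m))\<^sup>2 = measure lebesgue \<Omega> * (?m \<bullet> ?m)"
    using open_dom by (simp add: l2norm_sq power2_norm_eq_inner measure_restrict_space borel_open)
  \<comment> \<open>Conservation, applied to the constant vector \<open>?m\<close>, transfers the
    pairing to \<open>u0\<close>, whose mean is \<open>?m\<close> by definition.\<close>
  have "l2inner M (u t) (\<lambda>x. ?m) = l2inner M u0 (\<lambda>x. ?m)" by (rule mean_conserved[OF t])
  also have "\<dots> = (\<Sum>i\<in>UNIV. (\<integral>x. u0 x $ i \<partial>M) * ?m $ i)"
    unfolding l2inner_def inner_vec_def inner_real_def using int
    by (subst Bochner_Integration.integral_sum) auto
  also have "\<dots> = (l2norm M (\<lambda>x. ?m))\<^sup>2"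
    unfolding mi msq by (simp add: inner_vec_def sum_distrib_left mult.assoc)
  finally have "l2inner M (u t) (\<lambda>x. ?m) = (l2norm M (\<lambda>x. ?m))\<^sup>2" .
  moreover have "(l2norm M (\<lambda>x. u t x + - ?m))\<^sup>2 =
      (l2norm M (u t))\<^sup>2 + 2 * l2inner M (u t) (\<lambda>x. - ?m) + (l2norm M (\<lambda>x. - ?m))\<^sup>2"
    by (intro l2norm_sq_add u_sq t sq_integrable_minus ms)
  ultimately have "(l2norm M (\<lambda>x. u t x + - ?m))\<^sup>2 = (l2norm M (u t))\<^sup>2 - (l2norm M (\<lambda>x. ?m))\<^sup>2"
    by (simp add: l2inner_minus_right l2norm_minus)
  then show ?thesis
    using zero_le_power2[of "l2norm M (\<lambda>x. u t x + - ?m)"] by (simp add: energy_eq)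
qed

end

theorem lemma5:
  fixes \<Omega> :: "(real^2) set"
    and D :: "real^2 \<Rightarrow> real^2^2"
    and u0 :: "real^2 \<Rightarrow> real^2"
    and u :: "real \<Rightarrow> real^2 \<Rightarrow> real^2"
  assumes "open \<Omega>" and "connected \<Omega>" and "bounded \<Omega>" and "\<Omega> \<noteq> {}"
    and "uniformly_elliptic D"
    and "entries_lipschitz D"
    and "entries_bounded D"
    and "u0 \<in> X1 \<Omega>"
    and "\<And>T. T > 0 \<Longrightarrow> weak_solution \<Omega> D u0 T u"
  shows "lyapunov \<Omega> u0 u (energy \<Omega>)"
proof -
  obtain \<alpha> where \<alpha>: "0 < \<alpha>" "\<And>z \<xi>. \<alpha> * (norm \<xi>)\<^sup>2 \<le> \<xi> \<bullet> (D z *v \<xi>)"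
    using assms(5) unfolding uniformly_elliptic_def by blast
  obtain L where L: "0 < L" "\<And>y z i j. \<bar>D z $ i $ j - D y $ i $ j\<bar> \<le> L * norm (z - y)"
    using assms(6) unfolding entries_lipschitz_def by blast
  obtain K where K: "0 < K" "\<And>z i j. \<bar>D z $ i $ j\<bar> \<le> K"
    using assms(7) unfolding entries_bounded_def by blast
  interpret weak_solution_curve \<Omega> D L K \<alpha> u0 u
    by unfold_locales (use assms \<alpha> L K in auto)
  show ?thesis
    unfolding lyapunov_def using energy_derivative energy_mean_le assms(4) by blast
qed

end
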